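(* Let $d\geq 2$, $\mu>0$ and $\lambda+\mu\geq 0$. There exists a constant $c_{\frac d2,d,\lambda,\mu}>0$, depending only on $d,\lambda,\mu$, such that for every real-valued $a\in L^\infty(\mathbb{R}^d;\mathbb{R})$ the following holds. (i) If $a_-\in L^d(\mathbb{R}^d)$ and $c_{\frac d2,d,\lambda,\mu}\,\|a_-\|_{L^d(\mathbb{R}^d)}^d<1$, then the damped elastic wave operator $A_a^\ast$ has no positive eigenvalues. (ii) If $a_+\in L^d(\mathbb{R}^d)$ and $c_{\frac d2,d,\lambda,\mu}\,\|a_+\|_{L^d(\mathbb{R}^d)}^d<1$, then $A_a^\ast$ has no negative eigenvalues.
   Context: The Lamé operator acts on vector fields $u:\mathbb{R}^d\to\mathbb{C}^d$ by $-\Delta^\ast u=-\mu\Delta u-(\lambda+\mu)\nabla\operatorname{div}u$, with domain $H^2(\mathbb{R}^d)^d$, where $H^2(\mathbb{R}^d)^d=H^2(\mathbb{R}^d;\mathbb{C}^d)$. For a bounded damping $a$ (a scalar function is identified with $a$ times the $d\times d$ identity matrix), the damped elastic wave operator is $$A_a^\ast=\begin{pmatrix}0&1\\ \Delta^\ast&-a\end{pmatrix},\qquad \mathcal{D}(A_a^\ast)=H^2(\mathbb{R}^d)^d\times\dot H^1(\mathbb{R}^d)^d,$$ where $\dot H^1$ is the homogeneous Sobolev space. A number $z\in\mathbb{C}$ is an eigenvalue of $A_a^\ast$ if there is a non-trivial $(\psi_1,\psi_2)\in\mathcal{D}(A_a^\ast)$ with $\psi_2=z\psi_1$ and $\Delta^\ast\psi_1-a\psi_2=z\psi_2$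 almost everywhere. The positive and negative parts of $a$ are $a_\pm(x)=\max\{\pm a(x),0\}$. *)

theory Defs
  imports "HOL-Analysis.Analysis"
begin

text \<open>Elements of Lebesgue and Sobolev spaces are represented by functions; equality of
  elements is equality almost everywhere with respect to Lebesgue measure.\<close>

subsection \<open>Lebesgue spaces\<close>

definition Lp :: "real \<Rightarrow> ((real^'n::finite) \<Rightarrow> 'b::real_normed_vector) set" where
  "Lp p = {f \<in> borel_measurable lebesgue. integrable lebesgue (\<lambda>x. norm (f x) powr p)}"

text \<open>Only meaningful for members of \<^term>\<open>Lp p\<close>: the Bochner integral of a
  non-integrable function is zero.\<close>

definition Lp_norm :: "real \<Rightarrow> ((real^'n::finite) \<Rightarrow> 'b::real_normed_vector) \<Rightarrow> real" where
  "Lp_norm p f = (\<integral>x. norm (f x) powr p \<partial>lebesgue) powr (1 / p)"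

definition Linfty :: "((real^'n::finite) \<Rightarrow> 'b::real_normed_vector) set" where
  "Linfty = {f \<in> borel_measurable lebesgue. \<exists>C. AE x in lebesgue. norm (f x) \<le> C}"

definition locally_integrable :: "((real^'n::finite) \<Rightarrow> complex) \<Rightarrow> bool" where
  "locally_integrable f \<longleftrightarrow> (\<forall>K. compact K \<longrightarrow> f absolutely_integrable_on K)"

definition pos_part :: "('a \<Rightarrow> real) \<Rightarrow> 'a \<Rightarrow> real" where
  "pos_part a x = max (a x) 0"

definition neg_part :: "('a \<Rightarrow> real) \<Rightarrow> 'a \<Rightarrow> real" where
  "neg_part a x = max (- a x) 0"

subsection \<open>Test functions and weak derivatives\<close>

definition partial :: "'n::finite \<Rightarrow> ((real^'n) \<Rightarrow> complex) \<Rightarrow> (real^'n) \<Rightarrow> complex" where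
  "partial i f x = frechet_derivative f (at x) (axis i 1)"

primrec C_k :: "nat \<Rightarrow> ((real^'n::finite) \<Rightarrow> complex) \<Rightarrow> bool" where
  "C_k 0 f \<longleftrightarrow> continuous_on UNIV f"
| "C_k (Suc k) f \<longleftrightarrow> (\<forall>x. f differentiable (at x)) \<and> (\<forall>i. C_k k (partial i f))"

definition test_functions :: "((real^'n::finite) \<Rightarrow> complex) set" where
  "test_functions = {\<phi>. (\<forall>k. C_k k \<phi>) \<and> compact (closure {x. \<phi> x \<noteq> 0})}"

definition has_weak_partial ::
    "'n::finite \<Rightarrow> ((real^'n) \<Rightarrow> complex) \<Rightarrow> ((real^'n) \<Rightarrow> complex) \<Rightarrow> bool" where
  "has_weak_partial i f g \<longleftrightarrow> locally_integrable f \<and> locally_integrable g \<and>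
     (\<forall>\<phi>\<in>test_functions.
        (\<integral>x. f x * partial i \<phi> x \<partial>lebesgue) = - (\<integral>x. g x * \<phi> x \<partial>lebesgue))"

text \<open>A representative of the weak derivative, which is unique up to null sets if it
  exists; unspecified otherwise.\<close>

definition weak_partial :: "'n::finite \<Rightarrow> ((real^'n) \<Rightarrow> complex) \<Rightarrow> (real^'n) \<Rightarrow> complex" where
  "weak_partial i f = (SOME g. has_weak_partial i f g)"

subsection \<open>Sobolev spaces\<close>

primrec Sobolev :: "nat \<Rightarrow> ((real^'n::finite) \<Rightarrow> complex) set" where
  "Sobolev 0 = Lp 2"
| "Sobolev (Suc k) = {f \<in> Lp 2. \<forall>i. \<exists>g\<in>Sobolev k. has_weak_partial i f g}"

text \<open>The homogeneous space is the completion of the test functions with respect to the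
  \<open>L\<^sup>2\<close> norm of the gradient, realised by locally integrable functions.  If \<open>d \<ge> 3\<close> the
  realisation is unique, by the Sobolev embedding into \<open>L\<close>-exponent \<open>2d / (d - 2)\<close>.  If \<open>d = 2\<close>
  it is unique only up to constants (which are themselves limits of test functions), and the
  set consists of all locally integrable functions with square integrable weak gradient.\<close>

definition homogeneous_Sobolev1 :: "((real^'n::finite) \<Rightarrow> complex) set" where
  "homogeneous_Sobolev1 = {u. locally_integrable u \<and>
     (\<exists>g \<phi>. (\<forall>i. g i \<in> Lp 2 \<and> has_weak_partial i u (g i)) \<and>
       (\<forall>k::nat. \<phi> k \<in> test_functions) \<and>
       (\<forall>K. compact K \<longrightarrow> (\<lambda>k. LINT x:K|lebesgue. norm (\<phi> k x - u x)) \<longlonglongrightarrow> 0) \<and>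
       (\<forall>i. (\<lambda>k. Lp_norm 2 (\<lambda>x. partial i (\<phi> k) x - g i x)) \<longlonglongrightarrow> 0))}"

definition vector_fields ::
    "((real^'n::finite) \<Rightarrow> complex) set \<Rightarrow> ((real^'n) \<Rightarrow> complex^'n) set" where
  "vector_fields S = {u. \<forall>j. (\<lambda>x. u x $ j) \<in> S}"

subsection \<open>The Lame operator and the damped elastic wave operator\<close>

definition divergence :: "((real^'n::finite) \<Rightarrow> complex^'n) \<Rightarrow> (real^'n) \<Rightarrow> complex" where
  "divergence u x = (\<Sum>i\<in>UNIV. weak_partial i (\<lambda>y. u y $ i) x)"

definition gradient :: "((real^'n::finite) \<Rightarrow> complex) \<Rightarrow> (real^'n) \<Rightarrow> complex^'n" where
  "gradient f x = (\<chi> i. weak_partial i f x)"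

definition laplacian :: "((real^'n::finite) \<Rightarrow> complex^'n) \<Rightarrow> (real^'n) \<Rightarrow> complex^'n" where
  "laplacian u x = (\<chi> j. \<Sum>i\<in>UNIV. weak_partial i (weak_partial i (\<lambda>y. u y $ j)) x)"

text \<open>This is \<open>\<Delta>\<^sup>*\<close>, that is, the negative of the (nonnegative) Lame operator.\<close>

definition Lame_Delta ::
    "real \<Rightarrow> real \<Rightarrow> ((real^'n::finite) \<Rightarrow> complex^'n) \<Rightarrow> (real^'n) \<Rightarrow> complex^'n" where
  "Lame_Delta lam mu u x =
     mu *\<^sub>R laplacian u x + (lam + mu) *\<^sub>R gradient (divergence u) x"

definition damped_wave_domain ::
    "(((real^'n::finite) \<Rightarrow> complex^'n) \<times> ((real^'n) \<Rightarrow> complex^'n)) set" where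
  "damped_wave_domain = vector_fields (Sobolev 2) \<times> vector_fields homogeneous_Sobolev1"

definition damped_wave ::
    "real \<Rightarrow> real \<Rightarrow> ((real^'n::finite) \<Rightarrow> complex^'n^'n) \<Rightarrow>
     ((real^'n) \<Rightarrow> complex^'n) \<times> ((real^'n) \<Rightarrow> complex^'n) \<Rightarrow>
     ((real^'n) \<Rightarrow> complex^'n) \<times> ((real^'n) \<Rightarrow> complex^'n)" where
  "damped_wave lam mu a = (\<lambda>(\<psi>1, \<psi>2). (\<psi>2, \<lambda>x. Lame_Delta lam mu \<psi>1 x - a x *v \<psi>2 x))"

definition scalar_damping :: "((real^'n::finite) \<Rightarrow> real) \<Rightarrow> (real^'n) \<Rightarrow> complex^'n^'n" where
  "scalar_damping a x = mat (complex_of_real (a x))"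

definition damped_wave_eigenvalue ::
    "real \<Rightarrow> real \<Rightarrow> ((real^'n::finite) \<Rightarrow> complex^'n^'n) \<Rightarrow> complex \<Rightarrow> bool" where
  "damped_wave_eigenvalue lam mu a z \<longleftrightarrow>
     (\<exists>\<psi>\<in>damped_wave_domain.
        \<not> (AE x in lebesgue. fst \<psi> x = 0 \<and> snd \<psi> x = 0) \<and>
        (AE x in lebesgue. fst (damped_wave lam mu a \<psi>) x = z *s fst \<psi> x) \<and>
        (AE x in lebesgue. snd (damped_wave lam mu a \<psi>) x = z *s snd \<psi> x))"

end

theory Submission
  imports Defs
begin

text \<open>Let \<open>u\<close> be the first component of an eigenfunction for a real eigenvalue \<open>r \<noteq> 0\<close>, and let
  \<open>n\<close> be \<open>a\<^sub>-\<close> if \<open>r > 0\<close> and \<open>a\<^sub>+\<close> if \<open>r < 0\<close>.  Pairing the eigenvalue equation with \<open>u\<close> and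
  integrating by parts gives
  \<open>\<mu> \<parallel>\<nabla>u\<parallel>\<^sup>2 + (\<lambda> + \<mu>) \<parallel>div u\<parallel>\<^sup>2 + r\<^sup>2 \<parallel>u\<parallel>\<^sup>2 = - r \<integral> a |u|\<^sup>2 \<le> |r| \<integral> n |u|\<^sup>2\<close>.  Gagliardo's form of the
  \<open>L\<^sup>1\<close> Sobolev inequality, applied to \<open>|u\<^sub>j|\<^sup>2\<close>, yields
  \<open>\<integral> n |u\<^sub>j|\<^sup>2 \<le> 2 \<parallel>n\<parallel> \<parallel>u\<^sub>j\<parallel> \<parallel>\<nabla>u\<^sub>j\<parallel>\<close> with the \<open>L\<^sup>d\<close> norm of \<open>n\<close>, so the right-hand side is at most
  \<open>\<mu>\<close> to the power \<open>- 1 / 2\<close> times \<open>\<parallel>n\<parallel> (\<mu> \<parallel>\<nabla>u\<parallel>\<^sup>2 + r\<^sup>2 \<parallel>u\<parallel>\<^sup>2)\<close>.  Hence \<open>u = 0\<close> as soon as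
  \<open>\<parallel>n\<parallel>\<^sup>2 < \<mu>\<close>, and the constant is \<open>\<mu>\<close> to the power \<open>- d / 2\<close>.\<close>

section \<open>Smooth test functions\<close>

text \<open>What could spoil a bound uniform in the eigenvalue is the factor |r| in front of the
  damping term. It is absorbed exactly, because the estimate of the weighted integral has degree one
  in the norm of u_j and degree one in the norm of its gradient: with X and Y for these norms, 2
  (|r| X) (sqrt \<mu> Y) is at most r^2 X^2 + \<mu> Y^2. The power d in the smallness condition only
  encodes the comparison of the \<open>L\<^sup>d\<close> norm with sqrt \<mu>. The weight takes part
  in the Gagliardo argument as one more factor, instead of being split off by Hoelder with the dual
  exponent d / (d - 1); all estimates then involve integer powers only. The obstacle is regularity.
  The estimate along lines is proved for smooth functions with bounded support, while u lies in a
  Sobolev space defined by duality with such functions. Test functions are therefore shown to be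
  dense in the first-order space, by mollification and cutoff; the same density justifies the
  integration by parts. Since Tonelli and translations are applied to Borel functions, Lebesgue
  measurable data pass through Borel representatives.\<close>

lemma partial_eqI:
  assumes "(f has_derivative f') (at x)"
  shows "partial i f x = f' (axis i 1)"
  using frechet_derivative_at[OF assms] by (simp add: partial_def)

lemma C_k_imp_continuous: "C_k k f \<Longrightarrow> continuous_on UNIV f"
  by (cases k) (simp_all add: differentiable_imp_continuous_on differentiable_on_def
      differentiable_at_withinI)

lemma C_k_SucD: "C_k (Suc k) f \<Longrightarrow> C_k k f"
proof (induction k arbitrary: f)
  case 0
  then show ?case using C_k_imp_continuous[OF 0] by simp
next
  case (Suc k)
  then show ?case by (metis C_k.simps(2))
qed

text \<open>Since \<open>partial\<close> refers to the selected Frechet derivative, any known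
  derivative formula identifies it by uniqueness. Each closure property of \<open>C_k\<close> then
  becomes one derivative rule plus the induction hypothesis.\<close>

lemma C_k_Suc_derivI:
  assumes "\<And>x. (f has_derivative f' x) (at x)" and "\<And>i. C_k k (\<lambda>x. f' x (axis i 1))"
  shows "C_k (Suc k) f"
proof -
  have "partial i f = (\<lambda>x. f' x (axis i 1))" for i
    using assms(1) by (auto intro: partial_eqI)
  then show ?thesis using assms by (auto simp: differentiable_def)
qed

lemma C_k_has_derivative:
  "C_k (Suc k) f \<Longrightarrow> (f has_derivative frechet_derivative f (at x)) (at x)"
  by (simp add: frechet_derivative_works)

lemma C_k_partial: "C_k (Suc k) f \<Longrightarrow> C_k k (partial i f)"
  by simp

lemma C_k_const: "C_k k (\<lambda>x. c)"
proof (induction k arbitrary: c)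
  case (Suc k)
  show ?case by (rule C_k_Suc_derivI[OF has_derivative_const]) (rule Suc)
qed simp

lemma C_k_add: "C_k k f \<Longrightarrow> C_k k g \<Longrightarrow> C_k k (\<lambda>x. f x + g x)"
proof (induction k arbitrary: f g)
  case 0
  then show ?case by (simp add: continuous_on_add)
next
  case (Suc k)
  note d = has_derivative_add[OF Suc.prems[THEN C_k_has_derivative]]
  show ?case
    by (rule C_k_Suc_derivI[OF d])
      (rule Suc.IH[OF Suc.prems[THEN C_k_partial, unfolded partial_def [abs_def]]])
qed

lemma C_k_mult: "C_k k f \<Longrightarrow> C_k k g \<Longrightarrow> C_k k (\<lambda>x. f x * g x)"
proof (induction k arbitrary: f g)
  case 0
  then show ?case by (simp add: continuous_on_mult)
next
  case (Suc k)
  note d = has_derivative_mult[OF Suc.prems[THEN C_k_has_derivative]]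
  note p = Suc.prems[THEN C_k_partial, unfolded partial_def [abs_def]]
  show ?case
    by (rule C_k_Suc_derivI[OF d])
      (intro C_k_add Suc.IH p Suc.prems[THEN C_k_SucD])
qed

lemma C_k_prod: "finite I \<Longrightarrow> (\<And>i. i \<in> I \<Longrightarrow> C_k k (f i)) \<Longrightarrow> C_k k (\<lambda>x. \<Prod>i\<in>I. f i x)"
  by (induction I rule: finite_induct) (auto intro: C_k_const C_k_mult)

lemma C_k_cnj: "C_k k f \<Longrightarrow> C_k k (\<lambda>x. cnj (f x))"
proof (induction k arbitrary: f)
  case 0
  then show ?case by (simp add: continuous_on_cnj)
next
  case (Suc k)
  note d = has_derivative_cnj[OF Suc.prems[THEN C_k_has_derivative]]
  show ?case
    by (rule C_k_Suc_derivI[OF d])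
      (rule Suc.IH[OF Suc.prems[THEN C_k_partial, unfolded partial_def [abs_def]]])
qed

lemma has_derivative_affine:
  fixes f :: "(real^'n::finite) \<Rightarrow> complex"
  assumes "C_k (Suc k) f"
  shows "((\<lambda>x. f (c *\<^sub>R x + b)) has_derivative
    (\<lambda>h. of_real c * frechet_derivative f (at (c *\<^sub>R x + b)) h)) (at x)"
proof -
  note d = C_k_has_derivative[OF assms]
  have "((\<lambda>x. c *\<^sub>R x + b) has_derivative (\<lambda>h. c *\<^sub>R h)) (at x)"
    by (rule derivative_eq_intros refl | simp)+
  from has_derivative_compose[OF this d] show ?thesis
    unfolding linear_simps(5)[OF has_derivative_bounded_linear[OF d]]
    unfolding scaleR_conv_of_real[where 'a=complex] .
qed

lemma C_k_affine:
  fixes f :: "(real^'n::finite) \<Rightarrow> complex"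
  shows "C_k k f \<Longrightarrow> C_k k (\<lambda>x. f (c *\<^sub>R x + b))"
proof (induction k arbitrary: f)
  case 0
  have "continuous_on UNIV (\<lambda>x::real^'n. c *\<^sub>R x + b)"
    by (intro continuous_intros)
  then show ?case using continuous_on_compose2[of UNIV f UNIV] 0 by auto
next
  case (Suc k)
  show ?case
    by (rule C_k_Suc_derivI[OF has_derivative_affine[OF Suc.prems]])
      (intro C_k_mult C_k_const Suc.IH[OF Suc.prems[THEN C_k_partial, unfolded partial_def [abs_def]]])
qed

lemma partial_affine:
  assumes "C_k (Suc k) f"
  shows "partial i (\<lambda>x. f (c *\<^sub>R x + b)) x = of_real c * partial i f (c *\<^sub>R x + b)"
  unfolding partial_eqI[OF has_derivative_affine[OF assms]] by (simp add: partial_def)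

lemma partial_mult:
  assumes "C_k (Suc k) f" "C_k (Suc k) g"
  shows "partial i (\<lambda>x. f x * g x) x = f x * partial i g x + partial i f x * g x"
  unfolding partial_eqI[OF has_derivative_mult[OF assms[THEN C_k_has_derivative]]]
  by (simp add: partial_def)

lemma partial_cnj:
  assumes "C_k (Suc k) f"
  shows "partial i (\<lambda>x. cnj (f x)) x = cnj (partial i f x)"
  unfolding partial_eqI[OF has_derivative_cnj[OF assms[THEN C_k_has_derivative]]]
  by (simp add: partial_def)

text \<open>Closing the family \<open>exp (- 1 / t) / t\<^sup>n\<close> (extended by zero) under differentiation makes
  smoothness a one-line induction.\<close>

definition flat :: "nat \<Rightarrow> real \<Rightarrow> real" where
  "flat n t = (if t > 0 then exp (- (1 / t)) / t ^ n else 0)"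

lemma flat_deriv: "(flat n has_real_derivative flat (n + 2) t - n * flat (n + 1) t) (at t)"
proof -
  consider "t > 0" | "t < 0" | "t = 0" using linorder_less_linear[of t 0] by blast
  then show ?thesis
  proof cases
    case 1
    have "((\<lambda>t. exp (- (1 / t)) / t ^ n) has_real_derivative flat (n + 2) t - n * flat (n + 1) t) (at t)"
      using 1 by (auto intro!: derivative_eq_intros)
        (cases n; simp add: flat_def field_simps power2_eq_square)
    then show ?thesis
      by (rule has_field_derivative_transform_within_open[where S="{0<..}"])
        (use 1 in \<open>auto simp: flat_def\<close>)
  next
    case 2
    then have "((\<lambda>t. 0) has_real_derivative flat (n + 2) t - n * flat (n + 1) t) (at t)"
      by (simp add: flat_def)
    then show ?thesis
      by (rule has_field_derivative_transform_within_open[where S="{..<0}"])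
        (use 2 in \<open>auto simp: flat_def\<close>)
  next
    case 3
    \<comment> \<open>This is the difference quotient at 0. From the right, s = 1 / y turns it into
      s ^ (n + 1) / exp s; from the left it vanishes identically.\<close>
    have "((\<lambda>y. flat n y / y) \<longlongrightarrow> 0) (at 0)"
    proof (rule filterlim_split_at)
      have "((\<lambda>y. (inverse y) ^ (n + 1) / exp (inverse y)) \<longlongrightarrow> 0) (at_right (0::real))"
        by (rule filterlim_compose[OF tendsto_power_div_exp_0 filterlim_inverse_at_top_right])
      then show "((\<lambda>y. flat n y / y) \<longlongrightarrow> 0) (at_right 0)"
        by (rule Lim_transform_eventually)
          (auto simp: eventually_at_filter flat_def exp_minus field_simps)
      show "((\<lambda>y. flat n y / y) \<longlongrightarrow> 0) (at_left 0)"
        by (rule Lim_transform_eventually[OF tendsto_const])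
          (auto simp: eventually_at_filter flat_def)
    qed
    then show ?thesis
      unfolding 3 has_field_derivative_iff by (simp add: flat_def)
  qed
qed

text \<open>The index \<open>n\<close> has to stay arbitrary in the induction, since differentiation
  leads to \<open>n + 1\<close> and \<open>n + 2\<close>. An affine function of one coordinate
  inside is the form in which the bumps below use \<open>flat\<close>.\<close>

lemma C_k_flat: "C_k k (\<lambda>x::real^'n::finite. of_real (flat n (c * x $ j + b)))"
proof (induction k arbitrary: n)
  case 0
  have "continuous_on UNIV (flat n)" for n
    using flat_deriv by (intro DERIV_continuous_on) (auto intro: has_field_derivative_at_within)
  moreover have "continuous_on UNIV (\<lambda>x::real^'n. c * x $ j + b)"
    by (intro continuous_intros)
  ultimately have "continuous_on UNIV (\<lambda>x::real^'n. flat n (c * x $ j + b))"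
    by (rule continuous_on_compose2) auto
  then show ?case by (simp add: continuous_on_of_real)
next
  case (Suc k)
  let ?g = "\<lambda>t. flat (n + 2) t - n * flat (n + 1) t"
  have lin: "((\<lambda>x. c * x $ j + b) has_derivative (\<lambda>h. c * h $ j)) (at x)" for x :: "real^'n"
    by (intro has_derivative_add_const has_derivative_mult_right bounded_linear_imp_has_derivative
        bounded_linear_vec_nth)
  have fl: "(flat n has_derivative (\<lambda>h. ?g t * h)) (at t)" for t
    using flat_deriv[of n t, THEN has_field_derivative_imp_has_derivative] .
  note d = has_derivative_of_real[OF has_derivative_compose[OF lin fl]]
  show ?case
  proof (rule C_k_Suc_derivI[OF d])
    fix i
    have "C_k k (\<lambda>x. of_real (c * axis i 1 $ j) * (of_real (flat (n + 2) (c * x $ j + b)) +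
       - of_real n * of_real (flat (n + 1) (c * x $ j + b))))"
      by (intro C_k_mult C_k_add C_k_const Suc)
    then show "C_k k (\<lambda>x. complex_of_real (?g (c * x $ j + b) * (c * axis i 1 $ j)))"
      by (simp add: algebra_simps)
  qed
qed

lemma flat_bounds: "0 \<le> flat 0 t" "flat 0 t \<le> 1"
  by (auto simp: flat_def)

section \<open>Closure properties and boundedness of test functions\<close>

lemma test_functionsI:
  "(\<And>k. C_k k \<phi>) \<Longrightarrow> bounded {x. \<phi> x \<noteq> 0} \<Longrightarrow> \<phi> \<in> test_functions"
  by (simp add: test_functions_def)

lemma test_functions_C_k: "\<phi> \<in> test_functions \<Longrightarrow> C_k k \<phi>"
  and test_functions_bounded_support: "\<phi> \<in> test_functions \<Longrightarrow> bounded {x. \<phi> x \<noteq> 0}"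
  by (auto simp: test_functions_def)

lemma test_functions_partial:
  assumes "\<phi> \<in> test_functions"
  shows "partial i \<phi> \<in> test_functions"
proof (rule test_functionsI)
  show "C_k k (partial i \<phi>)" for k
    by (rule C_k_partial[OF test_functions_C_k[OF assms]])
  have "partial i \<phi> x = 0" if "x \<notin> closure {x. \<phi> x \<noteq> 0}" for x
  proof -
    have "(\<phi> has_derivative (\<lambda>h. 0)) (at x)"
    proof (rule has_derivative_transform_within_open[OF has_derivative_const])
      show "open (- closure {x. \<phi> x \<noteq> 0})" by (intro open_Compl closed_closure)
      show "x \<in> - closure {x. \<phi> x \<noteq> 0}" using that by simp
      show "0 = \<phi> y" if "y \<in> - closure {x. \<phi> x \<noteq> 0}" for y
        using that closure_subset[of "{x. \<phi> x \<noteq> 0}"] by auto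
    qed
    from partial_eqI[OF this] show ?thesis by simp
  qed
  then have "{x. partial i \<phi> x \<noteq> 0} \<subseteq> closure {x. \<phi> x \<noteq> 0}"
    by auto
  then show "bounded {x. partial i \<phi> x \<noteq> 0}"
    using bounded_subset bounded_closure test_functions_bounded_support[OF assms] by blast
qed

lemma test_functions_mult:
  assumes "\<And>k. C_k k f" "\<phi> \<in> test_functions"
  shows "(\<lambda>x. f x * \<phi> x) \<in> test_functions"
  by (rule test_functionsI[OF C_k_mult[OF assms(1) test_functions_C_k[OF assms(2)]]])
    (auto intro: bounded_subset[OF test_functions_bounded_support[OF assms(2)]])

lemma test_functions_cnj:
  assumes "\<phi> \<in> test_functions"
  shows "(\<lambda>x. cnj (\<phi> x)) \<in> test_functions"
  by (rule test_functionsI[OF C_k_cnj[OF test_functions_C_k[OF assms]]])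
    (use test_functions_bounded_support[OF assms] in simp)

lemma test_functions_affine:
  fixes \<phi> :: "(real^'n::finite) \<Rightarrow> complex"
  assumes "\<phi> \<in> test_functions" "c \<noteq> 0"
  shows "(\<lambda>x. \<phi> (c *\<^sub>R x + b)) \<in> test_functions"
proof (rule test_functionsI[OF C_k_affine[OF test_functions_C_k[OF assms(1)]]])
  let ?S = "{x. \<phi> x \<noteq> 0}"
  have "{x. \<phi> (c *\<^sub>R x + b) \<noteq> 0} \<subseteq> (\<lambda>y. (1 / c) *\<^sub>R y - (1 / c) *\<^sub>R b) ` ?S"
  proof
    fix x assume "x \<in> {x. \<phi> (c *\<^sub>R x + b) \<noteq> 0}"
    then show "x \<in> (\<lambda>y. (1 / c) *\<^sub>R y - (1 / c) *\<^sub>R b) ` ?S"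
      using assms(2) by (intro image_eqI[where x="c *\<^sub>R x + b"]) (auto simp: scaleR_add_right)
  qed
  moreover have "bounded ((\<lambda>y. (1 / c) *\<^sub>R y - (1 / c) *\<^sub>R b) ` ?S)"
    using bounded_translation_minus[OF bounded_scaling[OF test_functions_bounded_support[OF assms(1)]]]
    by (simp add: image_image)
  ultimately show "bounded {x. \<phi> (c *\<^sub>R x + b) \<noteq> 0}"
    by (rule bounded_subset[rotated])
qed

lemma test_functions_continuous: "\<phi> \<in> test_functions \<Longrightarrow> continuous_on UNIV \<phi>"
  using test_functions_C_k C_k_imp_continuous by blast

lemma test_functions_borel: "\<phi> \<in> test_functions \<Longrightarrow> \<phi> \<in> borel_measurable borel"
  by (intro borel_measurable_continuous_onI test_functions_continuous)

lemma borel_imp_lebesgue_measurable: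
  "f \<in> borel_measurable borel \<Longrightarrow> f \<in> borel_measurable lebesgue"
  by (simp add: measurable_completion)

lemma test_functions_bounded:
  assumes "\<phi> \<in> test_functions"
  obtains B where "B > 0" "\<And>x. norm (\<phi> x) \<le> B"
proof -
  let ?K = "closure {x. \<phi> x \<noteq> 0}"
  have "compact ?K" using test_functions_bounded_support[OF assms] by simp
  then have "compact (\<phi> ` ?K)"
    using compact_continuous_image continuous_on_subset test_functions_continuous[OF assms] by blast
  then obtain B where B: "B > 0" "\<And>y. y \<in> \<phi> ` ?K \<Longrightarrow> norm y \<le> B"
    using bounded_normE compact_imp_bounded
    by (metis bounded_pos)
  have "norm (\<phi> x) \<le> B" for x
  proof (cases "x \<in> ?K")
    case False
    then have "\<phi> x = 0" using closure_subset[of "{x. \<phi> x \<noteq> 0}"] by auto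
    then show ?thesis using B(1) by simp
  qed (use B(2) in auto)
  with B(1) show ?thesis using that by blast
qed

text \<open>Guarantees that the pairings in \<open>has_weak_partial\<close> are genuine integrals
  and not the default value zero.\<close>

lemma locally_integrable_mult_test:
  assumes "locally_integrable f" "\<phi> \<in> test_functions"
  shows "integrable lebesgue (\<lambda>x. f x * \<phi> x)"
proof -
  let ?K = "closure {x. \<phi> x \<noteq> 0}"
  have "compact ?K" using test_functions_bounded_support[OF assms(2)] by simp
  with assms(1) have f: "integrable lebesgue (\<lambda>x. indicat_real ?K x *\<^sub>R f x)"
    unfolding locally_integrable_def set_integrable_def by blast
  obtain B where "B > 0" and B: "\<And>x. norm (\<phi> x) \<le> B" using test_functions_bounded[OF assms(2)] by blast
  have eq: "f x * \<phi> x = indicat_real ?K x *\<^sub>R f x * \<phi> x" for x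
    using closure_subset[of "{x. \<phi> x \<noteq> 0}"] by (auto simp: indicator_def)
  have "integrable lebesgue (\<lambda>x. indicat_real ?K x *\<^sub>R f x * \<phi> x)"
  proof (rule Bochner_Integration.integrable_bound)
    show "integrable lebesgue (\<lambda>x. B * norm (indicat_real ?K x *\<^sub>R f x))"
      using f by (intro integrable_mult_right integrable_norm)
    show "(\<lambda>x. indicat_real ?K x *\<^sub>R f x * \<phi> x) \<in> borel_measurable lebesgue"
      using borel_measurable_integrable[OF f]
        borel_imp_lebesgue_measurable[OF test_functions_borel[OF assms(2)]]
      by (rule borel_measurable_times)
    show "AE x in lebesgue. norm (indicat_real ?K x *\<^sub>R f x * \<phi> x)
        \<le> norm (B * norm (indicat_real ?K x *\<^sub>R f x))"
    proof (rule AE_I2)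
      fix x
      have "norm (indicat_real ?K x *\<^sub>R f x) * norm (\<phi> x) \<le> B * norm (indicat_real ?K x *\<^sub>R f x)"
        using mult_left_mono[OF B norm_ge_zero, of "indicat_real ?K x *\<^sub>R f x" x]
        by (simp add: mult.commute)
      then show "norm (indicat_real ?K x *\<^sub>R f x * \<phi> x) \<le> norm (B * norm (indicat_real ?K x *\<^sub>R f x))"
        using \<open>B > 0\<close> by (simp add: norm_mult abs_mult mult.assoc)
    qed
  qed
  then show ?thesis by (simp only: eq)
qed

section \<open>Smooth bumps on boxes and the fundamental lemma of the calculus of variations\<close>

text \<open>Each factor is exp (- 1 / t), where t is k times the signed distance to one face of the
  box. Growing \<open>k\<close> steepens the bump towards the indicator of the open box, while the
  set where it is nonzero stays the same.\<close>

definition box_bump :: "real \<Rightarrow> (real^'n::finite) \<Rightarrow> (real^'n) \<Rightarrow> (real^'n) \<Rightarrow> complex" where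
  "box_bump k a b x = (\<Prod>j\<in>UNIV. of_real (flat 0 (k * x $ j + (- (k * a $ j)))) *
     of_real (flat 0 ((- k) * x $ j + k * b $ j)))"

lemma flat0_eq_0_iff: "flat 0 t = 0 \<longleftrightarrow> t \<le> 0"
  by (auto simp: flat_def)

lemma box_bump_eq_0_iff:
  assumes "k > 0"
  shows "box_bump k a b x \<noteq> 0 \<longleftrightarrow> x \<in> box a b"
proof -
  have "k * x $ j + - (k * a $ j) \<le> 0 \<longleftrightarrow> x $ j \<le> a $ j" "- k * x $ j + k * b $ j \<le> 0 \<longleftrightarrow> b $ j \<le> x $ j" for j
    using assms by auto
  then show ?thesis
    unfolding box_bump_def by (auto simp: flat0_eq_0_iff mem_box_cart not_le)
qed

lemma box_bump_test: "k > 0 \<Longrightarrow> box_bump k a b \<in> test_functions"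
proof (rule test_functionsI)
  show "C_k m (box_bump k a b)" for m
    unfolding box_bump_def [abs_def] by (intro C_k_prod C_k_mult C_k_flat) simp
  show "bounded {x. box_bump k a b x \<noteq> 0}" if "k > 0"
    using that by (simp add: box_bump_eq_0_iff bounded_box)
qed

lemma box_bump_norm_le: "norm (box_bump k a b x) \<le> 1"
  unfolding box_bump_def prod_norm[symmetric]
  by (intro prod_le_1) (auto simp: norm_mult flat_bounds intro!: mult_le_one)

lemma box_bump_tendsto:
  fixes a b x :: "real^'n::finite"
  shows "(\<lambda>k. box_bump (real (Suc k)) a b x) \<longlonglongrightarrow> indicator (box a b) x"
proof (cases "x \<in> box a b")
  case True
  have 1: "(\<lambda>k. of_real (flat 0 (real (Suc k) * c)) :: complex) \<longlonglongrightarrow> of_real 1" if "c > 0" for c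
  proof (rule tendsto_of_real)
    have "(\<lambda>k. 1 / (real (Suc k) * c)) \<longlonglongrightarrow> 0"
      using that by real_asymp
    then have "(\<lambda>k. exp (- (1 / (real (Suc k) * c)))) \<longlonglongrightarrow> exp (- 0)"
      by (intro tendsto_exp tendsto_minus)
    then show "(\<lambda>k. flat 0 (real (Suc k) * c)) \<longlonglongrightarrow> 1"
      using that by (simp add: flat_def)
  qed
  have "(\<lambda>k. box_bump (real (Suc k)) a b x) \<longlonglongrightarrow> (\<Prod>j\<in>(UNIV::'n set). of_real 1 * of_real 1)"
    unfolding box_bump_def
  proof (intro tendsto_prod tendsto_mult)
    fix j :: 'n
    from True have "a $ j < x $ j" "x $ j < b $ j" by (auto simp: mem_box_cart)
    then show "(\<lambda>k. of_real (flat 0 (real (Suc k) * x $ j + - (real (Suc k) * a $ j))) :: complex) \<longlonglongrightarrow> of_real 1"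
      "(\<lambda>k. of_real (flat 0 (- real (Suc k) * x $ j + real (Suc k) * b $ j)) :: complex) \<longlonglongrightarrow> of_real 1"
      using 1[of "x $ j - a $ j"] 1[of "b $ j - x $ j"] by (simp_all add: algebra_simps)
  qed
  with True show ?thesis by simp
next
  case False
  then show ?thesis using box_bump_eq_0_iff[of "real (Suc k)" a b x for k] by simp
qed

text \<open>The fundamental lemma of the calculus of variations. Bumps converging to the indicator
  of a box, with |h| on the box as dominating function, make the integral of h over every box
  vanish; Lebesgue differentiation over shrinking cubes then recovers h at almost every
  point.\<close>

lemma locally_integrable_eq_0:
  fixes h :: "(real^'n::finite) \<Rightarrow> complex"
  assumes h: "locally_integrable h"
    and orth: "\<And>\<phi>. \<phi> \<in> test_functions \<Longrightarrow> (\<integral>x. h x * \<phi> x \<partial>lebesgue) = 0"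
  shows "AE x in lebesgue. h x = 0"
proof -
  have box0: "integral (cbox a b) h = 0" for a b
  proof -
    have ci: "h absolutely_integrable_on cbox a b"
      using h by (simp add: locally_integrable_def)
    then have bi: "h absolutely_integrable_on box a b"
      by (rule set_integrable_subset) (auto simp: box_subset_cbox)
    have "(\<lambda>k. \<integral>x. h x * box_bump (real (Suc k)) a b x \<partial>lebesgue) \<longlonglongrightarrow>
      (\<integral>x. indicat_real (box a b) x *\<^sub>R h x \<partial>lebesgue)"
    proof (rule integral_dominated_convergence)
      show "integrable lebesgue (\<lambda>x. norm (indicat_real (box a b) x *\<^sub>R h x))"
        using integrable_norm[OF bi[unfolded set_integrable_def]] .
      show "(\<lambda>x. indicat_real (box a b) x *\<^sub>R h x) \<in> borel_measurable lebesgue"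
        using bi by (auto simp: set_integrable_def)
      show "(\<lambda>x. h x * box_bump (real (Suc k)) a b x) \<in> borel_measurable lebesgue" for k
        using locally_integrable_mult_test[OF h box_bump_test] by auto
      show "AE x in lebesgue. (\<lambda>k. h x * box_bump (real (Suc k)) a b x) \<longlonglongrightarrow> indicat_real (box a b) x *\<^sub>R h x"
      proof (rule AE_I2)
        fix x
        have "(\<lambda>k. h x * box_bump (real (Suc k)) a b x) \<longlonglongrightarrow> h x * indicator (box a b) x"
          by (intro tendsto_mult tendsto_const box_bump_tendsto)
        then show "(\<lambda>k. h x * box_bump (real (Suc k)) a b x) \<longlonglongrightarrow> indicat_real (box a b) x *\<^sub>R h x"
          by (auto simp: indicator_def split: if_splits)
      qed
      show "AE x in lebesgue. norm (h x * box_bump (real (Suc k)) a b x) \<le> norm (indicat_real (box a b) x *\<^sub>R h x)" for k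
      proof (rule AE_I2)
        fix x
        show "norm (h x * box_bump (real (Suc k)) a b x) \<le> norm (indicat_real (box a b) x *\<^sub>R h x)"
        proof (cases "x \<in> box a b")
          case True
          then show ?thesis
            using mult_left_mono[OF box_bump_norm_le[of "real (Suc k)" a b x] norm_ge_zero[of "h x"]]
            by (simp add: norm_mult)
        next
          case False
          then have "box_bump (real (Suc k)) a b x = 0"
            using box_bump_eq_0_iff[of "real (Suc k)" a b x] by auto
          then show ?thesis by simp
        qed
      qed
    qed
    moreover have "(\<integral>x. h x * box_bump (real (Suc k)) a b x \<partial>lebesgue) = 0" for k
      by (rule orth[OF box_bump_test]) simp
    ultimately have "(LINT x:box a b|lebesgue. h x) = 0"
      by (simp only: set_lebesgue_integral_def LIMSEQ_const_iff)
    then have "integral (box a b) h = 0"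
      using set_lebesgue_integral_eq_integral(2)[OF bi] by simp
    then show ?thesis by (simp add: integral_open_interval)
  qed
  have "h integrable_on cbox a b" for a b
    using h compact_cbox set_lebesgue_integral_eq_integral(1)[of "cbox a b" h]
    unfolding locally_integrable_def by blast
  then obtain N where N: "negligible N" "\<And>x e. \<lbrakk>x \<notin> N; 0 < e\<rbrakk> \<Longrightarrow>
      \<exists>d>0. \<forall>t. 0 < t \<and> t < d \<longrightarrow>
        norm (integral (cbox x (x + t *\<^sub>R One)) h /\<^sub>R t ^ DIM(real^'n) - h x) < e"
    using integrable_ccontinuous_explicit by blast
  \<comment> \<open>All cube averages are 0, so their distance from \<open>h x\<close> is always
    \<open>norm (h x)\<close>. Taking this number as the tolerance gives a strict inequality of it
    with itself, as soon as some admissible side length exists.\<close>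
  have "h x = 0" if "x \<notin> N" for x
  proof (rule ccontr)
    assume "h x \<noteq> 0"
    then have "\<exists>d>0. \<forall>t::real. 0 < t \<and> t < d \<longrightarrow> norm (h x) < norm (h x)"
      using N(2)[OF that, of "norm (h x)"] by (simp add: box0)
    then show False using dense by blast
  qed
  then have "{x \<in> space lebesgue. h x \<noteq> 0} \<subseteq> N" by auto
  then show ?thesis
    using N(1) by (auto intro!: AE_I' simp: negligible_iff_null_sets)
qed

section \<open>The Gagliardo inequality\<close>

text \<open>The inequality of arithmetic and geometric means. With an infinite factor the mean is
  infinite; otherwise it is the inequality for reals.\<close>

lemma prod_le_mean_power_ennreal:
  fixes y :: "'i \<Rightarrow> ennreal"
  assumes "finite I" "I \<noteq> {}"
  shows "(\<Prod>i\<in>I. y i) \<le> ((\<Sum>i\<in>I. y i) / of_nat (card I)) ^ card I"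
proof (cases "\<exists>i\<in>I. y i = top")
  case True
  then have "(\<Sum>i\<in>I. y i) = top" using assms(1) by (simp add: ennreal_sum_eq_top)
  moreover have "card I > 0" using assms by (simp add: card_gt_0_iff)
  ultimately show ?thesis by (simp add: ennreal_top_divide of_nat_less_top)
next
  case False
  define x where "x i = enn2real (y i)" for i
  have y: "y i = ennreal (x i)" if "i \<in> I" for i
    using False that by (simp add: x_def less_top)
  have x0: "x i \<ge> 0" for i by (simp add: x_def)
  have n: "card I > 0" using assms by (simp add: card_gt_0_iff)
  have "(\<Prod>i\<in>I. x i) = ((\<Prod>i\<in>I. x i) powr (1 / card I)) ^ card I"
    using n x0 by (simp add: powr_powr prod_nonneg flip: powr_realpow')
  also have "\<dots> \<le> (\<Sum>i\<in>I. x i / card I) ^ card I"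
    by (intro power_mono arith_geom_mean assms x0) simp
  also have "(\<Sum>i\<in>I. x i / card I) = (\<Sum>i\<in>I. x i) / card I"
    by (simp add: sum_divide_distrib)
  finally have "ennreal (\<Prod>i\<in>I. x i) \<le> ennreal (((\<Sum>i\<in>I. x i) / card I) ^ card I)"
    by (rule ennreal_leI)
  moreover have "(\<Prod>i\<in>I. y i) = ennreal (\<Prod>i\<in>I. x i)" "(\<Sum>i\<in>I. y i) = ennreal (\<Sum>i\<in>I. x i)"
    using x0 by (simp_all add: y prod_ennreal sum_ennreal)
  moreover have "ennreal ((\<Sum>i\<in>I. x i) / card I) = ennreal (\<Sum>i\<in>I. x i) / of_nat (card I)"
    using n x0 by (simp add: divide_ennreal[symmetric] sum_nonneg ennreal_of_nat_eq_real_of_nat)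
  ultimately show ?thesis
    by (simp only: ennreal_power[symmetric] divide_nonneg_nonneg sum_nonneg x0 of_nat_0_le_iff)
qed

lemma power_le_imp_le_ennreal:
  fixes a b :: ennreal
  assumes "a ^ n \<le> b ^ n" "n > 0"
  shows "a \<le> b"
proof (cases "b = top")
  case False
  with assms have "a \<noteq> top" by (auto simp: top_unique power_eq_top_ennreal)
  with False show ?thesis
    using assms by (cases a; cases b) (auto simp: ennreal_power)
qed simp

text \<open>Hoelder's inequality for \<open>card I\<close> factors, raised to the power \<open>card I\<close> to avoid roots of
  extended reals.\<close>

lemma nn_integral_power_le_prod:
  assumes I: "finite I" "I \<noteq> {}"
    and F[measurable]: "F \<in> borel_measurable M"
    and h[measurable]: "\<And>i. i \<in> I \<Longrightarrow> h i \<in> borel_measurable M"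
    and le: "\<And>x. x \<in> space M \<Longrightarrow> F x ^ card I \<le> (\<Prod>i\<in>I. h i x)"
  shows "(\<integral>\<^sup>+x. F x \<partial>M) ^ card I \<le> (\<Prod>i\<in>I. \<integral>\<^sup>+x. h i x \<partial>M)"
proof -
  have n: "card I > 0" using I by (simp add: card_gt_0_iff)
  define s where "s i = (\<integral>\<^sup>+x. h i x \<partial>M)" for i
  \<comment> \<open>The degenerate cases must be ordered like this: a factor with integral zero
    forces F = 0 almost everywhere, which settles products of the form 0 times infinity as well.
    Only when no integral vanishes does an infinite one make the right-hand side infinite.\<close>
  consider (zero) i where "i \<in> I" "s i = 0" | (top) i where "i \<in> I" "s i = top" "\<forall>i\<in>I. s i \<noteq> 0"
    | (fin) "\<And>i. i \<in> I \<Longrightarrow> s i \<noteq> 0" "\<And>i. i \<in> I \<Longrightarrow> s i \<noteq> top" by blast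
  then show ?thesis
  proof cases
    case zero
    then have h0: "AE x in M. h i x = 0" by (simp add: s_def nn_integral_0_iff_AE)
    have F0: "F x = 0" if "x \<in> space M" "h i x = 0" for x
    proof -
      have "(\<Prod>i\<in>I. h i x) = 0" using zero(1) that(2) I(1) by (auto simp: prod_zero_iff)
      with le[OF that(1)] have "F x ^ card I \<le> 0" by (simp only:)
      then show ?thesis by simp
    qed
    from h0 AE_space have "AE x in M. F x = 0" by eventually_elim (rule F0)
    then have "(\<integral>\<^sup>+x. F x \<partial>M) = 0" by (simp add: nn_integral_0_iff_AE)
    then show ?thesis using n by (simp add: zero_power)
  next
    case top
    have "(\<Prod>i\<in>I. s i) = top"
      using top I(1) by (subst ennreal_prod_eq_top) auto
    then show ?thesis by (simp add: s_def)
  next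
    case fin
    define P where "P = (\<Prod>i\<in>I. enn2real (s i))"
    define \<sigma> where "\<sigma> = root (card I) P"
    have pos: "enn2real (s i) > 0" if "i \<in> I" for i
      using fin[OF that] by (simp add: enn2real_positive_iff less_top zero_less_iff_neq_zero)
    have P: "P > 0" unfolding P_def by (intro prod_pos pos)
    have \<sigma>: "\<sigma> > 0" "\<sigma> ^ card I = P" using P n by (simp_all add: \<sigma>_def real_root_gt_zero)
    have si: "s i = ennreal (enn2real (s i))" if "i \<in> I" for i
      using fin(2)[OF that] by (simp add: less_top)
    have Ps: "ennreal P = (\<Prod>i\<in>I. s i)"
      unfolding P_def using si by (simp add: prod_ennreal[symmetric])
    \<comment> \<open>Every \<open>h i\<close> is normalised to integral 1 before the means are
      compared, and \<sigma> is the geometric mean of the integrals. After integration the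
      arithmetic mean of the normalised factors is exactly 1, which leaves \<sigma>.\<close>
    have bound: "F x \<le> ennreal \<sigma> * ((\<Sum>i\<in>I. h i x / s i) / of_nat (card I))" if x: "x \<in> space M" for x
    proof -
      have "h i x = s i * (h i x / s i)" if "i \<in> I" for i
        using fin[OF that] by (simp add: ennreal_times_divide mult.commute[of "s i"] mult_divide_eq_ennreal)
      then have "(\<Prod>i\<in>I. h i x) = (\<Prod>i\<in>I. s i * (h i x / s i))"
        by (rule prod.cong[OF refl])
      also have "\<dots> = ennreal P * (\<Prod>i\<in>I. h i x / s i)"
        by (simp add: prod.distrib Ps)
      also have "\<dots> \<le> ennreal P * ((\<Sum>i\<in>I. h i x / s i) / of_nat (card I)) ^ card I"
        by (intro mult_left_mono prod_le_mean_power_ennreal I) simp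
      also have "\<dots> = (ennreal \<sigma> * ((\<Sum>i\<in>I. h i x / s i) / of_nat (card I))) ^ card I"
        using \<sigma> by (simp add: power_mult_distrib ennreal_power)
      finally have "F x ^ card I \<le> (ennreal \<sigma> * ((\<Sum>i\<in>I. h i x / s i) / of_nat (card I))) ^ card I"
        using le[OF x] by (rule order_trans[rotated])
      then show ?thesis using n by (rule power_le_imp_le_ennreal)
    qed
    have "(\<integral>\<^sup>+x. F x \<partial>M) \<le> (\<integral>\<^sup>+x. ennreal \<sigma> * ((\<Sum>i\<in>I. h i x / s i) / of_nat (card I)) \<partial>M)"
      by (intro nn_integral_mono bound)
    also have "\<dots> = ennreal \<sigma> * ((\<Sum>i\<in>I. s i / s i) / of_nat (card I))"
      by (simp add: nn_integral_cmult nn_integral_divide nn_integral_sum s_def)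
    also have "(\<Sum>i\<in>I. s i / s i) = of_nat (card I)"
      using fin by (simp add: ennreal_divide_self less_top)
    also have "of_nat (card I) / of_nat (card I) = (1::ennreal)"
      using n by (intro ennreal_divide_self) (auto simp: of_nat_less_top)
    finally have "(\<integral>\<^sup>+x. F x \<partial>M) ^ card I \<le> ennreal \<sigma> ^ card I"
      by (intro power_mono) auto
    also have "\<dots> = (\<Prod>i\<in>I. s i)" using \<sigma> Ps by (simp add: ennreal_power)
    finally show ?thesis by (simp add: s_def)
  qed
qed

section \<open>Integrating out coordinates one at a time\<close>

abbreviation lborel_fun :: "('n::finite \<Rightarrow> real) measure" where
  "lborel_fun \<equiv> Pi\<^sub>M UNIV (\<lambda>_. lborel)"

interpretation lborel_fun: product_sigma_finite "\<lambda>_::'n::finite. lborel :: real measure" ..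

text \<open>The result is kept as a function of all coordinates, constant in coordinate
  \<open>j\<close>. Iterated integrals over any set of coordinates thus have one type and can be
  written as a fold over a list.\<close>

definition integrate_coord :: "'n \<Rightarrow> (('n \<Rightarrow> real) \<Rightarrow> ennreal) \<Rightarrow> ('n \<Rightarrow> real) \<Rightarrow> ennreal" where
  "integrate_coord j f x = (\<integral>\<^sup>+t. f (x(j := t)) \<partial>lborel)"

lemma space_lborel_fun: "space lborel_fun = UNIV"
  by (simp add: space_PiM PiE_UNIV_domain)

lemma measurable_upd_lborel_fun:
  "(\<lambda>(x, t). x(j := t)) \<in> (lborel_fun :: ('n::finite \<Rightarrow> real) measure) \<Otimes>\<^sub>M lborel \<rightarrow>\<^sub>M lborel_fun"
  using measurable_add_dim[of j UNIV "\<lambda>_. lborel"] by (simp add: case_prod_beta')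

lemma measurable_integrate_coord:
  fixes f :: "('n::finite \<Rightarrow> real) \<Rightarrow> ennreal"
  assumes "f \<in> borel_measurable lborel_fun"
  shows "integrate_coord j f \<in> borel_measurable lborel_fun"
proof -
  have "(\<lambda>(x, t). f (x(j := t))) \<in> borel_measurable (lborel_fun \<Otimes>\<^sub>M lborel)"
    using measurable_compose[OF measurable_upd_lborel_fun assms] by (simp add: case_prod_beta')
  then show ?thesis
    unfolding integrate_coord_def [abs_def] by (rule lborel.borel_measurable_nn_integral)
qed

lemma measurable_upd_const:
  fixes f :: "('n::finite \<Rightarrow> real) \<Rightarrow> ennreal"
  assumes "f \<in> borel_measurable lborel_fun"
  shows "(\<lambda>t. f (x(j := t))) \<in> borel_measurable lborel"
proof -
  have "(\<lambda>t. (x, t)) \<in> lborel \<rightarrow>\<^sub>M lborel_fun \<Otimes>\<^sub>M lborel"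
    by (intro measurable_Pair measurable_const measurable_ident_sets) (auto simp: space_lborel_fun)
  from measurable_compose[OF measurable_compose[OF this measurable_upd_lborel_fun] assms]
  show ?thesis by simp
qed

lemma measurable_foldr_integrate_coord:
  fixes f :: "('n::finite \<Rightarrow> real) \<Rightarrow> ennreal"
  assumes "f \<in> borel_measurable lborel_fun"
  shows "foldr integrate_coord L f \<in> borel_measurable lborel_fun"
  by (induction L) (auto intro: assms measurable_integrate_coord)

text \<open>Updates at different coordinates commute, and an update at the coordinate being
  integrated is overwritten; so independence of a coordinate survives all further
  integrations.\<close>

lemma foldr_integrate_coord_upd:
  assumes "\<And>x t. f (x(j := t)) = f x"
  shows "foldr integrate_coord L f (x(j := t)) = foldr integrate_coord L f x"
proof (induction L arbitrary: x)
  case (Cons i L)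
  have "foldr integrate_coord L f (x(j := t, i := s)) = foldr integrate_coord L f (x(i := s))" for s
  proof (cases "i = j")
    case False
    then show ?thesis using Cons[of "x(i := s)"] fun_upd_twist[OF False, of x s t] by metis
  qed simp
  then show ?case
    by (simp only: foldr.simps o_apply integrate_coord_def[of i "foldr integrate_coord L f"])
qed (simp add: assms)

text \<open>Tonelli's theorem for the coordinates in \<open>L\<close>, with the others frozen at
  \<open>x\<close>. Once \<open>L\<close> lists every coordinate, the fold becomes the integral over
  the whole space.\<close>

lemma foldr_integrate_coord_eq:
  fixes f :: "('n::finite \<Rightarrow> real) \<Rightarrow> ennreal"
  assumes f: "f \<in> borel_measurable lborel_fun" and "distinct L"
  shows "foldr integrate_coord L f x =
    (\<integral>\<^sup>+y. f (\<lambda>k. if k \<in> set L then y k else x k) \<partial>Pi\<^sub>M (set L) (\<lambda>_. lborel))"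
  using assms(2)
proof (induction L arbitrary: x)
  case Nil
  then show ?case by (simp add: lborel_fun.nn_integral_empty space_PiM_empty)
next
  case (Cons j L)
  have "(\<lambda>y k. if k \<in> set (j # L) then y k else x k) \<in> Pi\<^sub>M (set (j # L)) (\<lambda>_. lborel) \<rightarrow>\<^sub>M lborel_fun"
  proof (rule measurable_PiM_single')
    fix k
    show "(\<lambda>y. if k \<in> set (j # L) then y k else x k) \<in> Pi\<^sub>M (set (j # L)) (\<lambda>_. lborel) \<rightarrow>\<^sub>M lborel"
      by (cases "k \<in> set (j # L)") (auto intro: measurable_component_singleton)
  qed auto
  from measurable_compose[OF this f]
  have m: "(\<lambda>y. f (\<lambda>k. if k \<in> set (j # L) then y k else x k)) \<in>
      borel_measurable (Pi\<^sub>M (insert j (set L)) (\<lambda>_. lborel))"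
    by simp
  have "(\<integral>\<^sup>+y. f (\<lambda>k. if k \<in> set (j # L) then y k else x k) \<partial>Pi\<^sub>M (insert j (set L)) (\<lambda>_. lborel))
    = (\<integral>\<^sup>+t. \<integral>\<^sup>+y. f (\<lambda>k. if k \<in> set (j # L) then (y(j := t)) k else x k)
        \<partial>Pi\<^sub>M (set L) (\<lambda>_. lborel) \<partial>lborel)"
    using Cons.prems by (intro lborel_fun.product_nn_integral_insert_rev[OF _ _ m]) auto
  also have "\<dots> = (\<integral>\<^sup>+t. \<integral>\<^sup>+y. f (\<lambda>k. if k \<in> set L then y k else (x(j := t)) k)
        \<partial>Pi\<^sub>M (set L) (\<lambda>_. lborel) \<partial>lborel)"
    using Cons.prems by (intro nn_integral_cong arg_cong[where f=f] ext) auto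
  finally show ?case using Cons by (simp add: integrate_coord_def)
qed

lemma foldr_integrate_coord_UNIV:
  fixes f :: "('n::finite \<Rightarrow> real) \<Rightarrow> ennreal"
  assumes "f \<in> borel_measurable lborel_fun" "distinct L" "set L = UNIV"
  shows "foldr integrate_coord L f x = (\<integral>\<^sup>+y. f y \<partial>lborel_fun)"
  using foldr_integrate_coord_eq[OF assms(1,2)] assms(3) by simp

text \<open>The coordinates are integrated out one at a time.  When coordinate \<open>j\<close> is integrated, the factor
  for \<open>j\<close> is constant, and Hoelder's inequality applies to the remaining \<open>d - 1\<close> factors and the
  weight \<open>A\<close>.\<close>

lemma gagliardo_lborel_fun:
  fixes F A :: "('n::finite \<Rightarrow> real) \<Rightarrow> ennreal"
  assumes F: "F \<in> borel_measurable lborel_fun" and A: "A \<in> borel_measurable lborel_fun"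
    and G: "\<And>i. G i \<in> borel_measurable lborel_fun"
    and le: "\<And>x. F x ^ CARD('n) \<le> A x * (\<Prod>i\<in>UNIV. integrate_coord i (G i) x)"
  shows "(\<integral>\<^sup>+x. F x \<partial>lborel_fun) ^ CARD('n) \<le> (\<integral>\<^sup>+x. A x \<partial>lborel_fun) * (\<Prod>i\<in>UNIV. \<integral>\<^sup>+x. G i x \<partial>lborel_fun)"
proof -
  let ?T = "\<lambda>L. foldr integrate_coord L"
  \<comment> \<open>The state of factor \<open>i\<close> once the coordinates in \<open>L\<close>
    are integrated out. Coordinate \<open>i\<close> is skipped because the factor contains that
    integration from the start.\<close>
  define g where "g L i = ?T (removeAll i L) (integrate_coord i (G i))" for L i
  have Gm: "integrate_coord i (G i) \<in> borel_measurable lborel_fun" for i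
    by (rule measurable_integrate_coord[OF G])
  have gm: "g L i \<in> borel_measurable lborel_fun" for L i
    unfolding g_def by (rule measurable_foldr_integrate_coord[OF Gm])
  have indep: "g L i (x(i := t)) = g L i x" for L i x t
    unfolding g_def by (rule foldr_integrate_coord_upd) (simp add: integrate_coord_def)
  have main: "?T L F x ^ CARD('n) \<le> ?T L A x * (\<Prod>i\<in>UNIV. g L i x)" if "distinct L" for L x
    using that
  proof (induction L arbitrary: x)
    case Nil
    then show ?case using le by (simp add: g_def)
  next
    case (Cons j L)
    \<comment> \<open>Hoelder in the variable t needs exactly d functions. The factor for
      \<open>j\<close> is constant in t, so slot \<open>j\<close> is free to carry the
      weight.\<close>
    define h where "h i t = (if i = j then g L j x * ?T L A (x(j := t)) else g L i (x(j := t)))" for i t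
    have "(\<integral>\<^sup>+t. ?T L F (x(j := t)) \<partial>lborel) ^ CARD('n) \<le> (\<Prod>i\<in>UNIV. \<integral>\<^sup>+t. h i t \<partial>lborel)"
    proof (rule nn_integral_power_le_prod)
      show "(\<lambda>t. ?T L F (x(j := t))) \<in> borel_measurable lborel"
        by (intro measurable_upd_const measurable_foldr_integrate_coord F)
      show "h i \<in> borel_measurable lborel" for i
      proof (cases "i = j")
        case True
        have "(\<lambda>t. g L j x * ?T L A (x(j := t))) \<in> borel_measurable lborel"
          by (intro borel_measurable_times_ennreal borel_measurable_const measurable_upd_const
              measurable_foldr_integrate_coord A)
        then show ?thesis using True by (simp add: h_def [abs_def])
      next
        case False
        have "(\<lambda>t. g L i (x(j := t))) \<in> borel_measurable lborel"
          by (intro measurable_upd_const gm)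
        then show ?thesis using False by (simp add: h_def [abs_def])
      qed
      fix t
      have "?T L F (x(j := t)) ^ CARD('n) \<le> ?T L A (x(j := t)) * (\<Prod>i\<in>UNIV. g L i (x(j := t)))"
        using Cons by simp
      also have "\<dots> = (\<Prod>i\<in>UNIV. h i t)"
        by (simp add: prod.remove[of UNIV j] h_def indep mult_ac)
      finally show "?T L F (x(j := t)) ^ CARD('n) \<le> (\<Prod>i\<in>UNIV. h i t)" .
    qed auto
    also have "(\<Prod>i\<in>UNIV. \<integral>\<^sup>+t. h i t \<partial>lborel) = (\<integral>\<^sup>+t. h j t \<partial>lborel) * (\<Prod>i\<in>UNIV - {j}. \<integral>\<^sup>+t. h i t \<partial>lborel)"
      by (rule prod.remove) auto
    also have "(\<integral>\<^sup>+t. h j t \<partial>lborel) = g L j x * ?T (j # L) A x"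
      using nn_integral_cmult[OF measurable_upd_const[OF measurable_foldr_integrate_coord[OF A]]]
      by (simp add: h_def integrate_coord_def)
    also have "(\<Prod>i\<in>UNIV - {j}. \<integral>\<^sup>+t. h i t \<partial>lborel) = (\<Prod>i\<in>UNIV - {j}. g (j # L) i x)"
      by (intro prod.cong refl) (auto simp: h_def g_def integrate_coord_def)
    also have "g L j x = g (j # L) j x"
      by (simp add: g_def)
    finally show ?case
      by (simp only: prod.remove[of UNIV j "\<lambda>i. g (j # L) i x"] finite UNIV_I foldr.simps o_apply
          integrate_coord_def [of j "?T L F"] mult_ac)
  qed
  obtain L :: "'n list" where L: "set L = UNIV" "distinct L"
    using finite_distinct_list[of "UNIV :: 'n set"] by auto
  have "g L i x = (\<integral>\<^sup>+x. G i x \<partial>lborel_fun)" for i x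
  proof -
    \<comment> \<open>The integration built into the factor counts as the last list entry, the
      innermost of the fold; the extended list again runs through every coordinate once.\<close>
    have "g L i x = ?T (removeAll i L @ [i]) (G i) x" by (simp add: g_def)
    also have "\<dots> = (\<integral>\<^sup>+x. G i x \<partial>lborel_fun)"
      by (rule foldr_integrate_coord_UNIV[OF G]) (use L in \<open>auto simp: distinct_removeAll\<close>)
    finally show ?thesis .
  qed
  with main[OF L(2)] show ?thesis
    by (simp add: foldr_integrate_coord_UNIV[OF F L(2,1)] foldr_integrate_coord_UNIV[OF A L(2,1)])
qed

section \<open>Transfer from the product measure to Euclidean space\<close>

lemma measurable_vec_lambda_fun:
  "(\<lambda>f. \<chi> i. f i) \<in> (lborel_fun :: ('n::finite \<Rightarrow> real) measure) \<rightarrow>\<^sub>M borel"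
proof (subst borel_measurable_euclidean_space, rule ballI)
  fix b :: "real^'n"
  assume "b \<in> Basis"
  then obtain i where b: "b = axis i 1" by (auto simp: Basis_vec_def)
  have "(\<lambda>f. f i) \<in> (lborel_fun :: ('n \<Rightarrow> real) measure) \<rightarrow>\<^sub>M lborel"
    by (rule measurable_component_singleton) simp
  then show "(\<lambda>f. (\<chi> i. f i) \<bullet> b) \<in> borel_measurable (lborel_fun :: ('n \<Rightarrow> real) measure)"
    by (simp add: b inner_axis)
qed

text \<open>Both measures give an open box the product of its side lengths, and this determines
  Lebesgue measure.\<close>

lemma lborel_vec_eq_distr: "(lborel :: (real^'n::finite) measure) = distr lborel_fun borel (\<lambda>f. \<chi> i. f i)"
proof (rule lborel_eqI)
  fix l u :: "real^'n"
  assume le: "\<And>b. b \<in> Basis \<Longrightarrow> l \<bullet> b \<le> u \<bullet> b"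
  have le': "l $ i \<le> u $ i" for i
    using le[of "axis i 1"] by (simp add: inner_axis axis_in_Basis_iff)
  have "(\<lambda>f. \<chi> i. f i) -` box l u \<inter> space lborel_fun = (\<Pi>\<^sub>E i\<in>UNIV. {l $ i <..< u $ i})"
    by (auto simp: mem_box_cart space_lborel_fun PiE_UNIV_domain Pi_iff)
  then have "emeasure (distr lborel_fun borel (\<lambda>f. \<chi> i. f i)) (box l u) =
      emeasure lborel_fun (\<Pi>\<^sub>E i\<in>UNIV. {l $ i <..< u $ i})"
    by (simp add: emeasure_distr[OF measurable_vec_lambda_fun])
  also have "\<dots> = (\<Prod>i\<in>UNIV. ennreal (u $ i - l $ i))"
    by (subst lborel_fun.emeasure_PiM) (auto simp: le')
  also have "\<dots> = ennreal (\<Prod>i\<in>UNIV. u $ i - l $ i)"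
    using le' by (simp add: prod_ennreal)
  also have "(\<Prod>i\<in>UNIV. u $ i - l $ i) = (\<Prod>b\<in>Basis. (u - l) \<bullet> b)"
    by (rule prod.reindex_bij_witness[where i="\<lambda>b. SOME i. b = axis i 1" and j="\<lambda>i. axis i 1"])
      (auto simp: inner_axis axis_in_Basis_iff axis_eq_axis Basis_vec_def)
  finally show "emeasure (distr lborel_fun borel (\<lambda>f. \<chi> i. f i)) (box l u) = ennreal (\<Prod>b\<in>Basis. (u - l) \<bullet> b)" .
qed simp

lemma gagliardo_lborel:
  fixes F A :: "real^'n::finite \<Rightarrow> ennreal"
  assumes F: "F \<in> borel_measurable borel" and A: "A \<in> borel_measurable borel"
    and G: "\<And>i. G i \<in> borel_measurable borel"
    and le: "\<And>x. F x ^ CARD('n) \<le> A x * (\<Prod>i\<in>UNIV. \<integral>\<^sup>+t. G i (\<chi> k. if k = i then t else x $ k) \<partial>lborel)"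
  shows "(\<integral>\<^sup>+x. F x \<partial>lborel) ^ CARD('n) \<le> (\<integral>\<^sup>+x. A x \<partial>lborel) * (\<Prod>i\<in>UNIV. \<integral>\<^sup>+x. G i x \<partial>lborel)"
proof -
  have eq: "(\<integral>\<^sup>+x. f x \<partial>lborel) = (\<integral>\<^sup>+x. f (\<chi> i. x i) \<partial>lborel_fun)"
    if "f \<in> borel_measurable borel" for f :: "real^'n \<Rightarrow> ennreal"
    unfolding lborel_vec_eq_distr
    using nn_integral_distr[OF measurable_vec_lambda_fun, of f] that by simp
  show ?thesis
    unfolding eq[OF F] eq[OF A] eq[OF G]
  proof (rule gagliardo_lborel_fun)
    fix x :: "'n \<Rightarrow> real"
    have "(\<chi> k. if k = i then t else (\<chi> k. x k) $ k) = (\<chi> k. (x(i := t)) k)" for i t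
      by (simp add: vec_eq_iff)
    then show "F (\<chi> i. x i) ^ CARD('n) \<le> A (\<chi> i. x i) * (\<Prod>i\<in>UNIV. integrate_coord i (\<lambda>x. G i (\<chi> i. x i)) x)"
      using le[of "\<chi> i. x i"] by (simp add: integrate_coord_def fun_upd_def)
  qed (auto intro: measurable_compose[OF measurable_vec_lambda_fun] F A G)
qed

section \<open>The weighted inequality for test functions\<close>

lemma test_line_vector_derivative:
  fixes \<phi> :: "(real^'n::finite) \<Rightarrow> complex"
  assumes "\<phi> \<in> test_functions"
  shows "((\<lambda>t. \<phi> (\<chi> k. if k = i then t else x $ k)) has_vector_derivative
    partial i \<phi> (\<chi> k. if k = i then t else x $ k)) (at t)"
proof -
  let ?l = "\<lambda>t. (\<chi> k. if k = i then t else x $ k)"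
  define c where "c = (\<chi> k. if k = i then 0 else x $ k)"
  have l: "?l t = c + t *\<^sub>R axis i 1" for t
    by (simp add: c_def vec_eq_iff axis_def)
  have "((\<lambda>t. c + t *\<^sub>R axis i 1) has_derivative (\<lambda>h. h *\<^sub>R axis i 1)) (at t)"
    using has_derivative_add[OF has_derivative_const
        bounded_linear_imp_has_derivative[OF bounded_linear_scaleR_left[of "axis i 1 :: real^'n"]]]
    by (simp only: add_0)
  then have l': "(?l has_derivative (\<lambda>h. h *\<^sub>R axis i 1)) (at t)"
    by (simp only: l)
  note d = C_k_has_derivative[OF test_functions_C_k[OF assms, of 1, simplified One_nat_def]]
  from has_derivative_compose[OF l' d]
  have "((\<lambda>t. \<phi> (?l t)) has_derivative (\<lambda>h. frechet_derivative \<phi> (at (?l t)) (h *\<^sub>R axis i 1))) (at t)" .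
  then show ?thesis
    unfolding has_vector_derivative_def partial_def
    by (simp only: linear_simps(5)[OF has_derivative_bounded_linear[OF d]])
qed

text \<open>The fundamental theorem of calculus along the line through \<open>x\<close> in direction
  \<open>i\<close>, started outside the support. Differentiating the squared modulus keeps the
  integrand smooth where \<phi> vanishes, and it produces the product of \<phi> and a derivative to
  which Cauchy-Schwarz applies later.\<close>

lemma norm_square_test_le_nn_integral:
  fixes \<phi> :: "(real^'n::finite) \<Rightarrow> complex"
  assumes \<phi>: "\<phi> \<in> test_functions"
  defines "G \<equiv> \<lambda>i x. 2 * norm (\<phi> x) * norm (partial i \<phi> x)"
  shows "ennreal ((norm (\<phi> x))\<^sup>2) \<le> (\<integral>\<^sup>+t. ennreal (G i (\<chi> k. if k = i then t else x $ k)) \<partial>lborel)"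
proof -
  let ?l = "\<lambda>t. (\<chi> k. if k = i then t else x $ k)"
  define p where "p t = \<phi> (?l t) \<bullet> \<phi> (?l t)" for t
  define p' where "p' t = 2 * (\<phi> (?l t) \<bullet> partial i \<phi> (?l t))" for t
  define g where "g t = G i (?l t)" for t
  obtain B where B: "\<And>y. \<phi> y \<noteq> 0 \<Longrightarrow> norm y \<le> B"
    using test_functions_bounded_support[OF \<phi>] by (auto simp: bounded_iff)
  \<comment> \<open>The starting point has to lie to the left of \<open>x $ i\<close>, so that the
    interval is oriented correctly, and beyond the ball of radius \<open>B\<close> that contains the
    support.\<close>
  define s0 where "s0 = min (x $ i) (- B - 1)"
  have "\<phi> (?l s0) = 0"
  proof (rule ccontr)
    assume "\<phi> (?l s0) \<noteq> 0"
    then have "norm (?l s0) \<le> B" by (rule B)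
    moreover have "\<bar>?l s0 $ i\<bar> \<le> norm (?l s0)" by (rule component_le_norm_cart)
    moreover have "\<bar>?l s0 $ i\<bar> = \<bar>s0\<bar>" by simp
    ultimately show False by (auto simp: s0_def min_def split: if_splits)
  qed
  then have p0: "p s0 = 0" by (simp add: p_def)
  have px: "p (x $ i) = (norm (\<phi> x))\<^sup>2"
  proof -
    have "?l (x $ i) = x" by (simp add: vec_eq_iff)
    then show ?thesis by (simp only: p_def power2_norm_eq_inner)
  qed
  have "(p has_vector_derivative p' t) (at t within {s0..x $ i})" for t
  proof -
    note d = test_line_vector_derivative[OF \<phi>, of i x t, unfolded has_vector_derivative_def]
    have "(p has_derivative (\<lambda>h. \<phi> (?l t) \<bullet> (h *\<^sub>R partial i \<phi> (?l t)) + (h *\<^sub>R partial i \<phi> (?l t)) \<bullet> \<phi> (?l t))) (at t)"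
      unfolding p_def [abs_def] by (rule has_derivative_inner[OF d d])
    then have "(p has_vector_derivative p' t) (at t)"
      unfolding has_vector_derivative_def p'_def by (simp add: inner_commute algebra_simps)
    then show ?thesis by (rule has_vector_derivative_at_within)
  qed
  then have FTC: "(p' has_integral (p (x $ i) - p s0)) {s0..x $ i}"
    by (intro fundamental_theorem_of_calculus) (auto simp: s0_def)
  have line: "continuous_on UNIV (\<lambda>t. f (?l t))" if "continuous_on UNIV f" for f :: "real^'n \<Rightarrow> complex"
  proof -
    have "continuous_on UNIV (\<lambda>t. (\<chi> k. if k = i then t else x $ k))"
    proof (intro continuous_on_vec_lambda)
      show "continuous_on UNIV (\<lambda>t. if k = i then t else x $ k)" for k
        by (cases "k = i") (simp_all add: continuous_on_id)
    qed
    then show ?thesis using continuous_on_compose2[OF that] by auto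
  qed
  have "continuous_on UNIV g"
    unfolding g_def G_def
    by (intro continuous_on_mult continuous_on_const continuous_on_norm line
        test_functions_continuous test_functions_partial \<phi>)
  then have gi: "g integrable_on {s0..x $ i}"
    using continuous_on_subset integrable_continuous_real by blast
  have bound: "norm (p' t) \<le> g t" for t
    using Cauchy_Schwarz_ineq2[of "\<phi> (?l t)" "partial i \<phi> (?l t)"]
    by (simp add: p'_def g_def G_def abs_mult)
  have "(norm (\<phi> x))\<^sup>2 = integral {s0..x $ i} p'"
    using integral_unique[OF FTC] px p0 by simp
  also have "\<dots> \<le> integral {s0..x $ i} g"
    using FTC gi bound by (intro integral_le) (auto simp: integrable_on_def abs_le_iff)
  finally have "ennreal ((norm (\<phi> x))\<^sup>2) \<le> ennreal (integral {s0..x $ i} g)"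
    by (rule ennreal_leI)
  also have "\<dots> = (\<integral>\<^sup>+t. ennreal (indicator {s0..x $ i} t * g t) \<partial>lborel)"
    using nn_integral_has_integral_lebesgue[OF _ integrable_integral[OF gi]] by (simp add: g_def G_def)
  also have "\<dots> \<le> (\<integral>\<^sup>+t. ennreal (g t) \<partial>lborel)"
    by (intro nn_integral_mono ennreal_leI) (auto simp: indicator_def g_def G_def)
  finally show ?thesis by (simp add: g_def)
qed

text \<open>The d-th power of a |\<phi>|^2 contains d copies of |\<phi>|^2, and each copy is bounded
  by the integral along a different coordinate direction. The remaining a^d is the weight
  \<open>A\<close> of \<open>gagliardo_lborel\<close>.\<close>

lemma gagliardo_test:
  fixes \<phi> :: "(real^'n::finite) \<Rightarrow> complex"
  assumes \<phi>: "\<phi> \<in> test_functions" and a: "a \<in> borel_measurable borel" "\<And>x. a x \<ge> 0"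
  shows "(\<integral>\<^sup>+x. ennreal (a x * (norm (\<phi> x))\<^sup>2) \<partial>lborel) ^ CARD('n) \<le>
    (\<integral>\<^sup>+x. ennreal (a x ^ CARD('n)) \<partial>lborel) *
    (\<Prod>i\<in>UNIV. \<integral>\<^sup>+x. ennreal (2 * norm (\<phi> x) * norm (partial i \<phi> x)) \<partial>lborel)"
proof (rule gagliardo_lborel)
  note [measurable] = a(1) test_functions_borel[OF \<phi>] test_functions_borel[OF test_functions_partial[OF \<phi>]]
  show "(\<lambda>x. ennreal (a x * (norm (\<phi> x))\<^sup>2)) \<in> borel_measurable borel"
    "(\<lambda>x. ennreal (a x ^ CARD('n))) \<in> borel_measurable borel"
    "(\<lambda>x. ennreal (2 * norm (\<phi> x) * norm (partial i \<phi> x))) \<in> borel_measurable borel" for i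
    by measurable
  fix x
  have "ennreal (a x * (norm (\<phi> x))\<^sup>2) ^ CARD('n) =
      ennreal (a x ^ CARD('n)) * (\<Prod>i\<in>(UNIV::'n set). ennreal ((norm (\<phi> x))\<^sup>2))"
    using a(2)[of x] by (simp add: ennreal_power ennreal_mult[symmetric] power_mult_distrib)
  also have "\<dots> \<le> ennreal (a x ^ CARD('n)) * (\<Prod>i\<in>UNIV.
      \<integral>\<^sup>+t. ennreal (2 * norm (\<phi> (\<chi> k. if k = i then t else x $ k)) *
        norm (partial i \<phi> (\<chi> k. if k = i then t else x $ k))) \<partial>lborel)"
    by (intro mult_left_mono prod_mono_ennreal norm_square_test_le_nn_integral \<phi>) simp
  finally show "ennreal (a x * (norm (\<phi> x))\<^sup>2) ^ CARD('n) \<le> \<dots>" .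
qed

section \<open>Square integrable functions and weak derivatives\<close>

abbreviation L2 :: "((real^'n::finite) \<Rightarrow> complex) set" where
  "L2 \<equiv> Lp 2"

definition sqnorm :: "((real^'n::finite) \<Rightarrow> complex) \<Rightarrow> real" where
  "sqnorm f = (\<integral>x. (norm (f x))\<^sup>2 \<partial>lebesgue)"

lemma L2_iff:
  "f \<in> L2 \<longleftrightarrow> f \<in> borel_measurable lebesgue \<and> integrable lebesgue (\<lambda>x. (norm (f x))\<^sup>2)"
  by (simp add: Lp_def)

lemma L2_measurable: "f \<in> L2 \<Longrightarrow> f \<in> borel_measurable lebesgue"
  and L2_integrable: "f \<in> L2 \<Longrightarrow> integrable lebesgue (\<lambda>x. (norm (f x))\<^sup>2)"
  by (simp_all add: L2_iff)

lemma sqnorm_nonneg: "0 \<le> sqnorm f"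
  by (simp add: sqnorm_def)

lemma sqnorm_nn: "f \<in> L2 \<Longrightarrow> (\<integral>\<^sup>+x. ennreal ((norm (f x))\<^sup>2) \<partial>lebesgue) = ennreal (sqnorm f)"
  unfolding sqnorm_def by (rule nn_integral_eq_integral) (auto simp: L2_integrable)

lemma L2_dominated:
  assumes f: "f \<in> borel_measurable lebesgue" and g: "integrable lebesgue g"
    and le: "AE x in lebesgue. (norm (f x))\<^sup>2 \<le> g x"
  shows "f \<in> L2"
  unfolding L2_iff
proof
  have "(\<lambda>x. (norm (f x))\<^sup>2) \<in> borel_measurable lebesgue"
    using f by simp
  then show "integrable lebesgue (\<lambda>x. (norm (f x))\<^sup>2)"
    by (rule Bochner_Integration.integrable_bound[OF g])
      (use le in eventually_elim, auto)
qed (rule f)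

text \<open>Completeness of Lebesgue measure: the two preimages of a set differ only within a null
  set.\<close>

lemma lebesgue_measurable_cong_AE:
  assumes f: "f \<in> borel_measurable lebesgue" and ae: "AE x in lebesgue. f x = g x"
  shows "g \<in> borel_measurable lebesgue"
proof (rule measurableI)
  fix S :: "'b set"
  assume "S \<in> sets borel"
  with f have A: "f -` S \<inter> space lebesgue \<in> sets lebesgue" by (rule measurable_sets)
  have AE: "AE x in lebesgue. x \<in> f -` S \<inter> space lebesgue \<longleftrightarrow> x \<in> g -` S \<inter> space lebesgue"
    using ae by eventually_elim auto
  show "g -` S \<inter> space lebesgue \<in> sets lebesgue"
    by (rule completion.in_sets_AE[OF AE A]) (rule Int_lower2)
qed simp

lemma L2_cong_AE:
  assumes f: "f \<in> L2" and ae: "AE x in lebesgue. f x = g x"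
  shows "g \<in> L2" "sqnorm g = sqnorm f"
proof -
  have g: "g \<in> borel_measurable lebesgue"
    using L2_measurable[OF f] ae
    by (rule lebesgue_measurable_cong_AE)
  then show "g \<in> L2"
    by (rule L2_dominated[OF _ L2_integrable[OF f]]) (use ae in eventually_elim, simp)
  show "sqnorm g = sqnorm f"
    unfolding sqnorm_def
    using L2_measurable[OF f] g by (intro integral_cong_AE) (use ae in \<open>auto elim: eventually_mono\<close>)
qed

lemma norm_square_add_le:
  fixes a b :: "'a::real_normed_vector"
  shows "(norm (a + b))\<^sup>2 \<le> 2 * (norm a)\<^sup>2 + 2 * (norm b)\<^sup>2"
proof -
  have "(norm (a + b))\<^sup>2 \<le> (norm a + norm b)\<^sup>2"
    by (intro power_mono norm_triangle_ineq) simp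
  also have "\<dots> \<le> 2 * (norm a)\<^sup>2 + 2 * (norm b)\<^sup>2"
    using sum_squares_bound[of "norm a" "norm b"] by (simp add: power2_sum)
  finally show ?thesis .
qed

text \<open>The crude factor 2 takes the place of Minkowski's inequality. Constants are harmless,
  because the bound is only applied to errors that can be made arbitrarily small.\<close>

lemma L2_add:
  assumes "f \<in> L2" "g \<in> L2"
  shows "(\<lambda>x. f x + g x) \<in> L2" "sqnorm (\<lambda>x. f x + g x) \<le> 2 * sqnorm f + 2 * sqnorm g"
proof -
  have i: "integrable lebesgue (\<lambda>x. 2 * (norm (f x))\<^sup>2 + 2 * (norm (g x))\<^sup>2)"
    by (intro Bochner_Integration.integrable_add integrable_mult_right L2_integrable assms)
  show fg: "(\<lambda>x. f x + g x) \<in> L2"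
    by (rule L2_dominated[OF _ i])
      (auto intro: borel_measurable_add L2_measurable assms norm_square_add_le)
  have "sqnorm (\<lambda>x. f x + g x) \<le> (\<integral>x. 2 * (norm (f x))\<^sup>2 + 2 * (norm (g x))\<^sup>2 \<partial>lebesgue)"
    unfolding sqnorm_def by (intro integral_mono i L2_integrable[OF fg] norm_square_add_le)
  also have "\<dots> = 2 * sqnorm f + 2 * sqnorm g"
    unfolding sqnorm_def
    by (subst Bochner_Integration.integral_add)
      (auto intro: integrable_mult_right L2_integrable assms)
  finally show "sqnorm (\<lambda>x. f x + g x) \<le> 2 * sqnorm f + 2 * sqnorm g" .
qed

lemma L2_bounded_mult:
  assumes f: "f \<in> L2" and a: "a \<in> borel_measurable lebesgue" "AE x in lebesgue. norm (a x) \<le> C"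
  shows "(\<lambda>x. a x * f x) \<in> L2" "sqnorm (\<lambda>x. a x * f x) \<le> C\<^sup>2 * sqnorm f"
proof -
  have i: "integrable lebesgue (\<lambda>x. C\<^sup>2 * (norm (f x))\<^sup>2)"
    by (intro integrable_mult_right L2_integrable f)
  have le: "AE x in lebesgue. (norm (a x * f x))\<^sup>2 \<le> C\<^sup>2 * (norm (f x))\<^sup>2"
    using a(2) by eventually_elim (auto simp: norm_mult power_mult_distrib intro!: mult_right_mono power_mono)
  show af: "(\<lambda>x. a x * f x) \<in> L2"
    by (rule L2_dominated[OF _ i le]) (intro borel_measurable_times L2_measurable f a)
  have "sqnorm (\<lambda>x. a x * f x) \<le> (\<integral>x. C\<^sup>2 * (norm (f x))\<^sup>2 \<partial>lebesgue)"
    unfolding sqnorm_def by (intro integral_mono_AE i L2_integrable[OF af] le)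
  then show "sqnorm (\<lambda>x. a x * f x) \<le> C\<^sup>2 * sqnorm f"
    by (simp add: sqnorm_def)
qed

lemma L2_cmult: "f \<in> L2 \<Longrightarrow> (\<lambda>x. c * f x) \<in> L2"
  by (rule L2_bounded_mult(1)[where C="norm c"]) auto

lemma L2_zero: "(\<lambda>x. 0) \<in> L2"
  by (simp add: L2_iff)

lemma L2_sum: "finite I \<Longrightarrow> (\<And>i. i \<in> I \<Longrightarrow> f i \<in> L2) \<Longrightarrow> (\<lambda>x. \<Sum>i\<in>I. f i x) \<in> L2"
  by (induction I rule: finite_induct) (auto intro: L2_add(1) L2_zero)

lemma L2_uminus: "f \<in> L2 \<Longrightarrow> (\<lambda>x. - f x) \<in> L2"
  using L2_cmult[of f "-1"] by simp

lemma L2_diff: "f \<in> L2 \<Longrightarrow> g \<in> L2 \<Longrightarrow> (\<lambda>x. f x - g x) \<in> L2"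
  using L2_add(1)[OF _ L2_uminus, of f g] by simp

lemma L2_cnj: "f \<in> L2 \<Longrightarrow> (\<lambda>x. cnj (f x)) \<in> L2"
  unfolding L2_iff
  by (auto intro: measurable_compose[OF _ borel_measurable_continuous_onI[OF continuous_on_cnj[OF continuous_on_id]]])

lemma sqnorm_cnj_diff: "sqnorm (\<lambda>x. cnj (f x) - cnj (g x)) = sqnorm (\<lambda>x. f x - g x)"
  by (simp add: sqnorm_def flip: complex_cnj_diff)

lemma L2_mult_integrable:
  assumes "f \<in> L2" "g \<in> L2"
  shows "integrable lebesgue (\<lambda>x. f x * g x)"
proof (rule Bochner_Integration.integrable_bound)
  show "integrable lebesgue (\<lambda>x. (norm (f x))\<^sup>2 + (norm (g x))\<^sup>2)"
    by (intro Bochner_Integration.integrable_add L2_integrable assms)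
  show "(\<lambda>x. f x * g x) \<in> borel_measurable lebesgue"
    by (intro borel_measurable_times L2_measurable assms)
  have "norm (f x) * norm (g x) \<le> (norm (f x))\<^sup>2 + (norm (g x))\<^sup>2" for x
    using sum_squares_bound[of "norm (f x)" "norm (g x)"]
      mult_nonneg_nonneg[OF norm_ge_zero[of "f x"] norm_ge_zero[of "g x"]] by linarith
  then show "AE x in lebesgue. norm (f x * g x) \<le> norm ((norm (f x))\<^sup>2 + (norm (g x))\<^sup>2)"
    by (auto simp: norm_mult)
qed

lemma L2_Cauchy_Schwarz_norm:
  assumes "f \<in> L2" "g \<in> L2"
  shows "(\<integral>x. norm (f x) * norm (g x) \<partial>lebesgue)\<^sup>2 \<le> sqnorm f * sqnorm g"
proof -
  have i: "integrable lebesgue (\<lambda>x. norm (f x) * norm (g x))"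
    using integrable_norm[OF L2_mult_integrable[OF assms]] by (simp add: norm_mult)
  have m: "(\<lambda>x. ennreal (norm (h x))) \<in> borel_measurable lebesgue" if "h \<in> L2" for h :: "real^'n \<Rightarrow> complex"
    using L2_measurable[OF that] by simp
  have sq: "(\<integral>\<^sup>+x. (ennreal (norm (h x)))\<^sup>2 \<partial>lebesgue) = ennreal (sqnorm h)" if "h \<in> L2" for h :: "real^'n \<Rightarrow> complex"
    using sqnorm_nn[OF that] by (simp add: ennreal_power)
  have "ennreal ((\<integral>x. norm (f x) * norm (g x) \<partial>lebesgue)\<^sup>2) = (\<integral>\<^sup>+x. ennreal (norm (f x) * norm (g x)) \<partial>lebesgue)\<^sup>2"
    using nn_integral_eq_integral[OF i] by (simp add: ennreal_power)
  also have "\<dots> = (\<integral>\<^sup>+x. ennreal (norm (f x)) * ennreal (norm (g x)) \<partial>lebesgue)\<^sup>2"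
    by (simp add: ennreal_mult)
  also have "\<dots> \<le> ennreal (sqnorm f) * ennreal (sqnorm g)"
    using Cauchy_Schwarz_nn_integral[OF m[OF assms(1)] m[OF assms(2)]] by (simp only: sq assms)
  also have "\<dots> = ennreal (sqnorm f * sqnorm g)"
    by (simp add: ennreal_mult sqnorm_nonneg)
  finally show ?thesis
    using ennreal_le_iff[of "sqnorm f * sqnorm g"] mult_nonneg_nonneg[OF sqnorm_nonneg sqnorm_nonneg]
    by blast
qed

lemma L2_Cauchy_Schwarz:
  assumes "f \<in> L2" "g \<in> L2"
  shows "norm (\<integral>x. f x * g x \<partial>lebesgue) \<le> sqrt (sqnorm f * sqnorm g)"
proof -
  have "norm (\<integral>x. f x * g x \<partial>lebesgue) \<le> (\<integral>x. norm (f x) * norm (g x) \<partial>lebesgue)"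
    using integral_norm_bound[of lebesgue "\<lambda>x. f x * g x"] by (simp add: norm_mult)
  also have "\<dots> \<le> sqrt (sqnorm f * sqnorm g)"
    by (rule real_le_rsqrt[OF L2_Cauchy_Schwarz_norm[OF assms]])
  finally show ?thesis .
qed

lemma sqnorm_eq_0_AE:
  assumes "f \<in> L2" "sqnorm f = 0"
  shows "AE x in lebesgue. f x = 0"
proof -
  have "AE x in lebesgue. (norm (f x))\<^sup>2 = 0"
    using assms(2) integral_nonneg_eq_0_iff_AE[OF L2_integrable[OF assms(1)]]
    by (simp add: sqnorm_def)
  then show ?thesis by simp
qed

section \<open>Convergence in the mean square\<close>

text \<open>Membership is included because \<open>sqnorm\<close> of a function that is not square
  integrable is zero by default, so the limit alone would carry no information.\<close>

definition L2_tendsto ::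
  "(nat \<Rightarrow> (real^'n::finite) \<Rightarrow> complex) \<Rightarrow> ((real^'n) \<Rightarrow> complex) \<Rightarrow> bool" where
  "L2_tendsto F f \<longleftrightarrow> (\<forall>k. F k \<in> L2) \<and> f \<in> L2 \<and> (\<lambda>k. sqnorm (\<lambda>x. F k x - f x)) \<longlonglongrightarrow> 0"

lemma L2_tendsto_cnj: "L2_tendsto F f \<Longrightarrow> L2_tendsto (\<lambda>k x. cnj (F k x)) (\<lambda>x. cnj (f x))"
  by (simp add: L2_tendsto_def L2_cnj sqnorm_cnj_diff)

lemma L2_tendsto_const: "f \<in> L2 \<Longrightarrow> L2_tendsto (\<lambda>_. f) f"
  by (simp add: L2_tendsto_def sqnorm_def)

lemma L2_tendsto_bounded_mult:
  assumes F: "L2_tendsto F f" and a: "a \<in> borel_measurable lebesgue" "AE x in lebesgue. norm (a x) \<le> C"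
  shows "L2_tendsto (\<lambda>k x. a x * F k x) (\<lambda>x. a x * f x)"
  unfolding L2_tendsto_def
proof (intro conjI allI)
  show "(\<lambda>x. a x * F k x) \<in> L2" for k
    using F L2_bounded_mult(1)[OF _ a] by (simp add: L2_tendsto_def)
  show "(\<lambda>x. a x * f x) \<in> L2"
    using F L2_bounded_mult(1)[OF _ a] by (simp add: L2_tendsto_def)
  have le: "sqnorm (\<lambda>x. a x * F k x - a x * f x) \<le> C\<^sup>2 * sqnorm (\<lambda>x. F k x - f x)" for k
    using L2_bounded_mult(2)[OF L2_diff a, of "F k" f] F by (simp add: L2_tendsto_def right_diff_distrib)
  have "(\<lambda>k. C\<^sup>2 * sqnorm (\<lambda>x. F k x - f x)) \<longlonglongrightarrow> C\<^sup>2 * 0"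
    using F by (intro tendsto_mult tendsto_const) (simp add: L2_tendsto_def)
  then have lim: "(\<lambda>k. C\<^sup>2 * sqnorm (\<lambda>x. F k x - f x)) \<longlonglongrightarrow> 0" by simp
  show "(\<lambda>k. sqnorm (\<lambda>x. a x * F k x - a x * f x)) \<longlonglongrightarrow> 0"
    by (rule Lim_null_comparison[OF _ lim]) (simp only: real_norm_def abs_of_nonneg[OF sqnorm_nonneg] le eventually_True)
qed

text \<open>The difference of the products F G and f g is (F - f) (G - g) + (F - f) g + f (G - g),
  and Cauchy-Schwarz sends each of the three integrals to zero. The pairing is bilinear; conjugates
  enter through \<open>L2_tendsto_cnj\<close>.\<close>

lemma L2_tendsto_integral_mult:
  assumes F: "L2_tendsto F f" and G: "L2_tendsto G g"
  shows "(\<lambda>k. \<integral>x. F k x * G k x \<partial>lebesgue) \<longlonglongrightarrow> (\<integral>x. f x * g x \<partial>lebesgue)"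
proof -
  have m: "F k \<in> L2" "G k \<in> L2" "f \<in> L2" "g \<in> L2" for k
    using F G by (auto simp: L2_tendsto_def)
  define p where "p k = sqnorm (\<lambda>x. F k x - f x)" for k
  define q where "q k = sqnorm (\<lambda>x. G k x - g x)" for k
  have pq: "p \<longlonglongrightarrow> 0" "q \<longlonglongrightarrow> 0"
    using F G by (auto simp: L2_tendsto_def p_def [abs_def] q_def [abs_def])
  have "norm ((\<integral>x. F k x * G k x \<partial>lebesgue) - (\<integral>x. f x * g x \<partial>lebesgue))
      \<le> sqrt (p k * q k) + sqrt (p k * sqnorm g) + sqrt (sqnorm f * q k)" for k
  proof -
    let ?F = "\<lambda>x. F k x - f x" and ?G = "\<lambda>x. G k x - g x"
    have d: "?F \<in> L2" "?G \<in> L2" by (intro L2_diff m)+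
    have "(\<integral>x. F k x * G k x \<partial>lebesgue) - (\<integral>x. f x * g x \<partial>lebesgue) =
        (\<integral>x. ?F x * ?G x + ?F x * g x + f x * ?G x \<partial>lebesgue)"
      using m by (subst Bochner_Integration.integral_diff[symmetric])
        (auto intro!: L2_mult_integrable Bochner_Integration.integral_cong simp: algebra_simps)
    also have "\<dots> = (\<integral>x. ?F x * ?G x \<partial>lebesgue) + (\<integral>x. ?F x * g x \<partial>lebesgue) + (\<integral>x. f x * ?G x \<partial>lebesgue)"
      using m d by (simp add: Bochner_Integration.integral_add Bochner_Integration.integrable_add L2_mult_integrable)
    finally have eq: "(\<integral>x. F k x * G k x \<partial>lebesgue) - (\<integral>x. f x * g x \<partial>lebesgue) = \<dots>" .
    have "norm \<dots> \<le> norm (\<integral>x. ?F x * ?G x \<partial>lebesgue) + norm (\<integral>x. ?F x * g x \<partial>lebesgue) + norm (\<integral>x. f x * ?G x \<partial>lebesgue)"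
      by (rule order_trans[OF norm_triangle_ineq add_right_mono[OF norm_triangle_ineq]])
    also have "\<dots> \<le> sqrt (p k * q k) + sqrt (p k * sqnorm g) + sqrt (sqnorm f * q k)"
      unfolding p_def q_def
      using add_mono[OF add_mono[OF L2_Cauchy_Schwarz[OF d(1) d(2)] L2_Cauchy_Schwarz[OF d(1) m(4)]]
          L2_Cauchy_Schwarz[OF m(3) d(2)]] .
    finally show ?thesis unfolding eq .
  qed
  note bound = this
  have "(\<lambda>k. sqrt (p k * q k) + sqrt (p k * sqnorm g) + sqrt (sqnorm f * q k)) \<longlonglongrightarrow>
      sqrt (0 * 0) + sqrt (0 * sqnorm g) + sqrt (sqnorm f * 0)"
    by (intro tendsto_add tendsto_real_sqrt tendsto_mult tendsto_const pq)
  then have lim: "(\<lambda>k. sqrt (p k * q k) + sqrt (p k * sqnorm g) + sqrt (sqnorm f * q k)) \<longlonglongrightarrow> 0"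
    by simp
  from Lim_null_comparison[OF always_eventually[OF allI[OF bound]] lim]
  show ?thesis by (rule LIM_zero_cancel)
qed

lemma integral_mult_cnj: "(\<integral>x. f x * cnj (f x) \<partial>lebesgue) = of_real (sqnorm f)"
  unfolding sqnorm_def by (simp add: complex_norm_square[symmetric] flip: integral_complex_of_real)

lemma L2_tendsto_sqnorm:
  assumes "L2_tendsto F f"
  shows "(\<lambda>k. sqnorm (F k)) \<longlonglongrightarrow> sqnorm f"
  using L2_tendsto_integral_mult[OF assms L2_tendsto_cnj[OF assms]]
  by (simp add: integral_mult_cnj tendsto_of_real_iff)

lemma L2_locally_integrable:
  assumes "f \<in> L2"
  shows "locally_integrable f"
  unfolding locally_integrable_def
proof (intro allI impI)
  fix K :: "(real^'a) set"
  assume K: "compact K"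
  show "f absolutely_integrable_on K"
    unfolding set_integrable_def
  proof (rule Bochner_Integration.integrable_bound)
    have Km: "K \<in> sets lebesgue" "emeasure lebesgue K < \<infinity>"
      using lmeasurable_compact[OF K] by (auto simp: fmeasurable_def)
    show "integrable lebesgue (\<lambda>x. indicat_real K x + (norm (f x))\<^sup>2)"
      using Km by (intro Bochner_Integration.integrable_add L2_integrable assms) simp
    show "(\<lambda>x. indicat_real K x *\<^sub>R f x) \<in> borel_measurable lebesgue"
      using Km by (intro borel_measurable_scaleR L2_measurable assms borel_measurable_indicator)
    have "norm (f x) \<le> 1 + (norm (f x))\<^sup>2" for x
      using sum_squares_bound[of "norm (f x)" 1] norm_ge_zero[of "f x"] unfolding power2_eq_square by linarith
    then show "AE x in lebesgue. norm (indicat_real K x *\<^sub>R f x) \<le> norm (indicat_real K x + (norm (f x))\<^sup>2)"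
      by (auto simp: indicator_def)
  qed
qed

lemma test_functions_L2:
  assumes "\<phi> \<in> test_functions"
  shows "\<phi> \<in> L2"
proof -
  let ?K = "closure {x. \<phi> x \<noteq> 0}"
  have "compact ?K" using test_functions_bounded_support[OF assms] by simp
  then have K: "?K \<in> sets lebesgue" "emeasure lebesgue ?K < \<infinity>"
    using lmeasurable_compact[of ?K] by (auto simp: fmeasurable_def)
  obtain B where B: "B > 0" "\<And>x. norm (\<phi> x) \<le> B" using test_functions_bounded[OF assms] by blast
  show ?thesis
  proof (rule L2_dominated)
    show "integrable lebesgue (\<lambda>x. B\<^sup>2 * indicat_real ?K x)"
      using K by (intro integrable_mult_right) simp
    have "(norm (\<phi> x))\<^sup>2 \<le> B\<^sup>2 * indicat_real ?K x" for x
      using B power_mono[OF B(2) norm_ge_zero, of x 2] closure_subset[of "{x. \<phi> x \<noteq> 0}"]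
      by (cases "\<phi> x = 0") (auto simp: indicator_def)
    then show "AE x in lebesgue. (norm (\<phi> x))\<^sup>2 \<le> B\<^sup>2 * indicat_real ?K x"
      by simp
  qed (simp add: borel_imp_lebesgue_measurable test_functions_borel assms)
qed

section \<open>Weak derivatives up to null sets\<close>

lemma locally_integrable_cong_AE:
  assumes f: "locally_integrable f" and ae: "AE x in lebesgue. f x = g x"
  shows "locally_integrable g"
  unfolding locally_integrable_def
proof (intro allI impI)
  fix K :: "(real^'a) set"
  assume "compact K"
  then have i: "integrable lebesgue (\<lambda>x. indicat_real K x *\<^sub>R f x)"
    using f by (simp add: locally_integrable_def set_integrable_def)
  have ae': "AE x in lebesgue. indicat_real K x *\<^sub>R f x = indicat_real K x *\<^sub>R g x"
    using ae by eventually_elim simp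
  show "g absolutely_integrable_on K"
    unfolding set_integrable_def
    using i integrable_cong_AE[OF borel_measurable_integrable[OF i]
        lebesgue_measurable_cong_AE[OF borel_measurable_integrable[OF i] ae'] ae'] by simp
qed

lemma locally_integrable_add:
  "locally_integrable f \<Longrightarrow> locally_integrable g \<Longrightarrow> locally_integrable (\<lambda>x. f x + g x)"
  by (simp add: locally_integrable_def set_integral_add)

lemma locally_integrable_diff:
  "locally_integrable f \<Longrightarrow> locally_integrable g \<Longrightarrow> locally_integrable (\<lambda>x. f x - g x)"
  by (simp add: locally_integrable_def set_integral_diff)

text \<open>Covers nonmeasurable products as well: by completeness both products fail to be
  measurable together, and then both integrals are zero by default.\<close>

lemma integral_mult_cong_AE:
  fixes f g \<phi> :: "(real^'n::finite) \<Rightarrow> complex"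
  assumes "AE x in lebesgue. f x = g x"
  shows "(\<integral>x. f x * \<phi> x \<partial>lebesgue) = (\<integral>x. g x * \<phi> x \<partial>lebesgue)"
proof -
  have ae: "AE x in lebesgue. f x * \<phi> x = g x * \<phi> x" using assms by eventually_elim simp
  show ?thesis
  proof (cases "(\<lambda>x. f x * \<phi> x) \<in> borel_measurable lebesgue")
    case True
    then show ?thesis using integral_cong_AE[OF True lebesgue_measurable_cong_AE[OF True ae] ae] by simp
  next
    case False
    have ae': "AE x in lebesgue. g x * \<phi> x = f x * \<phi> x" using assms by eventually_elim simp
    have "(\<lambda>x. g x * \<phi> x) \<notin> borel_measurable lebesgue"
      using lebesgue_measurable_cong_AE[OF _ ae'] False by (rule contrapos_nn[rotated])
    then have "\<not> integrable lebesgue (\<lambda>x. g x * \<phi> x)" "\<not> integrable lebesgue (\<lambda>x. f x * \<phi> x)"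
      using False borel_measurable_integrable[of lebesgue "\<lambda>x. g x * \<phi> x"]
        borel_measurable_integrable[of lebesgue "\<lambda>x. f x * \<phi> x"] by argo+
    then show ?thesis by (simp add: not_integrable_integral_eq)
  qed
qed

lemma has_weak_partial_cong_AE:
  assumes w: "has_weak_partial i f g"
    and ae: "AE x in lebesgue. f x = f' x" "AE x in lebesgue. g x = g' x"
  shows "has_weak_partial i f' g'"
  using w locally_integrable_cong_AE[OF _ ae(1)] locally_integrable_cong_AE[OF _ ae(2)]
    integral_mult_cong_AE[OF ae(1)] integral_mult_cong_AE[OF ae(2)]
  by (simp add: has_weak_partial_def)

text \<open>The fundamental lemma applied to g - h. It makes the arbitrary choice in
  \<open>weak_partial\<close> harmless.\<close>

lemma has_weak_partial_unique:
  assumes "has_weak_partial i f g" "has_weak_partial i f h"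
  shows "AE x in lebesgue. g x = h x"
proof -
  have l: "locally_integrable g" "locally_integrable h"
    using assms by (auto simp: has_weak_partial_def)
  have "(\<integral>x. (g x - h x) * \<phi> x \<partial>lebesgue) = 0" if "\<phi> \<in> test_functions" for \<phi>
  proof -
    have "(\<integral>x. (g x - h x) * \<phi> x \<partial>lebesgue) = (\<integral>x. g x * \<phi> x \<partial>lebesgue) - (\<integral>x. h x * \<phi> x \<partial>lebesgue)"
      using locally_integrable_mult_test[OF l(1) that] locally_integrable_mult_test[OF l(2) that]
      by (simp add: left_diff_distrib)
    also have "\<dots> = 0"
      using assms that unfolding has_weak_partial_def by (metis (no_types, lifting) neg_equal_iff_equal right_minus_eq)
    finally show ?thesis .
  qed
  from locally_integrable_eq_0[OF locally_integrable_diff[OF l] this] show ?thesis by simp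
qed

lemma has_weak_partial_weak_partial:
  "has_weak_partial i f g \<Longrightarrow> has_weak_partial i f (weak_partial i f)"
  unfolding weak_partial_def by (rule someI [of "has_weak_partial i f"])

lemma weak_partial_AE_eq:
  "has_weak_partial i f g \<Longrightarrow> AE x in lebesgue. weak_partial i f x = g x"
  by (rule has_weak_partial_unique[OF has_weak_partial_weak_partial])

lemma has_weak_partial_add:
  assumes "has_weak_partial i f g" "has_weak_partial i f' g'"
  shows "has_weak_partial i (\<lambda>x. f x + f' x) (\<lambda>x. g x + g' x)"
  using assms
  by (auto simp: has_weak_partial_def locally_integrable_add distrib_right
      locally_integrable_mult_test test_functions_partial)

lemma has_weak_partial_zero: "has_weak_partial i (\<lambda>x. 0) (\<lambda>x. 0)"
  using L2_locally_integrable[OF L2_zero] by (simp add: has_weak_partial_def)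

lemma has_weak_partial_sum:
  "finite I \<Longrightarrow> (\<And>j. j \<in> I \<Longrightarrow> has_weak_partial i (f j) (g j)) \<Longrightarrow>
    has_weak_partial i (\<lambda>x. \<Sum>j\<in>I. f j x) (\<lambda>x. \<Sum>j\<in>I. g j x)"
  by (induction I rule: finite_induct) (auto intro: has_weak_partial_add has_weak_partial_zero)

section \<open>Taylor bounds and convolution with test functions\<close>

lemma frechet_derivative_eq_sum_partial:
  fixes f :: "(real^'n::finite) \<Rightarrow> complex"
  assumes "C_k (Suc k) f"
  shows "frechet_derivative f (at x) h = (\<Sum>i\<in>UNIV. of_real (h $ i) * partial i f x)"
proof -
  interpret bounded_linear "frechet_derivative f (at x)"
    by (rule has_derivative_bounded_linear[OF C_k_has_derivative[OF assms]])
  have "h = (\<Sum>i\<in>UNIV. h $ i *\<^sub>R axis i 1)"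
    by (simp add: vec_eq_iff axis_def if_distrib cong: if_cong)
  then have "frechet_derivative f (at x) h = (\<Sum>i\<in>UNIV. h $ i *\<^sub>R frechet_derivative f (at x) (axis i 1))"
    by (metis (no_types, lifting) scaleR sum sum.cong)
  then show ?thesis by (simp add: partial_def scaleR_conv_of_real)
qed

lemma norm_sum_mult_component_le:
  fixes h :: "real^'n::finite" and c :: "'n \<Rightarrow> complex"
  assumes "\<And>i. norm (c i) \<le> M"
  shows "norm (\<Sum>i\<in>UNIV. of_real (h $ i) * c i) \<le> real CARD('n) * M * norm h"
proof -
  have "norm (of_real (h $ i) * c i) \<le> M * norm h" for i
    using mult_mono[OF component_le_norm_cart[of h i] assms[of i]] by (simp add: norm_mult mult.commute)
  then have "norm (\<Sum>i\<in>UNIV. of_real (h $ i) * c i) \<le> (\<Sum>i\<in>(UNIV :: 'n set). M * norm h)"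
    by (intro sum_norm_le) auto
  then show ?thesis by (simp add: mult.assoc)
qed

lemma test_functions_Lipschitz:
  fixes \<phi> :: "(real^'n::finite) \<Rightarrow> complex"
  assumes "\<phi> \<in> test_functions"
  obtains M where "M \<ge> 0" "\<And>x y. norm (\<phi> x - \<phi> y) \<le> M * norm (x - y)"
proof -
  have "\<exists>B>0. \<forall>x. norm (partial i \<phi> x) \<le> B" for i
    using test_functions_bounded[OF test_functions_partial[OF assms]] by metis
  then obtain B where B: "\<And>i. B i > 0" "\<And>i x. norm (partial i \<phi> x) \<le> B i" by metis
  define M where "M = (\<Sum>i\<in>UNIV. B i)"
  have BM: "B i \<le> M" for i unfolding M_def by (rule member_le_sum) (use B(1) in \<open>auto intro: less_imp_le\<close>)
  have M0: "M \<ge> 0" unfolding M_def by (rule sum_nonneg) (use B(1) in \<open>auto intro: less_imp_le\<close>)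
  note C = test_functions_C_k[OF assms, of "Suc 0"]
  have "norm (frechet_derivative \<phi> (at x) h) \<le> real CARD('n) * M * norm h" for x h
    unfolding frechet_derivative_eq_sum_partial[OF C]
    by (rule norm_sum_mult_component_le) (rule order_trans[OF B(2) BM])
  then have on: "onorm (frechet_derivative \<phi> (at x)) \<le> real CARD('n) * M" for x
    by (rule onorm_le)
  have "norm (\<phi> x - \<phi> y) \<le> (real CARD('n) * M) * norm (x - y)" for x y
    by (rule differentiable_bound[OF convex_UNIV C_k_has_derivative[OF C] on]) auto
  with M0 show ?thesis using that[of "real CARD('n) * M"] by auto
qed

text \<open>The mean value inequality on a ball of radius |h|, applied to \<phi> minus its
  linearisation at z: the derivative of this difference is of size |h| there, since the partial
  derivatives are Lipschitz. One constant for all z is what differentiation under the convolution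
  integral requires.\<close>

lemma test_functions_Taylor:
  fixes \<phi> :: "(real^'n::finite) \<Rightarrow> complex"
  assumes "\<phi> \<in> test_functions"
  obtains M where "M \<ge> 0"
    "\<And>z h. norm (\<phi> (z + h) - \<phi> z - (\<Sum>i\<in>UNIV. of_real (h $ i) * partial i \<phi> z)) \<le> M * (norm h)\<^sup>2"
proof -
  have "\<exists>B\<ge>0. \<forall>x y. norm (partial i \<phi> x - partial i \<phi> y) \<le> B * norm (x - y)" for i
    using test_functions_Lipschitz[OF test_functions_partial[OF assms]] by metis
  then obtain B where B: "\<And>i. B i \<ge> 0" "\<And>i x y. norm (partial i \<phi> x - partial i \<phi> y) \<le> B i * norm (x - y)"
    by metis
  define M where "M = (\<Sum>i\<in>UNIV. B i)"
  have BM: "B i \<le> M" for i unfolding M_def by (rule member_le_sum) (use B(1) in auto)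
  have M0: "M \<ge> 0" unfolding M_def by (rule sum_nonneg) (use B(1) in auto)
  note C = test_functions_C_k[OF assms, of "Suc 0"]
  define D where "D z h = (\<Sum>i\<in>UNIV. of_real (h $ i) * partial i \<phi> z)" for z and h :: "real^'n"
  have D: "frechet_derivative \<phi> (at z) = D z" for z
    using frechet_derivative_eq_sum_partial[OF C] by (auto simp: D_def)
  have "norm (\<phi> (z + h) - \<phi> z - D z h) \<le> (real CARD('n) * M) * (norm h)\<^sup>2" for z h
  proof -
    interpret bounded_linear "D z"
      using has_derivative_bounded_linear[OF C_k_has_derivative[OF C]] by (simp add: D)
    define p where "p k = \<phi> k - D z k" for k
    have d: "(p has_derivative (\<lambda>k. D y k - D z k)) (at y within cball z (norm h))" for y
      unfolding p_def [abs_def]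
      using C_k_has_derivative[OF C, of y] bounded_linear_imp_has_derivative[OF bounded_linear_axioms]
      by (intro has_derivative_diff) (auto intro: has_derivative_at_withinI simp: D)
    have "onorm (\<lambda>k. D y k - D z k) \<le> real CARD('n) * M * norm h" if "y \<in> cball z (norm h)" for y
    proof (rule onorm_le)
      fix k
      have "norm (partial i \<phi> y - partial i \<phi> z) \<le> M * norm h" for i
        using mult_mono[OF BM[of i] _ M0, of "norm (y - z)" "norm h"] B(2)[of i y z] that
        by (auto simp: dist_norm norm_minus_commute)
      from norm_sum_mult_component_le[of "\<lambda>i. partial i \<phi> y - partial i \<phi> z", OF this, of k]
      show "norm (D y k - D z k) \<le> real CARD('n) * M * norm h * norm k"
        by (simp add: D_def right_diff_distrib sum_subtractf mult.assoc)
    qed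
    from differentiable_bound[OF convex_cball d this, of "z + h" z]
    have "norm (p (z + h) - p z) \<le> real CARD('n) * M * norm h * norm h"
      by (simp add: dist_norm)
    then show ?thesis by (simp add: p_def add algebra_simps power2_eq_square)
  qed
  with M0 show ?thesis using that[of "real CARD('n) * M"] by (auto simp: D_def)
qed

definition conv ::
    "((real^'n::finite) \<Rightarrow> complex) \<Rightarrow> ((real^'n) \<Rightarrow> complex) \<Rightarrow> (real^'n) \<Rightarrow> complex" where
  "conv u \<psi> x = (\<integral>y. u y * \<psi> (x - y) \<partial>lebesgue)"

lemma test_functions_reflect:
  assumes "\<psi> \<in> test_functions"
  shows "(\<lambda>y. \<psi> (x - y)) \<in> test_functions"
  using test_functions_affine[OF assms, of "-1" x] by simp

lemma partial_reflect:
  assumes "\<psi> \<in> test_functions"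
  shows "partial i (\<lambda>y. \<psi> (x - y)) y = - partial i \<psi> (x - y)"
  using partial_affine[OF test_functions_C_k[OF assms], of i "-1" x y] by simp

text \<open>Differentiation under the integral sign in quantitative form. The Taylor remainder of
  the kernel is at most M |h|^2 everywhere and, for |h| at most 1, vanishes outside one fixed ball
  on which u is integrable; this gives an error of order |h|^2.\<close>

lemma conv_has_derivative:
  fixes u :: "(real^'n::finite) \<Rightarrow> complex"
  assumes u: "locally_integrable u" and \<psi>: "\<psi> \<in> test_functions"
  shows "(conv u \<psi> has_derivative (\<lambda>h. \<Sum>i\<in>UNIV. of_real (h $ i) * conv u (partial i \<psi>) x)) (at x)"
proof -
  let ?D = "\<lambda>h. \<Sum>i\<in>UNIV. complex_of_real (h $ i) * conv u (partial i \<psi>) x"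
  obtain M where M: "M \<ge> 0"
    "\<And>z h. norm (\<psi> (z + h) - \<psi> z - (\<Sum>i\<in>UNIV. of_real (h $ i) * partial i \<psi> z)) \<le> M * (norm h)\<^sup>2"
    using test_functions_Taylor[OF \<psi>] by blast
  have "bounded ({x. \<psi> x \<noteq> 0} \<union> (\<Union>i. {x. partial i \<psi> x \<noteq> 0}))"
    by (intro bounded_Un[THEN iffD2] conjI bounded_UN finite_UNIV ballI
        test_functions_bounded_support test_functions_partial \<psi>) simp
  then obtain B where B: "\<And>z. \<psi> z \<noteq> 0 \<Longrightarrow> norm z \<le> B" "\<And>i z. partial i \<psi> z \<noteq> 0 \<Longrightarrow> norm z \<le> B"
    by (auto simp: bounded_iff)
  \<comment> \<open>The extra 1 in the radius leaves room for the shift by \<open>h\<close>.\<close>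
  let ?K = "cball x (B + 1)"
  define I where "I = (\<integral>y. norm (indicat_real ?K y *\<^sub>R u y) \<partial>lebesgue)"
  have Ki: "integrable lebesgue (\<lambda>y. indicat_real ?K y *\<^sub>R u y)"
    using u by (simp add: locally_integrable_def set_integrable_def)
  have int: "integrable lebesgue (\<lambda>y. u y * \<eta> (z - y))" if "\<eta> \<in> test_functions" for \<eta> z
    by (rule locally_integrable_mult_test[OF u test_functions_reflect[OF that]])
  have bl: "bounded_linear ?D"
    by (intro bounded_linear_sum bounded_linear_mult_const bounded_linear_compose[OF bounded_linear_of_real bounded_linear_vec_nth])
  have est: "norm (conv u \<psi> (x + h) - conv u \<psi> x - ?D h) \<le> M * I * (norm h)\<^sup>2" if h: "norm h \<le> 1" for h
  proof -
    define r where "r y = \<psi> (x + h - y) - \<psi> (x - y) - (\<Sum>i\<in>UNIV. of_real (h $ i) * partial i \<psi> (x - y))" for y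
    have r: "norm (r y) \<le> M * (norm h)\<^sup>2" for y
      using M(2)[of "x - y" h] by (simp add: r_def algebra_simps)
    have r0: "r y = 0" if "y \<notin> ?K" for y
    proof -
      have n: "norm (x - y) > B + 1" using that by (simp add: dist_norm)
      moreover have "norm (x - y) \<le> norm (x + h - y) + norm h"
        using norm_triangle_ineq4[of "x + h - y" h] by (simp add: algebra_simps)
      ultimately have "norm (x + h - y) > B" using h by linarith
      then have "\<psi> (x + h - y) = 0" using B(1)[of "x + h - y"] by linarith
      moreover have "\<psi> (x - y) = 0" using B(1)[of "x - y"] n by linarith
      moreover have "partial i \<psi> (x - y) = 0" for i using B(2)[of i "x - y"] n by linarith
      ultimately show ?thesis by (simp add: r_def)
    qed
    have "conv u \<psi> (x + h) - conv u \<psi> x - ?D h =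
        (\<integral>y. u y * \<psi> (x + h - y) - u y * \<psi> (x - y) -
          (\<Sum>i\<in>UNIV. of_real (h $ i) * (u y * partial i \<psi> (x - y))) \<partial>lebesgue)"
      unfolding conv_def
      by (simp add: int \<psi> test_functions_partial)
    also have "\<dots> = (\<integral>y. u y * r y \<partial>lebesgue)"
      by (rule Bochner_Integration.integral_cong) (auto simp: r_def algebra_simps sum_distrib_left)
    finally have eq: "conv u \<psi> (x + h) - conv u \<psi> x - ?D h = (\<integral>y. u y * r y \<partial>lebesgue)" .
    have "norm (\<integral>y. u y * r y \<partial>lebesgue) \<le> (\<integral>y. M * (norm h)\<^sup>2 * norm (indicat_real ?K y *\<^sub>R u y) \<partial>lebesgue)"
    proof (rule order_trans[OF integral_norm_bound], rule integral_mono)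
      have "integrable lebesgue (\<lambda>y. u y * \<psi> (x + h - y) - u y * \<psi> (x - y) -
          (\<Sum>i\<in>UNIV. of_real (h $ i) * (u y * partial i \<psi> (x - y))))"
        by (intro Bochner_Integration.integrable_diff Bochner_Integration.integrable_sum integrable_mult_right
            int \<psi> test_functions_partial)
      then show "integrable lebesgue (\<lambda>y. norm (u y * r y))"
        by (intro integrable_norm) (simp add: r_def algebra_simps sum_distrib_left)
      show "integrable lebesgue (\<lambda>y. M * (norm h)\<^sup>2 * norm (indicat_real ?K y *\<^sub>R u y))"
        by (intro integrable_mult_right integrable_norm Ki)
      show "norm (u y * r y) \<le> M * (norm h)\<^sup>2 * norm (indicat_real ?K y *\<^sub>R u y)" for y
        using r0[of y] mult_left_mono[OF r[of y] norm_ge_zero[of "u y"]]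
        by (cases "y \<in> ?K") (auto simp: norm_mult mult_ac)
    qed
    also have "\<dots> = M * (norm h)\<^sup>2 * I"
      unfolding I_def by (rule integral_mult_right_zero)
    finally show ?thesis unfolding eq by (simp only: mult_ac)
  qed
  show ?thesis
  proof (rule has_derivativeI_sandwich[where e=1 and H="\<lambda>y. M * I * norm (y - x)"])
    show "norm (conv u \<psi> y - conv u \<psi> x - ?D (y - x)) / norm (y - x) \<le> M * I * norm (y - x)"
      if "y \<noteq> x" "dist y x < 1" for y
      using est[of "y - x"] that by (simp add: dist_norm divide_simps power2_eq_square mult_ac)
    have "((\<lambda>y. M * I * norm (y - x)) \<longlongrightarrow> M * I * norm (x - x)) (at x)"
      by (intro tendsto_mult tendsto_const tendsto_norm tendsto_diff tendsto_ident_at)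
    then show "((\<lambda>y. M * I * norm (y - x)) \<longlongrightarrow> 0) (at x)" by simp
  qed (use bl in auto)
qed

lemma partial_conv:
  assumes "locally_integrable u" "\<psi> \<in> test_functions"
  shows "partial i (conv u \<psi>) = conv u (partial i \<psi>)"
proof
  fix x
  have "partial i (conv u \<psi>) x = (\<Sum>j\<in>UNIV. of_real (axis i 1 $ j) * conv u (partial j \<psi>) x)"
    by (rule partial_eqI[OF conv_has_derivative[OF assms]])
  also have "\<dots> = (\<Sum>j\<in>UNIV. if j = i then conv u (partial j \<psi>) x else 0)"
    by (intro sum.cong) (auto simp: axis_def)
  also have "\<dots> = conv u (partial i \<psi>) x"
    by simp
  finally show "partial i (conv u \<psi>) x = conv u (partial i \<psi>) x" .
qed

lemma C_k_conv:
  assumes "locally_integrable u" "\<psi> \<in> test_functions"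
  shows "C_k k (conv u \<psi>)"
  using assms(2)
proof (induction k arbitrary: \<psi>)
  case 0
  have "isCont (conv u \<psi>) x" for x
    by (rule has_derivative_continuous[OF conv_has_derivative[OF assms(1) 0]])
  then show ?case by (simp add: continuous_at_imp_continuous_on)
next
  case (Suc k)
  have "conv u \<psi> differentiable at x" for x
    by (rule differentiableI[OF conv_has_derivative[OF assms(1) Suc.prems]])
  then show ?case
    using Suc.IH[OF test_functions_partial[OF Suc.prems]]
    by (simp add: partial_conv[OF assms(1) Suc.prems])
qed

text \<open>For fixed x the reflected kernel is itself a test function. The sign produced by the
  reflection cancels the sign in the definition of the weak derivative, so the derivative passes
  from the kernel to u.\<close>

lemma conv_partial_eq:
  assumes w: "has_weak_partial i u g" and \<psi>: "\<psi> \<in> test_functions"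
  shows "conv u (partial i \<psi>) = conv g \<psi>"
proof
  fix x
  have "(\<integral>y. u y * partial i (\<lambda>y. \<psi> (x - y)) y \<partial>lebesgue) = - (\<integral>y. g y * \<psi> (x - y) \<partial>lebesgue)"
    using w test_functions_reflect[OF \<psi>, of x] by (simp add: has_weak_partial_def)
  then show "conv u (partial i \<psi>) x = conv g \<psi> x"
    by (simp add: partial_reflect[OF \<psi>] conv_def)
qed

section \<open>Approximation by test functions\<close>

lemma lborel_distr_diff: "distr lborel borel (\<lambda>x. x - z) = (lborel :: 'a::euclidean_space measure)"
  using lborel_distr_plus[of "- z"] by (simp add: add.commute[of "- z"] cong: distr_cong)

lemma lborel_distr_minus: "distr lborel borel (\<lambda>z. x - z) = (lborel :: 'a::euclidean_space measure)"
  using lborel_affine[of "-1" x] by (simp add: density_1)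

lemma lborel_integrable_translate:
  fixes f :: "'a::euclidean_space \<Rightarrow> 'b::{banach, second_countable_topology}"
  assumes "integrable lborel f"
  shows "integrable lborel (\<lambda>x. f (x - z))"
proof -
  have "integrable (distr lborel borel (\<lambda>x. x - z)) f" using assms by (simp only: lborel_distr_diff)
  moreover have "f \<in> borel_measurable borel" using borel_measurable_integrable[OF assms] by simp
  ultimately show ?thesis by (subst (asm) integrable_distr_eq) auto
qed

lemma lborel_integral_translate:
  fixes f :: "'a::euclidean_space \<Rightarrow> 'b::{banach, second_countable_topology}"
  assumes "f \<in> borel_measurable borel"
  shows "(\<integral>x. f (x - z) \<partial>lborel) = (\<integral>x. f x \<partial>lborel)"
  using integral_distr[of "\<lambda>x. x - z" lborel borel f] assms by (simp add: lborel_distr_diff)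

lemma compact_inner_regular_lborel:
  fixes A :: "'a::euclidean_space set"
  assumes A: "A \<in> sets borel" "emeasure lborel A < \<infinity>" and "e > 0"
  obtains K where "compact K" "K \<subseteq> A" "measure lborel A - measure lborel K < e"
proof (cases "measure lborel A = 0")
  case True
  then show ?thesis using that[of "{}"] \<open>e > 0\<close> by simp
next
  case False
  \<comment> \<open>Restricting the measure to \<open>A\<close> makes it finite, as inner regularity
    requires, and leaves subsets of \<open>A\<close> unchanged.\<close>
  let ?M = "density lborel (indicator A)"
  have em: "emeasure ?M B = emeasure lborel (A \<inter> B)" if "B \<in> sets borel" for B
  proof -
    have "(\<integral>\<^sup>+x. indicator A x * indicator B x \<partial>lborel) = (\<integral>\<^sup>+x. indicator (A \<inter> B) x \<partial>lborel)"
      by (intro nn_integral_cong) (auto simp: indicator_def)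
    with A that show ?thesis by (simp add: emeasure_density)
  qed
  have fA: "emeasure lborel A = ennreal (measure lborel A)"
    using A(2) by (intro emeasure_eq_ennreal_measure) auto
  have "emeasure ?M A = (SUP K \<in> {K. K \<subseteq> A \<and> compact K}. emeasure ?M K)"
    using A em[of UNIV] by (intro inner_regular) auto
  moreover have "emeasure ?M A = ennreal (measure lborel A)"
    by (simp add: em A fA)
  moreover have "ennreal (measure lborel A - e) < ennreal (measure lborel A)"
    using False \<open>e > 0\<close> zero_less_measure_iff[of lborel A] by (intro ennreal_lessI) simp_all
  ultimately have "ennreal (measure lborel A - e) < (SUP K \<in> {K. K \<subseteq> A \<and> compact K}. emeasure ?M K)"
    by (simp only:)
  then obtain K where K: "K \<subseteq> A" "compact K" "ennreal (measure lborel A - e) < emeasure ?M K"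
    by (auto simp: less_SUP_iff)
  then have "emeasure ?M K = emeasure lborel K"
    by (simp add: em borel_compact Int_absorb1)
  also have "\<dots> = ennreal (measure lborel K)"
    using emeasure_lborel_cbox emeasure_compact_finite[OF K(2)] by (intro emeasure_eq_ennreal_measure) auto
  finally have "ennreal (measure lborel A - e) < ennreal (measure lborel K)" using K by simp
  then have "measure lborel A - e < measure lborel K"
    by (meson ennreal_leI not_le)
  then show ?thesis using that K by auto
qed

text \<open>For an indicator, squeeze the set between a compact K and an open U of nearly the same
  measure; a small shift of K remains inside U. Sums and dominated limits then follow by the
  triangle inequality and translation invariance.\<close>

lemma L1_translation_continuous:
  fixes f :: "'a::euclidean_space \<Rightarrow> 'b::{banach, second_countable_topology}"
  assumes "integrable lborel f"
  shows "\<forall>e>0. \<exists>d>0. \<forall>z. norm z < d \<longrightarrow> (\<integral>x. norm (f (x - z) - f x) \<partial>lborel) < e"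
  using assms
proof (induction rule: integrable_induct)
  case (base A c)
  show ?case
  proof (intro allI impI)
    fix e :: real
    assume "e > 0"
    \<comment> \<open>The three differences in the squeeze cost less than e', 2 e' and e', together
      4 e'. Adding 1 to \<open>norm c\<close> avoids division by zero.\<close>
    define e' where "e' = e / (4 * (norm c + 1))"
    have e': "e' > 0" using \<open>e > 0\<close> by (simp add: e'_def add_nonneg_pos)
    have A: "A \<in> sets borel" using base by simp
    obtain U where U: "open U" "A \<subseteq> U" "emeasure lborel (U - A) < ennreal e'"
      using outer_regular_lborel[OF A e'] by blast
    obtain K where K: "compact K" "K \<subseteq> A" "measure lborel A - measure lborel K < e'"
      using compact_inner_regular_lborel[OF A base(2) e'] by blast
    obtain d where d: "d > 0" "(\<Union>x\<in>K. ball x d) \<subseteq> U"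
      using compact_subset_open_imp_ball_epsilon_subset[OF K(1) U(1)] K(2) U(2) by blast
    have Um: "U \<in> sets borel" and Km: "K \<in> sets borel" using U K by (auto simp: borel_compact)
    have UA: "U = A \<union> (U - A)" using U(2) by auto
    have fU: "emeasure lborel U < \<infinity>"
    proof -
      have "emeasure lborel U \<le> emeasure lborel A + emeasure lborel (U - A)"
        using emeasure_subadditive[of A lborel "U - A"] A Um UA by simp
      also have "\<dots> < \<infinity>" using base(2) order.strict_trans[OF U(3) ennreal_less_top] by simp
      finally show ?thesis .
    qed
    have fK: "emeasure lborel K < \<infinity>" using emeasure_compact_finite[OF K(1)] by simp
    have mU: "measure lborel U - measure lborel A < e'"
    proof -
      have "measure lborel (U - A) = measure lborel U - measure lborel A"
        using fU A Um U(2) by (intro measure_Diff) auto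
      moreover have "measure lborel (U - A) < e'"
        using U(3) order.strict_trans[OF U(3) ennreal_less_top] by (simp add: measure_def enn2real_less_iff)
      ultimately show ?thesis by simp
    qed
    have iA: "integrable lborel (indicat_real A)" and iU: "integrable lborel (indicat_real U)"
      and iK: "integrable lborel (indicat_real K)"
      using A Um Km base(2) fU fK by (auto intro!: integrable_real_indicator)
    show "\<exists>d>0. \<forall>z. norm z < d \<longrightarrow>
        (\<integral>x. norm (indicat_real A (x - z) *\<^sub>R c - indicat_real A x *\<^sub>R c) \<partial>lborel) < e"
    proof (intro exI conjI allI impI)
      fix z :: 'a
      assume z: "norm z < d"
      have KU: "indicat_real K (x - z) \<le> indicat_real U x" for x
      proof (cases "x - z \<in> K")
        case True
        then have "x \<in> ball (x - z) d" using z by (simp add: dist_norm)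
        with True d(2) have "x \<in> U" by blast
        then show ?thesis by simp
      qed simp
      have KA: "indicat_real K x \<le> indicat_real A x" and AU: "indicat_real A x \<le> indicat_real U x" for x
        using K(2) U(2) by (auto simp: indicator_def)
      \<comment> \<open>This telescopes from A at x - z to K at x - z, to U at x, to A at x; every
        step has a known sign, so no absolute values are left.\<close>
      let ?g = "\<lambda>x. (indicat_real A (x - z) - indicat_real K (x - z)) + (indicat_real U x - indicat_real K (x - z))
          + (indicat_real U x - indicat_real A x)"
      note tA = lborel_integrable_translate[OF iA, of z] and tK = lborel_integrable_translate[OF iK, of z]
      have "(\<integral>x. norm (indicat_real A (x - z) *\<^sub>R c - indicat_real A x *\<^sub>R c) \<partial>lborel) \<le> (\<integral>x. ?g x * norm c \<partial>lborel)"
      proof (rule integral_mono)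
        show "integrable lborel (\<lambda>x. norm (indicat_real A (x - z) *\<^sub>R c - indicat_real A x *\<^sub>R c))"
          by (intro integrable_norm Bochner_Integration.integrable_diff integrable_scaleR_left tA iA)
        show "integrable lborel (\<lambda>x. ?g x * norm c)"
          by (intro integrable_mult_left Bochner_Integration.integrable_add Bochner_Integration.integrable_diff tA tK iU iA)
        fix x
        have "\<bar>indicat_real A (x - z) - indicat_real A x\<bar> \<le> ?g x"
          using KU[of x] KA[of "x - z"] AU[of x] by linarith
        then have "\<bar>indicat_real A (x - z) - indicat_real A x\<bar> * norm c \<le> ?g x * norm c"
          by (rule mult_right_mono) simp
        then show "norm (indicat_real A (x - z) *\<^sub>R c - indicat_real A x *\<^sub>R c) \<le> ?g x * norm c"
          by (simp only: scaleR_diff_left[symmetric] norm_scaleR)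
      qed
      also have "\<dots> = ((measure lborel A - measure lborel K) + (measure lborel U - measure lborel K) +
          (measure lborel U - measure lborel A)) * norm c"
        using A Km Um
        by (simp add: Bochner_Integration.integral_add Bochner_Integration.integral_diff
            Bochner_Integration.integrable_add Bochner_Integration.integrable_diff tA tK iA iU iK
            lborel_integral_translate[of "indicat_real A"] lborel_integral_translate[of "indicat_real K"])
      also have "\<dots> \<le> (4 * e') * norm c"
        using K(3) mU by (intro mult_right_mono) auto
      also have "\<dots> < 4 * e' * (norm c + 1)"
        using e' by (intro mult_strict_left_mono) auto
      also have "\<dots> = e"
      proof -
        have "4 * (e / (4 * m)) * m = e" if "m \<noteq> 0" for m :: real
          using that by simp
        moreover have "norm c + 1 \<noteq> 0" using norm_ge_zero[of c] by linarith
        ultimately show ?thesis unfolding e'_def by blast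
      qed
      finally show "(\<integral>x. norm (indicat_real A (x - z) *\<^sub>R c - indicat_real A x *\<^sub>R c) \<partial>lborel) < e" .
    qed (rule d(1))
  qed
next
  case (add f g)
  show ?case
  proof (intro allI impI)
    fix e :: real
    assume "e > 0"
    then have "e / 2 > 0" by simp
    obtain d1 where d1: "d1 > 0" "\<forall>z. norm z < d1 \<longrightarrow> (\<integral>x. norm (f (x - z) - f x) \<partial>lborel) < e / 2"
      using add.IH(1)[rule_format, OF \<open>e / 2 > 0\<close>] by blast
    obtain d2 where d2: "d2 > 0" "\<forall>z. norm z < d2 \<longrightarrow> (\<integral>x. norm (g (x - z) - g x) \<partial>lborel) < e / 2"
      using add.IH(2)[rule_format, OF \<open>e / 2 > 0\<close>] by blast
    show "\<exists>d>0. \<forall>z. norm z < d \<longrightarrow> (\<integral>x. norm (f (x - z) + g (x - z) - (f x + g x)) \<partial>lborel) < e"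
    proof (intro exI[of _ "min d1 d2"] conjI allI impI)
      fix z :: 'a assume z: "norm z < min d1 d2"
      have i: "integrable lborel (\<lambda>x. norm (f (x - z) - f x))" "integrable lborel (\<lambda>x. norm (g (x - z) - g x))"
        by (intro integrable_norm Bochner_Integration.integrable_diff lborel_integrable_translate add.hyps)+
      have "(\<integral>x. norm (f (x - z) + g (x - z) - (f x + g x)) \<partial>lborel) \<le>
          (\<integral>x. norm (f (x - z) - f x) + norm (g (x - z) - g x) \<partial>lborel)"
      proof (rule integral_mono)
        show "integrable lborel (\<lambda>x. norm (f (x - z) + g (x - z) - (f x + g x)))"
          by (intro integrable_norm Bochner_Integration.integrable_diff Bochner_Integration.integrable_add
              lborel_integrable_translate add.hyps)
        show "norm (f (x - z) + g (x - z) - (f x + g x)) \<le> norm (f (x - z) - f x) + norm (g (x - z) - g x)" for x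
          using norm_triangle_ineq[of "f (x - z) - f x" "g (x - z) - g x"] by (simp add: algebra_simps)
      qed (intro Bochner_Integration.integrable_add i)
      also have "\<dots> = (\<integral>x. norm (f (x - z) - f x) \<partial>lborel) + (\<integral>x. norm (g (x - z) - g x) \<partial>lborel)"
        by (rule Bochner_Integration.integral_add[OF i])
      also have "\<dots> < e" using d1(2)[rule_format, of z] d2(2)[rule_format, of z] z by simp
      finally show "(\<integral>x. norm (f (x - z) + g (x - z) - (f x + g x)) \<partial>lborel) < e" .
    qed (use d1(1) d2(1) in simp)
  qed
next
  case (lim f s)
  \<comment> \<open>The approximants supplied by the induction satisfy norm (s i x) \<le> 2 norm (f
    x), whence the dominating function 3 norm (f x).\<close>
  have "(\<lambda>i. \<integral>x. norm (s i x - f x) \<partial>lborel) \<longlonglongrightarrow> integral\<^sup>L lborel (\<lambda>x::'a. 0)"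
  proof (rule integral_dominated_convergence[where w="\<lambda>x. 3 * norm (f x)"])
    show "integrable lborel (\<lambda>x. 3 * norm (f x))"
      by (intro integrable_mult_right integrable_norm lim.hyps(4))
    show "(\<lambda>x. norm (s i x - f x)) \<in> borel_measurable lborel" for i
      using borel_measurable_integrable[OF lim.hyps(1)] borel_measurable_integrable[OF lim.hyps(4)] by simp
    show "AE x in lborel. (\<lambda>i. norm (s i x - f x)) \<longlonglongrightarrow> 0"
      using lim.hyps(2) by (intro AE_I2 tendsto_norm_zero LIM_zero) auto
    show "AE x in lborel. norm (norm (s i x - f x)) \<le> 3 * norm (f x)" for i
    proof (rule AE_I2)
      fix x
      show "norm (norm (s i x - f x)) \<le> 3 * norm (f x)"
        using lim.hyps(3)[of x i] norm_triangle_ineq4[of "s i x" "f x"] by simp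
    qed
  qed simp
  then have L: "(\<lambda>i. \<integral>x. norm (s i x - f x) \<partial>lborel) \<longlonglongrightarrow> 0" by simp
  show ?case
  proof (intro allI impI)
    fix e :: real
    assume "e > 0"
    then have "eventually (\<lambda>i. (\<integral>x. norm (s i x - f x) \<partial>lborel) < e / 3) sequentially"
      by (intro order_tendstoD(2)[OF L]) simp
    then obtain i where i: "(\<integral>x. norm (s i x - f x) \<partial>lborel) < e / 3"
      by (auto simp: eventually_sequentially)
    have "e / 3 > 0" using \<open>e > 0\<close> by simp
    then obtain d where d: "d > 0" "\<forall>z. norm z < d \<longrightarrow> (\<integral>x. norm (s i (x - z) - s i x) \<partial>lborel) < e / 3"
      using lim.IH[rule_format, of "e / 3" i] by blast
    show "\<exists>d>0. \<forall>z. norm z < d \<longrightarrow> (\<integral>x. norm (f (x - z) - f x) \<partial>lborel) < e"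
    proof (intro exI[of _ d] conjI allI impI d(1))
      fix z :: 'a assume z: "norm z < d"
      let ?h = "\<lambda>x. norm (s i x - f x)"
      have h: "integrable lborel ?h"
        by (intro integrable_norm Bochner_Integration.integrable_diff lim.hyps(1,4))
      note th = lborel_integrable_translate[OF h, of z]
      have si: "integrable lborel (\<lambda>x. norm (s i (x - z) - s i x))"
        by (intro integrable_norm Bochner_Integration.integrable_diff lborel_integrable_translate lim.hyps(1,4))
      have "(\<integral>x. norm (f (x - z) - f x) \<partial>lborel) \<le> (\<integral>x. ?h (x - z) + norm (s i (x - z) - s i x) + ?h x \<partial>lborel)"
      proof (rule integral_mono)
        show "integrable lborel (\<lambda>x. norm (f (x - z) - f x))"
          by (intro integrable_norm Bochner_Integration.integrable_diff lborel_integrable_translate lim.hyps(1,4))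
        show "norm (f (x - z) - f x) \<le> ?h (x - z) + norm (s i (x - z) - s i x) + ?h x" for x
          using norm_triangle_ineq[of "f (x - z) - s i (x - z)" "s i (x - z) - s i x + (s i x - f x)"]
            norm_triangle_ineq[of "s i (x - z) - s i x" "s i x - f x"]
          by (simp add: norm_minus_commute)
      qed (intro Bochner_Integration.integrable_add th si h)
      also have "\<dots> = (\<integral>x. ?h (x - z) \<partial>lborel) + (\<integral>x. norm (s i (x - z) - s i x) \<partial>lborel) + (\<integral>x. ?h x \<partial>lborel)"
        by (simp only: Bochner_Integration.integral_add Bochner_Integration.integrable_add th si h)
      also have "(\<integral>x. ?h (x - z) \<partial>lborel) = (\<integral>x. ?h x \<partial>lborel)"
        using borel_measurable_integrable[OF h] by (intro lborel_integral_translate) simp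
      also have "(\<integral>x. ?h x \<partial>lborel) + (\<integral>x. norm (s i (x - z) - s i x) \<partial>lborel) + (\<integral>x. ?h x \<partial>lborel) < e"
        using i d(2)[rule_format, OF z] by simp
      finally show "(\<integral>x. norm (f (x - z) - f x) \<partial>lborel) < e" .
    qed
  qed
qed

text \<open>Reduces continuity of translation in \<open>L\<^sup>2\<close> to continuity in \<open>L\<^sup>1\<close>, applied to
  \<open>|f| f\<close>.\<close>

lemma norm_diff_square_le:
  fixes z w :: "'a::real_inner"
  shows "(norm (z - w))\<^sup>2 \<le> 2 * norm (norm z *\<^sub>R z - norm w *\<^sub>R w)"
proof (cases "z = w")
  case False
  define a where "a = norm z" define b where "b = norm w" define D where "D = norm (z - w)"
  have ab: "a \<ge> 0" "b \<ge> 0" by (auto simp: a_def b_def)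
  have D: "D > 0" "D \<le> a + b" using False norm_triangle_ineq4[of z w] by (auto simp: D_def a_def b_def)
  have D2: "D\<^sup>2 = a\<^sup>2 + b\<^sup>2 - 2 * (z \<bullet> w)"
    by (simp add: D_def a_def b_def power2_norm_eq_inner inner_diff_left inner_diff_right inner_commute)
  have zz: "z \<bullet> z = a\<^sup>2" "w \<bullet> w = b\<^sup>2" by (simp_all add: a_def b_def power2_norm_eq_inner)
  \<comment> \<open>Strong monotonicity of the map z to |z| z: the pairing with z - w splits into
    two nonnegative terms, and the first already contains the square of the distance. The inequality
    D \<le> a + b then removes the factor a + b.\<close>
  have "(a *\<^sub>R z - b *\<^sub>R w) \<bullet> (z - w) = a * a\<^sup>2 + b * b\<^sup>2 - (a + b) * (z \<bullet> w)"
    by (simp add: inner_diff_left inner_diff_right inner_commute[of w z] zz algebra_simps)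
  also have "\<dots> = (a + b) * D\<^sup>2 / 2 + (a + b) * (a - b)\<^sup>2 / 2"
    unfolding D2 by (simp add: field_simps power2_eq_square)
  finally have "(a + b) * D\<^sup>2 / 2 \<le> (a *\<^sub>R z - b *\<^sub>R w) \<bullet> (z - w)"
    using ab by simp
  also have "\<dots> \<le> norm (a *\<^sub>R z - b *\<^sub>R w) * D"
    unfolding D_def by (rule norm_cauchy_schwarz)
  finally have "(a + b) * D * D \<le> (2 * norm (a *\<^sub>R z - b *\<^sub>R w)) * D"
    by (simp add: power2_eq_square)
  then have "(a + b) * D \<le> 2 * norm (a *\<^sub>R z - b *\<^sub>R w)"
    using D(1) by (simp only: mult_le_cancel_right)
  moreover have "D * D \<le> (a + b) * D" using D by (intro mult_right_mono) auto
  ultimately show ?thesis by (simp add: D_def a_def b_def power2_eq_square)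
qed simp

lemma L2_translation_continuous:
  fixes f :: "'a::euclidean_space \<Rightarrow> complex"
  assumes f: "f \<in> borel_measurable borel" "integrable lborel (\<lambda>x. (norm (f x))\<^sup>2)" and "e > 0"
  obtains d where "d > 0" "\<And>z. norm z < d \<Longrightarrow> (\<integral>\<^sup>+x. ennreal ((norm (f (x - z) - f x))\<^sup>2) \<partial>lborel) \<le> ennreal e"
proof -
  define N where "N x = norm (f x) *\<^sub>R f x" for x
  have N: "integrable lborel N"
  proof (rule Bochner_Integration.integrable_bound[OF f(2)])
    show "N \<in> borel_measurable lborel" using f(1) unfolding N_def [abs_def] by simp
  qed (simp add: N_def power2_eq_square)
  obtain d where d: "d > 0" "\<And>z. norm z < d \<Longrightarrow> (\<integral>x. norm (N (x - z) - N x) \<partial>lborel) < e / 2"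
    using L1_translation_continuous[OF N, rule_format, of "e / 2"] \<open>e > 0\<close> by auto
  have "(\<integral>\<^sup>+x. ennreal ((norm (f (x - z) - f x))\<^sup>2) \<partial>lborel) \<le> ennreal e" if z: "norm z < d" for z
  proof -
    have i: "integrable lborel (\<lambda>x. 2 * norm (N (x - z) - N x))"
      by (intro integrable_mult_right integrable_norm Bochner_Integration.integrable_diff
          lborel_integrable_translate N)
    have "(\<integral>\<^sup>+x. ennreal ((norm (f (x - z) - f x))\<^sup>2) \<partial>lborel) \<le> (\<integral>\<^sup>+x. ennreal (2 * norm (N (x - z) - N x)) \<partial>lborel)"
      unfolding N_def by (intro nn_integral_mono ennreal_leI norm_diff_square_le)
    also have "\<dots> = ennreal (2 * (\<integral>x. norm (N (x - z) - N x) \<partial>lborel))"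
      by (subst nn_integral_eq_integral[OF i]) auto
    also have "\<dots> \<le> ennreal e" using d(2)[OF z] by (intro ennreal_leI) simp
    finally show ?thesis .
  qed
  with d(1) show ?thesis using that by blast
qed

section \<open>Mollification and cutoff\<close>

lemma conv_lborel_eq:
  fixes f :: "(real^'n::finite) \<Rightarrow> complex"
  assumes f: "f \<in> borel_measurable borel" and \<rho>: "\<rho> \<in> test_functions"
  shows "conv f \<rho> x = (\<integral>z. f (x - z) * \<rho> z \<partial>lborel)"
proof -
  note [measurable] = f test_functions_borel[OF \<rho>]
  have "(\<lambda>y. f y * \<rho> (x - y)) \<in> borel_measurable borel" by measurable
  then have "conv f \<rho> x = (\<integral>y. f y * \<rho> (x - y) \<partial>lborel)"
    unfolding conv_def by (intro integral_completion) simp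
  also have "\<dots> = (\<integral>y. f y * \<rho> (x - y) \<partial>distr lborel borel (\<lambda>z. x - z))"
    by (simp only: lborel_distr_minus)
  also have "\<dots> = (\<integral>z. f (x - z) * \<rho> (x - (x - z)) \<partial>lborel)"
    by (intro integral_distr) auto
  finally show ?thesis by simp
qed

text \<open>Jensen's inequality for the probability density \<open>r\<close>, obtained from
  Cauchy-Schwarz by writing r as sqrt r times sqrt r. Total mass 1 allows f x to be moved under the
  convolution integral.\<close>

lemma conv_diff_square_le:
  fixes f :: "(real^'n::finite) \<Rightarrow> complex"
  assumes f: "f \<in> borel_measurable borel" "locally_integrable f"
    and \<rho>: "(\<lambda>x. complex_of_real (r x)) \<in> test_functions" "\<And>x. r x \<ge> 0" "(\<integral>x. r x \<partial>lborel) = 1"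
  shows "ennreal ((norm (conv f (\<lambda>x. of_real (r x)) x - f x))\<^sup>2) \<le>
    (\<integral>\<^sup>+z. ennreal ((norm (f (x - z) - f x))\<^sup>2) * ennreal (r z) \<partial>lborel)"
proof -
  let ?\<rho> = "\<lambda>x. complex_of_real (r x)"
  have "(\<lambda>x. Re (?\<rho> x)) \<in> borel_measurable borel"
    using test_functions_borel[OF \<rho>(1)] by (rule measurable_compose[OF _ borel_measurable_Re]) 
  then have [measurable]: "r \<in> borel_measurable borel" by simp
  note [measurable] = f(1)
  \<comment> \<open>A non-integrable \<open>r\<close> would have integral zero by default, not
    1.\<close>
  have ri: "integrable lborel r"
    using \<rho>(3) not_integrable_integral_eq by fastforce
  have i1: "integrable lborel (\<lambda>z. f (x - z) * ?\<rho> z)"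
  proof -
    have "integrable lebesgue (\<lambda>y. f y * ?\<rho> (x - y))"
      by (rule locally_integrable_mult_test[OF f(2) test_functions_reflect[OF \<rho>(1)]])
    then have "integrable lborel (\<lambda>y. f y * ?\<rho> (x - y))"
      by (subst (asm) integrable_completion) auto
    then have "integrable (distr lborel borel (\<lambda>z. x - z)) (\<lambda>y. f y * ?\<rho> (x - y))"
      by (simp only: lborel_distr_minus)
    then show ?thesis
      by (subst (asm) integrable_distr_eq) auto
  qed
  have i2: "integrable lborel (\<lambda>z. f x * ?\<rho> z)"
    using ri by (intro integrable_mult_right) simp
  have "(\<integral>z. f x * ?\<rho> z \<partial>lborel) = f x"
    using \<rho>(3) by simp
  then have "conv f ?\<rho> x - f x = (\<integral>z. (f (x - z) - f x) * ?\<rho> z \<partial>lborel)"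
    using i1 i2 by (simp add: conv_lborel_eq[OF f(1) \<rho>(1)] left_diff_distrib)
  moreover have "ennreal (norm (\<integral>z. (f (x - z) - f x) * ?\<rho> z \<partial>lborel)) \<le>
      (\<integral>\<^sup>+z. ennreal (norm ((f (x - z) - f x) * ?\<rho> z)) \<partial>lborel)"
    using i1 i2 by (intro integral_norm_bound_ennreal) (simp add: left_diff_distrib)
  ultimately have "ennreal (norm (conv f ?\<rho> x - f x)) \<le>
      (\<integral>\<^sup>+z. ennreal (norm (f (x - z) - f x) * r z) \<partial>lborel)"
    using \<rho>(2) by (simp add: norm_mult)
  also have "\<dots> = (\<integral>\<^sup>+z. ennreal (norm (f (x - z) - f x) * sqrt (r z)) * ennreal (sqrt (r z)) \<partial>lborel)"
    using \<rho>(2) by (intro nn_integral_cong) (simp add: mult.assoc flip: ennreal_mult)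
  finally have "(ennreal (norm (conv f ?\<rho> x - f x)))\<^sup>2 \<le>
      (\<integral>\<^sup>+z. ennreal (norm (f (x - z) - f x) * sqrt (r z)) * ennreal (sqrt (r z)) \<partial>lborel)\<^sup>2"
    by (rule power_mono) simp
  also have "\<dots> \<le> (\<integral>\<^sup>+z. (ennreal (norm (f (x - z) - f x) * sqrt (r z)))\<^sup>2 \<partial>lborel) *
      (\<integral>\<^sup>+z. (ennreal (sqrt (r z)))\<^sup>2 \<partial>lborel)"
    by (rule Cauchy_Schwarz_nn_integral) measurable
  also have "(\<integral>\<^sup>+z. (ennreal (sqrt (r z)))\<^sup>2 \<partial>lborel) = (\<integral>\<^sup>+z. ennreal (r z) \<partial>lborel)"
    using \<rho>(2) by (intro nn_integral_cong) (simp add: ennreal_power)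
  also have "\<dots> = 1"
    using nn_integral_eq_integral[OF ri] \<rho>(2,3) by simp
  also have "(\<integral>\<^sup>+z. (ennreal (norm (f (x - z) - f x) * sqrt (r z)))\<^sup>2 \<partial>lborel) =
      (\<integral>\<^sup>+z. ennreal ((norm (f (x - z) - f x))\<^sup>2) * ennreal (r z) \<partial>lborel)"
    using \<rho>(2) by (intro nn_integral_cong) (simp add: ennreal_power power_mult_distrib ennreal_mult)
  finally show ?thesis by (simp add: ennreal_power)
qed

text \<open>After Tonelli the Jensen bound is an average, with weight r of total mass 1, of the mean
  square errors of translation by z. Only shifts in the support of r enter.\<close>

lemma conv_diff_nn_integral_le:
  fixes f :: "(real^'n::finite) \<Rightarrow> complex"
  assumes f: "f \<in> borel_measurable borel" "locally_integrable f"
    and \<rho>: "(\<lambda>x. complex_of_real (r x)) \<in> test_functions" "\<And>x. r x \<ge> 0" "(\<integral>x. r x \<partial>lborel) = 1"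
    and le: "\<And>z. r z \<noteq> 0 \<Longrightarrow> (\<integral>\<^sup>+x. ennreal ((norm (f (x - z) - f x))\<^sup>2) \<partial>lborel) \<le> e"
  shows "(\<integral>\<^sup>+x. ennreal ((norm (conv f (\<lambda>x. of_real (r x)) x - f x))\<^sup>2) \<partial>lborel) \<le> e"
proof -
  let ?\<rho> = "\<lambda>x. complex_of_real (r x)"
  have "(\<lambda>x. Re (?\<rho> x)) \<in> borel_measurable borel"
    using test_functions_borel[OF \<rho>(1)] by (rule measurable_compose[OF _ borel_measurable_Re]) 
  then have [measurable]: "r \<in> borel_measurable borel" by simp
  note [measurable] = f(1)
  have ri: "integrable lborel r"
    using \<rho>(3) not_integrable_integral_eq by fastforce
  have "(\<integral>\<^sup>+x. ennreal ((norm (conv f ?\<rho> x - f x))\<^sup>2) \<partial>lborel) \<le>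
      (\<integral>\<^sup>+x. \<integral>\<^sup>+z. ennreal ((norm (f (x - z) - f x))\<^sup>2) * ennreal (r z) \<partial>lborel \<partial>lborel)"
    by (intro nn_integral_mono conv_diff_square_le f \<rho>)
  also have "\<dots> = (\<integral>\<^sup>+z. \<integral>\<^sup>+x. ennreal ((norm (f (x - z) - f x))\<^sup>2) * ennreal (r z) \<partial>lborel \<partial>lborel)"
    by (rule lborel_pair.Fubini'[symmetric]) measurable
  also have "\<dots> \<le> (\<integral>\<^sup>+z. e * ennreal (r z) \<partial>lborel)"
  proof (intro nn_integral_mono)
    fix z
    have "(\<integral>\<^sup>+x. ennreal ((norm (f (x - z) - f x))\<^sup>2) * ennreal (r z) \<partial>lborel) =
        (\<integral>\<^sup>+x. ennreal ((norm (f (x - z) - f x))\<^sup>2) \<partial>lborel) * ennreal (r z)"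
      by (rule nn_integral_multc) measurable
    also have "\<dots> \<le> e * ennreal (r z)"
      using le[of z] by (cases "r z = 0") (auto intro: mult_right_mono)
    finally show "(\<integral>\<^sup>+x. ennreal ((norm (f (x - z) - f x))\<^sup>2) * ennreal (r z) \<partial>lborel) \<le> e * ennreal (r z)" .
  qed
  also have "\<dots> = e * (\<integral>\<^sup>+z. ennreal (r z) \<partial>lborel)"
    by (rule nn_integral_cmult) measurable
  also have "(\<integral>\<^sup>+z. ennreal (r z) \<partial>lborel) = 1"
    using nn_integral_eq_integral[OF ri] \<rho>(2,3) by simp
  finally show ?thesis by simp
qed

lemma box_bump_of_real:
  obtains r where "box_bump k a b = (\<lambda>x. complex_of_real (r x))" "\<And>x. r x \<ge> 0"
proof
  let ?r = "\<lambda>x. \<Prod>j\<in>UNIV. flat 0 (k * x $ j + (- (k * a $ j))) * flat 0 ((- k) * x $ j + k * b $ j)"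
  show "box_bump k a b = (\<lambda>x. complex_of_real (?r x))"
    by (simp add: box_bump_def fun_eq_iff)
  show "?r x \<ge> 0" for x by (intro prod_nonneg) (simp add: flat_bounds)
qed

lemma mollifier_exists:
  assumes "d > 0"
  obtains r :: "real^'n::finite \<Rightarrow> real"
  where "(\<lambda>x. complex_of_real (r x)) \<in> test_functions" "\<And>x. r x \<ge> 0" "(\<integral>x. r x \<partial>lborel) = 1"
    "\<And>x. r x \<noteq> 0 \<Longrightarrow> norm x < d"
proof -
  \<comment> \<open>A point of the box has all coordinates below s in modulus, so its sum norm, and
    hence its Euclidean norm, is below d.\<close>
  define s where "s = d / real CARD('n)"
  have s: "s > 0" using assms by (simp add: s_def)
  define a b :: "real^'n" where "a = (\<chi> i. - s)" and "b = (\<chi> i. s)"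
  obtain r where r: "box_bump 1 a b = (\<lambda>x. complex_of_real (r x))" "\<And>x. r x \<ge> 0"
    using box_bump_of_real by blast
  have supp: "r x \<noteq> 0 \<longleftrightarrow> x \<in> box a b" for x
    using box_bump_eq_0_iff[of 1 a b x] by (simp add: r(1))
  have test: "(\<lambda>x. complex_of_real (r x)) \<in> test_functions"
    using box_bump_test[of 1 a b] by (simp add: r(1))
  have "(\<lambda>x. Re (complex_of_real (r x))) \<in> borel_measurable borel"
    using test_functions_borel[OF test] by (rule measurable_compose[OF _ borel_measurable_Re]) 
  then have rm: "r \<in> borel_measurable borel" by simp
  have ri: "integrable lborel r"
  proof (rule Bochner_Integration.integrable_bound)
    show "integrable lborel (indicat_real (box a b))"
      by (intro integrable_real_indicator) (use emeasure_bounded_finite[OF bounded_box, of a b] in auto)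
    have "norm (r x) \<le> indicat_real (box a b) x" for x
      using box_bump_norm_le[of 1 a b x] supp[of x] by (auto simp: r(1) indicator_def)
    then show "AE x in lborel. norm (r x) \<le> norm (indicat_real (box a b) x)" by simp
  qed (simp add: rm)
  define c where "c = (\<integral>x. r x \<partial>lborel)"
  have "c \<noteq> 0"
  proof
    assume "c = 0"
    then have "AE x in lborel. r x = 0"
      using integral_nonneg_eq_0_iff_AE[OF ri] r(2) by (simp add: c_def)
    then have "AE x in lborel. x \<notin> box a b" by eventually_elim (use supp in blast)
    then have "box a b \<in> null_sets lborel"
      by (subst AE_iff_null_sets) auto
    then have "negligible (box a b)"
      by (simp add: negligible_iff_null_sets null_sets_completionI)
    moreover have "0 \<in> box a b" using s by (simp add: mem_box_cart a_def b_def)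
    ultimately show False using open_not_negligible[OF open_box] by blast
  qed
  moreover have "c \<ge> 0" unfolding c_def using r(2) by (intro integral_nonneg_AE) simp
  ultimately have c: "c > 0" by simp
  show ?thesis
  proof (rule that[of "\<lambda>x. r x / c"])
    have "(\<lambda>x. complex_of_real (1 / c) * complex_of_real (r x)) \<in> test_functions"
      by (rule test_functions_mult[OF C_k_const test])
    then show "(\<lambda>x. complex_of_real (r x / c)) \<in> test_functions" by simp
    show "r x / c \<ge> 0" for x using c r(2)[of x] by simp
    show "(\<integral>x. r x / c \<partial>lborel) = 1" using c by (simp add: c_def)
    show "norm x < d" if "r x / c \<noteq> 0" for x
    proof -
      have "\<bar>x $ i\<bar> < s" for i
        using that supp[of x] by (auto simp: mem_box_cart a_def b_def abs_less_iff minus_less_iff)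
      then have "(\<Sum>i\<in>UNIV. \<bar>x $ i\<bar>) < (\<Sum>i\<in>(UNIV::'n set). s)"
        by (intro sum_strict_mono) auto
      then show ?thesis using norm_le_l1_cart[of x] by (simp add: s_def)
    qed
  qed
qed

text \<open>Translation and Tonelli are applied over \<open>lborel\<close> to Borel functions; such
  a representative carries an arbitrary Lebesgue measurable function there.\<close>

lemma lebesgue_ex_borel_AE_eq:
  fixes f :: "'a::euclidean_space \<Rightarrow> complex"
  assumes "f \<in> borel_measurable lebesgue"
  obtains g where "g \<in> borel_measurable borel" "AE x in lebesgue. f x = g x"
proof -
  have "(\<lambda>x. Re (f x)) \<in> borel_measurable lebesgue" "(\<lambda>x. Im (f x)) \<in> borel_measurable lebesgue"
    using assms by (auto intro: measurable_compose[OF _ borel_measurable_Re] measurable_compose[OF _ borel_measurable_Im])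
  then obtain p q where p: "p \<in> borel_measurable lborel" "AE x in lborel. Re (f x) = p x"
    and q: "q \<in> borel_measurable lborel" "AE x in lborel. Im (f x) = q x"
    using completion_ex_borel_measurable_real by metis
  have "AE x in lborel. f x = Complex (p x) (q x)"
    using p(2) q(2) by eventually_elim (simp add: complex_eq_iff)
  then have "AE x in lebesgue. f x = Complex (p x) (q x)" by (rule AE_completion)
  moreover have "(\<lambda>x. Complex (p x) (q x)) \<in> borel_measurable borel"
    using p(1) q(1) by (simp add: borel_measurable_complex_iff)
  ultimately show ?thesis using that by blast
qed

lemma L2_nn_integral_le:
  assumes f: "f \<in> borel_measurable lebesgue" and e: "e \<ge> 0"
    and le: "(\<integral>\<^sup>+x. ennreal ((norm (f x))\<^sup>2) \<partial>lebesgue) \<le> ennreal e"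
  shows "f \<in> L2" "sqnorm f \<le> e"
proof -
  have "(\<lambda>x. (norm (f x))\<^sup>2) \<in> borel_measurable lebesgue" using f by simp
  moreover have "(\<integral>\<^sup>+x. ennreal ((norm (f x))\<^sup>2) \<partial>lebesgue) < \<infinity>"
    using order.strict_trans1[OF le ennreal_less_top] by simp
  ultimately have "integrable lebesgue (\<lambda>x. (norm (f x))\<^sup>2)"
    by (intro integrableI_nonneg) auto
  with f show L: "f \<in> L2" by (simp add: L2_iff)
  show "sqnorm f \<le> e" using le e by (simp add: sqnorm_nn[OF L])
qed

text \<open>The radius works for every admissible kernel supported in it. This order of quantifiers
  lets a single mollifier approximate a function and all of its weak derivatives at once.\<close>

lemma conv_mollify:
  fixes v :: "(real^'n::finite) \<Rightarrow> complex"
  assumes v: "v \<in> L2" and "e > 0"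
  obtains d where "d > 0"
    "\<And>r. (\<lambda>x. complex_of_real (r x)) \<in> test_functions \<Longrightarrow> (\<And>x. r x \<ge> 0) \<Longrightarrow> (\<integral>x. r x \<partial>lborel) = 1 \<Longrightarrow>
      (\<And>x. r x \<noteq> 0 \<Longrightarrow> norm x < d) \<Longrightarrow>
      conv v (\<lambda>x. of_real (r x)) \<in> L2 \<and> sqnorm (\<lambda>x. conv v (\<lambda>x. of_real (r x)) x - v x) \<le> e"
proof -
  obtain f where f: "f \<in> borel_measurable borel" and ae: "AE x in lebesgue. v x = f x"
    using lebesgue_ex_borel_AE_eq[OF L2_measurable[OF v]] by blast
  have fL: "f \<in> L2" by (rule L2_cong_AE(1)[OF v ae])
  have "integrable lborel (\<lambda>x. (norm (f x))\<^sup>2)"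
    using L2_integrable[OF fL] f by (subst (asm) integrable_completion) auto
  from L2_translation_continuous[OF f this \<open>e > 0\<close>] obtain d where d: "d > 0"
    "\<And>z. norm z < d \<Longrightarrow> (\<integral>\<^sup>+x. ennreal ((norm (f (x - z) - f x))\<^sup>2) \<partial>lborel) \<le> ennreal e" by blast
  show ?thesis
  proof (rule that[OF d(1)])
    fix r :: "real^'n \<Rightarrow> real"
    let ?\<rho> = "\<lambda>x. complex_of_real (r x)"
    assume r: "?\<rho> \<in> test_functions" "\<And>x. r x \<ge> 0" "(\<integral>x. r x \<partial>lborel) = 1" "\<And>x. r x \<noteq> 0 \<Longrightarrow> norm x < d"
    have cm: "conv v ?\<rho> \<in> borel_measurable lebesgue"
      by (intro borel_imp_lebesgue_measurable borel_measurable_continuous_onI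
          C_k_imp_continuous[OF C_k_conv] L2_locally_integrable v r(1))
    have ceq: "conv v ?\<rho> = conv f ?\<rho>"
      unfolding conv_def [abs_def] by (intro ext integral_mult_cong_AE ae)
    have m: "(\<lambda>x. conv v ?\<rho> x - v x) \<in> borel_measurable lebesgue"
      using cm L2_measurable[OF v] by simp
    have "(\<integral>\<^sup>+x. ennreal ((norm (conv v ?\<rho> x - v x))\<^sup>2) \<partial>lebesgue) =
        (\<integral>\<^sup>+x. ennreal ((norm (conv f ?\<rho> x - f x))\<^sup>2) \<partial>lebesgue)"
      unfolding ceq by (rule nn_integral_cong_AE) (use ae in eventually_elim, simp)
    also have "\<dots> = (\<integral>\<^sup>+x. ennreal ((norm (conv f ?\<rho> x - f x))\<^sup>2) \<partial>lborel)"
      by (rule nn_integral_completion)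
    also have "\<dots> \<le> ennreal e"
      by (rule conv_diff_nn_integral_le[OF f L2_locally_integrable[OF fL] r(1-3) d(2)[OF r(4)]])
    finally have *: "(\<lambda>x. conv v ?\<rho> x - v x) \<in> L2" "sqnorm (\<lambda>x. conv v ?\<rho> x - v x) \<le> e"
      using L2_nn_integral_le[OF m less_imp_le[OF \<open>e > 0\<close>]] by blast+
    have "(\<lambda>x. (conv v ?\<rho> x - v x) + v x) \<in> L2"
      by (rule L2_add(1)[OF *(1) v])
    with *(2) show "conv v ?\<rho> \<in> L2 \<and> sqnorm (\<lambda>x. conv v ?\<rho> x - v x) \<le> e" by simp
  qed
qed

lemma sqnorm_mult_tendsto_0:
  assumes u: "u \<in> L2" and m: "\<And>k. \<eta> k \<in> borel_measurable lebesgue"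
    and le: "\<And>k x. norm (\<eta> k x) \<le> C" and lim: "\<And>x. (\<lambda>k. \<eta> k x) \<longlonglongrightarrow> 0"
  shows "(\<lambda>k::nat. sqnorm (\<lambda>x. \<eta> k x * u x)) \<longlonglongrightarrow> 0"
proof -
  have "(\<lambda>k. \<integral>x. (norm (\<eta> k x * u x))\<^sup>2 \<partial>lebesgue) \<longlonglongrightarrow> integral\<^sup>L lebesgue (\<lambda>x::real^'a. 0)"
  proof (rule integral_dominated_convergence[where w="\<lambda>x. C\<^sup>2 * (norm (u x))\<^sup>2"])
    show "integrable lebesgue (\<lambda>x. C\<^sup>2 * (norm (u x))\<^sup>2)"
      by (intro integrable_mult_right L2_integrable u)
    show "(\<lambda>x. (norm (\<eta> k x * u x))\<^sup>2) \<in> borel_measurable lebesgue" for k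
      using m[of k] L2_measurable[OF u] by simp
    have "(\<lambda>k. (norm (\<eta> k x * u x))\<^sup>2) \<longlonglongrightarrow> (norm (0 * u x))\<^sup>2" for x
      by (intro tendsto_power tendsto_norm tendsto_mult tendsto_const lim)
    then show "AE x in lebesgue. (\<lambda>k. (norm (\<eta> k x * u x))\<^sup>2) \<longlonglongrightarrow> 0" by simp
    have "(norm (\<eta> k x))\<^sup>2 * (norm (u x))\<^sup>2 \<le> C\<^sup>2 * (norm (u x))\<^sup>2" for k x
      by (intro mult_right_mono power_mono le) auto
    then show "AE x in lebesgue. norm ((norm (\<eta> k x * u x))\<^sup>2) \<le> C\<^sup>2 * (norm (u x))\<^sup>2" for k
      by (simp add: norm_mult power_mult_distrib)
  qed simp
  then show ?thesis by (simp add: sqnorm_def)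
qed

text \<open>Dilations by 1 / (k + 1) of one bump, normalised to the value 1 at the origin.
  Continuity there gives the limit 1, and the chain rule gains the factor 1 / (k + 1) in the
  derivatives.\<close>

lemma cutoff_exists:
  obtains \<zeta> :: "nat \<Rightarrow> (real^'n::finite) \<Rightarrow> complex" and C
  where "\<And>k. \<zeta> k \<in> test_functions" "\<And>k x. norm (\<zeta> k x) \<le> C" "\<And>k i x. norm (partial i (\<zeta> k) x) \<le> C"
    "\<And>x. (\<lambda>k. \<zeta> k x) \<longlonglongrightarrow> 1" "\<And>i x. (\<lambda>k. partial i (\<zeta> k) x) \<longlonglongrightarrow> 0"
proof -
  define a b :: "real^'n" where "a = (\<chi> i. - 1)" and "b = (\<chi> i. 1)"
  define c where "c = box_bump 1 a b 0"
  have c: "c \<noteq> 0" using box_bump_eq_0_iff[of 1 a b 0] by (simp add: c_def a_def b_def mem_box_cart)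
  define \<psi> where "\<psi> x = (1 / c) * box_bump 1 a b x" for x
  have \<psi>: "\<psi> \<in> test_functions"
    unfolding \<psi>_def [abs_def] by (rule test_functions_mult[OF C_k_const box_bump_test]) simp
  have \<psi>0: "\<psi> 0 = 1" using c by (simp add: \<psi>_def c_def)
  define s where "s k = inverse (real (Suc k))" for k
  have s: "s k > 0" "s k \<le> 1" "s \<longlonglongrightarrow> 0" for k
    using LIMSEQ_inverse_real_of_nat by (auto simp: s_def [abs_def] inverse_le_1_iff)
  define \<zeta> where "\<zeta> k x = \<psi> (s k *\<^sub>R x + 0)" for k x
  obtain B where B: "B > 0" "\<And>x. norm (\<psi> x) \<le> B" using test_functions_bounded[OF \<psi>] by blast
  have "\<exists>B>0. \<forall>x. norm (partial i \<psi> x) \<le> B" for i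
    using test_functions_bounded[OF test_functions_partial[OF \<psi>]] by metis
  then obtain B' where B': "\<And>i. B' i > 0" "\<And>i x. norm (partial i \<psi> x) \<le> B' i" by metis
  define C where "C = B + (\<Sum>i\<in>UNIV. B' i)"
  have sum0: "(\<Sum>i\<in>UNIV. B' i) \<ge> 0" by (intro sum_nonneg less_imp_le B'(1))
  have B'C: "B' i \<le> C" for i
    using member_le_sum[of i UNIV B'] B'(1) B(1) by (auto simp: C_def less_imp_le intro: add_increasing)
  have p: "partial i (\<zeta> k) x = of_real (s k) * partial i \<psi> (s k *\<^sub>R x)" for i k x
    unfolding \<zeta>_def [abs_def] using partial_affine[OF test_functions_C_k[OF \<psi>], of i "s k" 0 x] by simp
  have pb: "norm (partial i (\<zeta> k) x) \<le> s k * C" for i k x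
    unfolding p norm_mult using s(1)[of k] order_trans[OF B'(2) B'C, of i "s k *\<^sub>R x"]
    by (auto intro!: mult_left_mono)
  have C0: "C \<ge> 0" using B(1) sum0 by (simp add: C_def)
  show ?thesis
  proof (rule that[of \<zeta> C])
    show "\<zeta> k \<in> test_functions" for k
      unfolding \<zeta>_def [abs_def] using s(1)[of k] by (intro test_functions_affine \<psi>) simp
    show "norm (\<zeta> k x) \<le> C" for k x
      using order_trans[OF B(2), of C] sum0 by (simp add: \<zeta>_def C_def)
    show "norm (partial i (\<zeta> k) x) \<le> C" for i k x
      using order_trans[OF pb mult_right_mono[OF s(2) C0]] by simp
    have "(\<lambda>k. s k *\<^sub>R x + 0) \<longlonglongrightarrow> 0 *\<^sub>R x + 0" for x :: "real^'n"
      by (intro tendsto_add tendsto_scaleR s(3) tendsto_const)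
    moreover have "isCont \<psi> 0"
      using test_functions_continuous[OF \<psi>] by (simp add: continuous_on_eq_continuous_at)
    ultimately show "(\<lambda>k. \<zeta> k x) \<longlonglongrightarrow> 1" for x
      unfolding \<zeta>_def \<psi>0[symmetric] by (intro isCont_tendsto_compose[of 0 \<psi>]) auto
    have "(\<lambda>k. s k * C) \<longlonglongrightarrow> 0 * C" by (intro tendsto_mult s(3) tendsto_const)
    then have "(\<lambda>k. s k * C) \<longlonglongrightarrow> 0" by simp
    from Lim_null_comparison[OF always_eventually[OF allI[OF pb]] this]
    show "(\<lambda>k. partial i (\<zeta> k) x) \<longlonglongrightarrow> 0" for i x .
  qed
qed

section \<open>Density of test functions and its consequences\<close>

text \<open>Mollification makes v smooth and commutes with weak derivatives; the cutoff then makes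
  the support bounded. The extra term of the product rule, a derivative of the cutoff times the
  mollified function, tends to zero by dominated convergence.\<close>

lemma test_functions_L2_dense:
  fixes v :: "(real^'n::finite) \<Rightarrow> complex"
  assumes v: "v \<in> L2" and w: "\<And>i. w i \<in> L2" "\<And>i. has_weak_partial i v (w i)" and "e > 0"
  obtains \<phi> where "\<phi> \<in> test_functions" "sqnorm (\<lambda>x. \<phi> x - v x) \<le> e"
    "\<And>i. sqnorm (\<lambda>x. partial i \<phi> x - w i x) \<le> e"
proof -
  \<comment> \<open>Every use of \<open>L2_add\<close> doubles the errors. For the function, e / 4
    from the cutoff and e / 4 from mollification add up to e; for a derivative, the two cutoff terms
    of e / 16 first combine to e / 4.\<close>
  have e4: "e / 4 > 0" and e16: "e / 16 > 0" using \<open>e > 0\<close> by simp_all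
  define good where "good g d \<longleftrightarrow> d > 0 \<and> (\<forall>r. (\<lambda>x. complex_of_real (r x)) \<in> test_functions \<longrightarrow>
      (\<forall>x. r x \<ge> 0) \<longrightarrow> (\<integral>x. r x \<partial>lborel) = 1 \<longrightarrow> (\<forall>x. r x \<noteq> 0 \<longrightarrow> norm x < d) \<longrightarrow>
      conv g (\<lambda>x. of_real (r x)) \<in> L2 \<and> sqnorm (\<lambda>x. conv g (\<lambda>x. of_real (r x)) x - g x) \<le> e / 4)"
    for g :: "real^'n \<Rightarrow> complex" and d :: real
  have good: "\<exists>d. good g d" if g: "g \<in> L2" for g
    by (rule conv_mollify[OF g e4]) (auto simp: good_def)
  obtain d0 where d0: "good v d0" using good[OF v] by blast
  have "\<forall>i. \<exists>d. good (w i) d" using good[OF w(1)] by blast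
  then obtain D where D: "\<And>i. good (w i) (D i)" by metis
  define d where "d = Min (insert d0 (range D))"
  have "\<forall>x\<in>insert d0 (range D). x > 0" using d0 D by (auto simp: good_def)
  then have "d > 0" by (simp add: d_def Min_gr_iff)
  moreover have "d \<le> d0" "d \<le> D i" for i unfolding d_def by (rule Min_le; simp)+
  ultimately have d: "d > 0" "d \<le> d0" "d \<le> D i" for i by blast+
  obtain r :: "real^'n \<Rightarrow> real" where r: "(\<lambda>x. complex_of_real (r x)) \<in> test_functions" "\<And>x. r x \<ge> 0"
    "(\<integral>x. r x \<partial>lborel) = 1" "\<And>x. r x \<noteq> 0 \<Longrightarrow> norm x < d"
    using mollifier_exists[OF d(1)] by blast
  let ?\<rho> = "\<lambda>x. complex_of_real (r x)"
  have mollified: "conv g ?\<rho> \<in> L2 \<and> sqnorm (\<lambda>x. conv g ?\<rho> x - g x) \<le> e / 4" if "good g d'" "d \<le> d'" for g d'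
    using that r unfolding good_def by (meson less_le_trans)
  define u where "u = conv v ?\<rho>"
  have u: "u \<in> L2" "sqnorm (\<lambda>x. u x - v x) \<le> e / 4" using mollified[OF d0 d(2)] by (auto simp: u_def)
  note vl = L2_locally_integrable[OF v]
  have uC: "C_k k u" for k unfolding u_def by (rule C_k_conv[OF vl r(1)])
  have pu: "partial i u = conv (w i) ?\<rho>" for i
    unfolding u_def partial_conv[OF vl r(1)] by (rule conv_partial_eq[OF w(2) r(1)])
  have du: "partial i u \<in> L2" "sqnorm (\<lambda>x. partial i u x - w i x) \<le> e / 4" for i
    using mollified[OF D d(3)] by (auto simp: pu)
  obtain \<zeta> :: "nat \<Rightarrow> real^'n \<Rightarrow> complex" and C where \<zeta>: "\<And>k. \<zeta> k \<in> test_functions" "\<And>k x. norm (\<zeta> k x) \<le> C"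
    "\<And>k i x. norm (partial i (\<zeta> k) x) \<le> C" "\<And>x. (\<lambda>k. \<zeta> k x) \<longlonglongrightarrow> 1"
    "\<And>i x. (\<lambda>k. partial i (\<zeta> k) x) \<longlonglongrightarrow> 0"
    using cutoff_exists by blast
  have \<zeta>m: "\<zeta> k \<in> borel_measurable lebesgue" "partial i (\<zeta> k) \<in> borel_measurable lebesgue" for i k
    by (intro borel_imp_lebesgue_measurable test_functions_borel test_functions_partial \<zeta>)+
  have \<zeta>1: "(\<lambda>x. \<zeta> k x - 1) \<in> borel_measurable lebesgue" for k using \<zeta>m by simp
  have \<zeta>1b: "norm (\<zeta> k x - 1) \<le> C + 1" for k x
    using norm_triangle_ineq4[of "\<zeta> k x" 1] \<zeta>(2)[of k x] by simp
  have \<zeta>1l: "(\<lambda>k. \<zeta> k x - 1) \<longlonglongrightarrow> 0" for x using \<zeta>(4)[of x] by (rule LIM_zero)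
  have lim1: "(\<lambda>k. sqnorm (\<lambda>x. (\<zeta> k x - 1) * g x)) \<longlonglongrightarrow> 0" if "g \<in> L2" for g
    by (rule sqnorm_mult_tendsto_0[OF that \<zeta>1 \<zeta>1b \<zeta>1l])
  have lim2: "(\<lambda>k. sqnorm (\<lambda>x. partial i (\<zeta> k) x * u x)) \<longlonglongrightarrow> 0" for i
    by (rule sqnorm_mult_tendsto_0[OF u(1) \<zeta>m(2) \<zeta>(3) \<zeta>(5)])
  have "eventually (\<lambda>k. sqnorm (\<lambda>x. (\<zeta> k x - 1) * u x) < e / 4) sequentially"
    by (rule order_tendstoD(2)[OF lim1[OF u(1)] e4])
  moreover have "eventually (\<lambda>k. \<forall>i\<in>UNIV. sqnorm (\<lambda>x. (\<zeta> k x - 1) * partial i u x) < e / 16) sequentially"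
    by (intro eventually_ball_finite finite ballI order_tendstoD(2)[OF lim1[OF du(1)] e16])
  moreover have "eventually (\<lambda>k. \<forall>i\<in>UNIV. sqnorm (\<lambda>x. partial i (\<zeta> k) x * u x) < e / 16) sequentially"
    by (intro eventually_ball_finite finite ballI order_tendstoD(2)[OF lim2 e16])
  ultimately have "eventually (\<lambda>k. sqnorm (\<lambda>x. (\<zeta> k x - 1) * u x) < e / 4 \<and>
      (\<forall>i\<in>UNIV. sqnorm (\<lambda>x. (\<zeta> k x - 1) * partial i u x) < e / 16) \<and>
      (\<forall>i\<in>UNIV. sqnorm (\<lambda>x. partial i (\<zeta> k) x * u x) < e / 16)) sequentially"
    by eventually_elim simp
  then obtain k where k: "sqnorm (\<lambda>x. (\<zeta> k x - 1) * u x) < e / 4"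
    "\<And>i. sqnorm (\<lambda>x. (\<zeta> k x - 1) * partial i u x) < e / 16"
    "\<And>i. sqnorm (\<lambda>x. partial i (\<zeta> k) x * u x) < e / 16"
    by (auto simp: eventually_sequentially)
  define \<phi> where "\<phi> x = u x * \<zeta> k x" for x
  have C1: "C_k (Suc 0) u" "C_k (Suc 0) (\<zeta> k)" using uC test_functions_C_k[OF \<zeta>(1)] by blast+
  have b: "AE x in lebesgue. norm (\<zeta> k x - 1) \<le> C + 1" "AE x in lebesgue. norm (partial i (\<zeta> k) x) \<le> C" for i
    using \<zeta>1b \<zeta>(3) by simp_all
  note L2s = L2_bounded_mult(1)[OF u(1) \<zeta>1 b(1)] L2_bounded_mult(1)[OF du(1) \<zeta>1 b(1)]
    L2_bounded_mult(1)[OF u(1) \<zeta>m(2) b(2)]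
  show ?thesis
  proof (rule that)
    show "\<phi> \<in> test_functions"
      unfolding \<phi>_def [abs_def] by (rule test_functions_mult[OF uC \<zeta>(1)])
    have "sqnorm (\<lambda>x. (\<zeta> k x - 1) * u x + (u x - v x)) \<le>
        2 * sqnorm (\<lambda>x. (\<zeta> k x - 1) * u x) + 2 * sqnorm (\<lambda>x. u x - v x)"
      by (rule L2_add(2)[OF L2s(1) L2_diff[OF u(1) v]])
    also have "\<dots> \<le> e" using k(1) u(2) by simp
    also have "(\<lambda>x. (\<zeta> k x - 1) * u x + (u x - v x)) = (\<lambda>x. \<phi> x - v x)"
      by (simp add: \<phi>_def fun_eq_iff algebra_simps)
    finally show "sqnorm (\<lambda>x. \<phi> x - v x) \<le> e" .
    fix i
    have "sqnorm (\<lambda>x. (\<zeta> k x - 1) * partial i u x + partial i (\<zeta> k) x * u x) \<le>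
        2 * sqnorm (\<lambda>x. (\<zeta> k x - 1) * partial i u x) + 2 * sqnorm (\<lambda>x. partial i (\<zeta> k) x * u x)"
      by (rule L2_add(2)[OF L2s(2,3)])
    also have "\<dots> \<le> e / 4" using k(2,3)[of i] by simp
    finally have 1: "sqnorm (\<lambda>x. (\<zeta> k x - 1) * partial i u x + partial i (\<zeta> k) x * u x) \<le> e / 4" .
    have "sqnorm (\<lambda>x. ((\<zeta> k x - 1) * partial i u x + partial i (\<zeta> k) x * u x) + (partial i u x - w i x)) \<le>
        2 * sqnorm (\<lambda>x. (\<zeta> k x - 1) * partial i u x + partial i (\<zeta> k) x * u x) + 2 * sqnorm (\<lambda>x. partial i u x - w i x)"
      by (rule L2_add(2)[OF L2_add(1)[OF L2s(2,3)] L2_diff[OF du(1) w(1)]])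
    also have "\<dots> \<le> e" using 1 du(2)[of i] by simp
    also have "(\<lambda>x. ((\<zeta> k x - 1) * partial i u x + partial i (\<zeta> k) x * u x) + (partial i u x - w i x)) =
        (\<lambda>x. partial i \<phi> x - w i x)"
      unfolding \<phi>_def [abs_def] partial_mult[OF C1] by (simp add: fun_eq_iff algebra_simps)
    finally show "sqnorm (\<lambda>x. partial i \<phi> x - w i x) \<le> e" .
  qed
qed

lemma test_functions_L2_approx:
  fixes v :: "(real^'n::finite) \<Rightarrow> complex"
  assumes v: "v \<in> L2" and w: "\<And>i. w i \<in> L2" "\<And>i. has_weak_partial i v (w i)"
  obtains \<phi> where "\<And>k::nat. \<phi> k \<in> test_functions" "L2_tendsto \<phi> v"
    "\<And>i. L2_tendsto (\<lambda>k. partial i (\<phi> k)) (w i)"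
proof -
  define s where "s k = inverse (real (Suc k))" for k
  have s: "s k > 0" "s \<longlonglongrightarrow> 0" for k
    using LIMSEQ_inverse_real_of_nat by (auto simp: s_def [abs_def])
  have "\<exists>\<phi>. \<phi> \<in> test_functions \<and> sqnorm (\<lambda>x. \<phi> x - v x) \<le> s k \<and> (\<forall>i. sqnorm (\<lambda>x. partial i \<phi> x - w i x) \<le> s k)" for k
    by (rule test_functions_L2_dense[OF v w s(1)[of k]]) blast+
  then obtain \<phi> where \<phi>: "\<And>k. \<phi> k \<in> test_functions" "\<And>k. sqnorm (\<lambda>x. \<phi> k x - v x) \<le> s k"
    "\<And>i k. sqnorm (\<lambda>x. partial i (\<phi> k) x - w i x) \<le> s k"
    by metis
  have lim: "f \<longlonglongrightarrow> 0" if "\<And>k. 0 \<le> f k" "\<And>k. f k \<le> s k" for f :: "nat \<Rightarrow> real"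
    by (rule Lim_null_comparison[OF _ s(2)]) (simp add: that)
  have "L2_tendsto \<phi> v"
    unfolding L2_tendsto_def by (intro conjI allI test_functions_L2 \<phi>(1) v lim sqnorm_nonneg \<phi>(2))
  moreover have "L2_tendsto (\<lambda>k. partial i (\<phi> k)) (w i)" for i
    unfolding L2_tendsto_def
    by (intro conjI allI test_functions_L2 test_functions_partial \<phi>(1) w(1) lim sqnorm_nonneg \<phi>(3))
  ultimately show ?thesis using that \<phi>(1) by blast
qed

text \<open>The definition of a weak derivative tests only against smooth functions of bounded
  support. Density lets any square integrable v with square integrable weak derivatives take their
  place, since both sides are continuous in the mean square.\<close>

lemma weak_integration_by_parts:
  fixes f v :: "(real^'n::finite) \<Rightarrow> complex"
  assumes f: "f \<in> L2" "g \<in> L2" "has_weak_partial i f g"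
    and v: "v \<in> L2" "\<And>i. w i \<in> L2" "\<And>i. has_weak_partial i v (w i)"
  shows "(\<integral>x. g x * cnj (v x) \<partial>lebesgue) = - (\<integral>x. f x * cnj (w i x) \<partial>lebesgue)"
proof -
  obtain \<phi> where \<phi>: "\<And>k::nat. \<phi> k \<in> test_functions" "L2_tendsto \<phi> v"
    "\<And>i. L2_tendsto (\<lambda>k. partial i (\<phi> k)) (w i)"
    using test_functions_L2_approx[OF v] by blast
  have eq: "- (\<integral>x. f x * cnj (partial i (\<phi> k) x) \<partial>lebesgue) = (\<integral>x. g x * cnj (\<phi> k x) \<partial>lebesgue)" for k
  proof -
    have "(\<integral>x. f x * partial i (\<lambda>x. cnj (\<phi> k x)) x \<partial>lebesgue) = - (\<integral>x. g x * cnj (\<phi> k x) \<partial>lebesgue)"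
      using f(3) test_functions_cnj[OF \<phi>(1)] by (simp add: has_weak_partial_def)
    then show ?thesis by (simp add: partial_cnj[OF test_functions_C_k[OF \<phi>(1)]])
  qed
  have "(\<lambda>k. \<integral>x. g x * cnj (\<phi> k x) \<partial>lebesgue) \<longlonglongrightarrow> (\<integral>x. g x * cnj (v x) \<partial>lebesgue)"
    by (intro L2_tendsto_integral_mult L2_tendsto_const f L2_tendsto_cnj \<phi>)
  moreover have "(\<lambda>k. - (\<integral>x. f x * cnj (partial i (\<phi> k) x) \<partial>lebesgue)) \<longlonglongrightarrow> - (\<integral>x. f x * cnj (w i x) \<partial>lebesgue)"
    by (intro tendsto_minus L2_tendsto_integral_mult L2_tendsto_const f L2_tendsto_cnj \<phi>)
  ultimately show ?thesis unfolding eq by (rule LIMSEQ_unique)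
qed

text \<open>Cauchy-Schwarz in each directional factor of \<open>gagliardo_test\<close>. The bound on
  the weight makes the left integral finite, so that the extended inequality can be read in the
  reals.\<close>

lemma gagliardo_nirenberg_test:
  fixes \<phi> :: "(real^'n::finite) \<Rightarrow> complex"
  assumes \<phi>: "\<phi> \<in> test_functions"
    and a: "a \<in> borel_measurable borel" "\<And>x. a x \<ge> 0" "\<And>x. a x \<le> C"
      "integrable lebesgue (\<lambda>x. a x ^ CARD('n))"
  shows "(\<integral>x. a x * (norm (\<phi> x))\<^sup>2 \<partial>lebesgue) ^ CARD('n) \<le>
    (\<integral>x. a x ^ CARD('n) \<partial>lebesgue) * (\<Prod>i\<in>UNIV. 2 * sqrt (sqnorm \<phi> * sqnorm (partial i \<phi>)))"
proof -
  note L = test_functions_L2[OF \<phi>] test_functions_L2[OF test_functions_partial[OF \<phi>]]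
  have i1: "integrable lebesgue (\<lambda>x. a x * (norm (\<phi> x))\<^sup>2)"
  proof (rule Bochner_Integration.integrable_bound)
    show "integrable lebesgue (\<lambda>x. C * (norm (\<phi> x))\<^sup>2)"
      by (intro integrable_mult_right L2_integrable L)
    show "(\<lambda>x. a x * (norm (\<phi> x))\<^sup>2) \<in> borel_measurable lebesgue"
      using borel_imp_lebesgue_measurable[OF a(1)] L2_measurable[OF L(1)] by simp
    have "a x * (norm (\<phi> x))\<^sup>2 \<le> C * (norm (\<phi> x))\<^sup>2" for x
      by (intro mult_right_mono a) simp
    moreover have "C \<ge> 0" using a(2,3) order_trans by blast
    ultimately show "AE x in lebesgue. norm (a x * (norm (\<phi> x))\<^sup>2) \<le> norm (C * (norm (\<phi> x))\<^sup>2)"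
      using a(2) by (auto simp: abs_mult)
  qed
  have i3: "integrable lebesgue (\<lambda>x. norm (\<phi> x) * norm (partial i \<phi> x))" for i
    using integrable_norm[OF L2_mult_integrable[OF L(1) L(2)[of i]]] by (simp add: norm_mult)
  have nn: "(\<integral>\<^sup>+x. ennreal (f x) \<partial>lborel) = ennreal (\<integral>x. f x \<partial>lebesgue)"
    if "integrable lebesgue f" "\<And>x. f x \<ge> 0" for f :: "real^'n \<Rightarrow> real"
    using nn_integral_eq_integral[OF that(1)] that(2) by (simp add: nn_integral_completion)
  have CS: "(\<integral>x. 2 * norm (\<phi> x) * norm (partial i \<phi> x) \<partial>lebesgue) \<le> 2 * sqrt (sqnorm \<phi> * sqnorm (partial i \<phi>))" for i
    using real_le_rsqrt[OF L2_Cauchy_Schwarz_norm[OF L(1) L(2)[of i]]] by (simp add: mult.assoc)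
  have pos: "(\<integral>x. 2 * norm (\<phi> x) * norm (partial i \<phi> x) \<partial>lebesgue) \<ge> 0" for i by simp
  have "ennreal ((\<integral>x. a x * (norm (\<phi> x))\<^sup>2 \<partial>lebesgue) ^ CARD('n)) \<le>
      ennreal ((\<integral>x. a x ^ CARD('n) \<partial>lebesgue) * (\<Prod>i\<in>UNIV. \<integral>x. 2 * norm (\<phi> x) * norm (partial i \<phi> x) \<partial>lebesgue))"
  proof -
    have "(\<integral>\<^sup>+x. ennreal (2 * norm (\<phi> x) * norm (partial i \<phi> x)) \<partial>lborel) =
        ennreal (\<integral>x. 2 * norm (\<phi> x) * norm (partial i \<phi> x) \<partial>lebesgue)" for i
      using i3[of i] by (intro nn) (simp_all add: mult.assoc)
    moreover have "(\<integral>\<^sup>+x. ennreal (a x * (norm (\<phi> x))\<^sup>2) \<partial>lborel) = ennreal (\<integral>x. a x * (norm (\<phi> x))\<^sup>2 \<partial>lebesgue)"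
      using i1 a(2) by (intro nn) simp_all
    moreover have "(\<integral>\<^sup>+x. ennreal (a x ^ CARD('n)) \<partial>lborel) = ennreal (\<integral>x. a x ^ CARD('n) \<partial>lebesgue)"
      using a by (intro nn) simp_all
    ultimately show ?thesis
      using gagliardo_test[OF \<phi> a(1,2)] a(2)
      by (simp add: ennreal_power prod_ennreal pos prod_nonneg flip: ennreal_mult)
  qed
  then have "(\<integral>x. a x * (norm (\<phi> x))\<^sup>2 \<partial>lebesgue) ^ CARD('n) \<le>
      (\<integral>x. a x ^ CARD('n) \<partial>lebesgue) * (\<Prod>i\<in>UNIV. \<integral>x. 2 * norm (\<phi> x) * norm (partial i \<phi> x) \<partial>lebesgue)"
    using a(2) pos by (subst (asm) ennreal_le_iff) (auto intro!: mult_nonneg_nonneg prod_nonneg)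
  also have "\<dots> \<le> (\<integral>x. a x ^ CARD('n) \<partial>lebesgue) * (\<Prod>i\<in>UNIV. 2 * sqrt (sqnorm \<phi> * sqnorm (partial i \<phi>)))"
    using a(2) pos CS by (intro mult_left_mono prod_mono) auto
  finally show ?thesis .
qed

text \<open>Both sides pass to the limit along the approximation by test functions: on the left
  because multiplication by a bounded weight is continuous in the mean square, on the right because
  the norms converge.\<close>

lemma gagliardo_nirenberg:
  fixes v :: "(real^'n::finite) \<Rightarrow> complex"
  assumes v: "v \<in> L2" "\<And>i. w i \<in> L2" "\<And>i. has_weak_partial i v (w i)"
    and a: "a \<in> borel_measurable borel" "\<And>x. a x \<ge> 0" "\<And>x. a x \<le> C"
      "integrable lebesgue (\<lambda>x. a x ^ CARD('n))"
  shows "(\<integral>x. a x * (norm (v x))\<^sup>2 \<partial>lebesgue) ^ CARD('n) \<le>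
    (\<integral>x. a x ^ CARD('n) \<partial>lebesgue) * (\<Prod>i\<in>UNIV. 2 * sqrt (sqnorm v * sqnorm (w i)))"
proof -
  obtain \<phi> where \<phi>: "\<And>k::nat. \<phi> k \<in> test_functions" "L2_tendsto \<phi> v"
    "\<And>i. L2_tendsto (\<lambda>k. partial i (\<phi> k)) (w i)"
    using test_functions_L2_approx[OF v] by blast
  have am: "(\<lambda>x. complex_of_real (a x)) \<in> borel_measurable lebesgue"
    using borel_imp_lebesgue_measurable[OF a(1)] by simp
  have ab: "AE x in lebesgue. norm (complex_of_real (a x)) \<le> C"
    using a(2,3) by simp
  have eq: "(\<integral>x. of_real (a x) * f x * cnj (f x) \<partial>lebesgue) = complex_of_real (\<integral>x. a x * (norm (f x))\<^sup>2 \<partial>lebesgue)"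
    for f :: "real^'n \<Rightarrow> complex"
  proof -
    have "of_real (a x) * f x * cnj (f x) = complex_of_real (a x * (norm (f x))\<^sup>2)" for x
      by (simp add: mult.assoc complex_norm_square[symmetric])
    then show ?thesis by (simp only: integral_complex_of_real)
  qed
  have "(\<lambda>k. \<integral>x. of_real (a x) * \<phi> k x * cnj (\<phi> k x) \<partial>lebesgue) \<longlonglongrightarrow>
      (\<integral>x. of_real (a x) * v x * cnj (v x) \<partial>lebesgue)"
    by (intro L2_tendsto_integral_mult L2_tendsto_bounded_mult[OF _ am ab] L2_tendsto_cnj \<phi>)
  then have "(\<lambda>k. \<integral>x. a x * (norm (\<phi> k x))\<^sup>2 \<partial>lebesgue) \<longlonglongrightarrow> (\<integral>x. a x * (norm (v x))\<^sup>2 \<partial>lebesgue)"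
    unfolding eq tendsto_of_real_iff .
  then have "(\<lambda>k. (\<integral>x. a x * (norm (\<phi> k x))\<^sup>2 \<partial>lebesgue) ^ CARD('n)) \<longlonglongrightarrow>
      (\<integral>x. a x * (norm (v x))\<^sup>2 \<partial>lebesgue) ^ CARD('n)"
    by (rule tendsto_power)
  moreover have "(\<lambda>k. (\<integral>x. a x ^ CARD('n) \<partial>lebesgue) * (\<Prod>i\<in>UNIV. 2 * sqrt (sqnorm (\<phi> k) * sqnorm (partial i (\<phi> k)))))
      \<longlonglongrightarrow> (\<integral>x. a x ^ CARD('n) \<partial>lebesgue) * (\<Prod>i\<in>UNIV. 2 * sqrt (sqnorm v * sqnorm (w i)))"
    by (intro tendsto_mult tendsto_const tendsto_prod tendsto_real_sqrt L2_tendsto_sqnorm \<phi>)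
  ultimately show ?thesis
    using gagliardo_nirenberg_test[OF \<phi>(1) a] by (intro LIMSEQ_le) auto
qed

section \<open>The damped elastic wave operator\<close>

text \<open>\<open>Sobolev\<close> asserts that some good derivative exists, whereas
  \<open>weak_partial\<close> is a fixed choice; agreement almost everywhere carries the regularity
  over to it.\<close>

lemma Sobolev_1D:
  assumes "g \<in> Sobolev (Suc 0)"
  shows "g \<in> L2" "weak_partial i g \<in> L2" "has_weak_partial i g (weak_partial i g)"
proof -
  show "g \<in> L2" using assms by simp
  from assms obtain h where h: "h \<in> L2" "has_weak_partial i g h" by auto
  show "has_weak_partial i g (weak_partial i g)" by (rule has_weak_partial_weak_partial[OF h(2)])
  have "AE x in lebesgue. h x = weak_partial i g x"
    using weak_partial_AE_eq[OF h(2)] by eventually_elim simp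
  then show "weak_partial i g \<in> L2" by (rule L2_cong_AE(1)[OF h(1)])
qed

lemma weak_partial_Sobolev:
  assumes "f \<in> Sobolev (Suc (Suc 0))"
  shows "has_weak_partial i f (weak_partial i f)" "weak_partial i f \<in> Sobolev (Suc 0)"
proof -
  have "\<exists>g\<in>Sobolev (Suc 0). has_weak_partial i f g"
    using assms unfolding Sobolev.simps(2)[of "Suc 0"] by blast
  then obtain g where g: "g \<in> Sobolev (Suc 0)" "has_weak_partial i f g" by blast
  show "has_weak_partial i f (weak_partial i f)" by (rule has_weak_partial_weak_partial[OF g(2)])
  have ae: "AE x in lebesgue. g x = weak_partial i f x"
    using weak_partial_AE_eq[OF g(2)] by eventually_elim simp
  have "has_weak_partial j (weak_partial i f) (weak_partial j g)" for j
    by (rule has_weak_partial_cong_AE[OF Sobolev_1D(3)[OF g(1)] ae]) simp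
  then show "weak_partial i f \<in> Sobolev (Suc 0)"
    using L2_cong_AE(1)[OF Sobolev_1D(1)[OF g(1)] ae] Sobolev_1D(2)[OF g(1)] by auto
qed

lemma Sobolev_2D:
  assumes "f \<in> Sobolev (Suc (Suc 0))"
  shows "f \<in> L2" "weak_partial i f \<in> L2" "has_weak_partial i f (weak_partial i f)"
    "weak_partial j (weak_partial i f) \<in> L2"
    "has_weak_partial j (weak_partial i f) (weak_partial j (weak_partial i f))"
  using assms weak_partial_Sobolev[OF assms] Sobolev_1D[OF weak_partial_Sobolev(2)[OF assms]] by auto

section \<open>Energy identity and exclusion of real eigenvalues\<close>

text \<open>Component j of the equation is multiplied by the conjugate of u_j and integrated by
  parts. The Laplacian yields squared norms at once, whereas the gradient of the divergence yields
  the pairing of div u with the j-th derivative of u_j, which becomes the square of div u only after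
  summation over j.\<close>

lemma Lame_energy_identity:
  fixes u :: "(real^'n::finite) \<Rightarrow> complex^'n"
  assumes u: "u \<in> vector_fields (Sobolev 2)"
    and b: "b \<in> borel_measurable lebesgue" "AE x in lebesgue. \<bar>b x\<bar> \<le> C"
    and eq: "AE x in lebesgue. Lame_Delta lam mu u x = of_real (b x) *s u x"
  shows "mu * (\<Sum>j\<in>UNIV. \<Sum>i\<in>UNIV. sqnorm (weak_partial i (\<lambda>y. u y $ j))) +
    (lam + mu) * sqnorm (divergence u) + (\<Sum>j\<in>UNIV. \<integral>x. b x * (norm (u x $ j))\<^sup>2 \<partial>lebesgue) = 0"
proof -
  define U where "U j = (\<lambda>y. u y $ j)" for j
  define P where "P i j = weak_partial i (U j)" for i j
  define Q where "Q i j = weak_partial i (P i j)" for i j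
  define V where "V = divergence u"
  define R where "R j = weak_partial j V" for j
  have US: "U j \<in> Sobolev (Suc (Suc 0))" for j
    using u by (simp add: vector_fields_def U_def numeral_2_eq_2)
  note S = Sobolev_2D[OF US, folded P_def]
  have V: "V = (\<lambda>x. \<Sum>i\<in>UNIV. P i i x)"
    by (simp add: V_def divergence_def [abs_def] P_def U_def)
  have VL: "V \<in> L2" unfolding V by (rule L2_sum) (auto intro: S(2))
  \<comment> \<open>An explicit weak derivative of the divergence shows that one exists; only then
    is the choice made in \<open>R\<close> a weak derivative.\<close>
  have Vw: "has_weak_partial j V (\<lambda>x. \<Sum>i\<in>UNIV. weak_partial j (P i i) x)" for j
    unfolding V by (rule has_weak_partial_sum) (auto intro: S(5))
  have Rw: "has_weak_partial j V (R j)" for j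
    unfolding R_def by (rule has_weak_partial_weak_partial[OF Vw])
  have RL: "R j \<in> L2" for j
  proof (rule L2_cong_AE(1))
    show "(\<lambda>x. \<Sum>i\<in>UNIV. weak_partial j (P i i) x) \<in> L2" by (rule L2_sum) (auto intro: S(4))
    show "AE x in lebesgue. (\<Sum>i\<in>UNIV. weak_partial j (P i i) x) = R j x"
      by (rule has_weak_partial_unique[OF Vw Rw])
  qed
  have QL: "Q i j \<in> L2" for i j unfolding Q_def by (rule S(4))
  have ibpQ: "(\<integral>x. Q i j x * cnj (U j x) \<partial>lebesgue) = - of_real (sqnorm (P i j))" for i j
    using weak_integration_by_parts[where f="P i j" and v="U j" and w="\<lambda>i. P i j",
        OF S(2) S(4) S(5) S(1) S(2) S(3), of i]
    by (simp add: Q_def integral_mult_cnj)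
  have ibpR: "(\<integral>x. R j x * cnj (U j x) \<partial>lebesgue) = - (\<integral>x. V x * cnj (P j j x) \<partial>lebesgue)" for j
    by (rule weak_integration_by_parts[OF VL RL Rw S(1) S(2) S(3)])
  have comp: "AE x in lebesgue. (of_real mu * (\<Sum>i\<in>UNIV. Q i j x) + of_real (lam + mu) * R j x) * cnj (U j x) =
      of_real (b x * (norm (U j x))\<^sup>2)" for j
    using eq
  proof eventually_elim
    case (elim x)
    have "Lame_Delta lam mu u x $ j = of_real (b x) * U j x"
      using elim by (simp add: U_def)
    moreover have "Lame_Delta lam mu u x $ j = of_real mu * (\<Sum>i\<in>UNIV. Q i j x) + of_real (lam + mu) * R j x"
      by (simp add: Lame_Delta_def laplacian_def gradient_def Q_def P_def R_def V_def U_def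
          scaleR_conv_of_real[where 'a=complex])
    ultimately show ?case
      by (simp add: mult.assoc complex_norm_square[symmetric])
  qed
  have cU: "(\<lambda>x. cnj (U j x)) \<in> L2" for j by (rule L2_cnj[OF S(1)])
  have id: "- of_real mu * (\<Sum>i\<in>UNIV. of_real (sqnorm (P i j))) - of_real (lam + mu) * (\<integral>x. V x * cnj (P j j x) \<partial>lebesgue)
      = complex_of_real (\<integral>x. b x * (norm (U j x))\<^sup>2 \<partial>lebesgue)" for j
  proof -
    have i: "integrable lebesgue (\<lambda>x. Q i j x * cnj (U j x))" "integrable lebesgue (\<lambda>x. R j x * cnj (U j x))" for i
      by (intro L2_mult_integrable QL RL cU)+
    have "(\<integral>x. (of_real mu * (\<Sum>i\<in>UNIV. Q i j x) + of_real (lam + mu) * R j x) * cnj (U j x) \<partial>lebesgue) =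
        (\<integral>x. of_real mu * (\<Sum>i\<in>UNIV. Q i j x * cnj (U j x)) + of_real (lam + mu) * (R j x * cnj (U j x)) \<partial>lebesgue)"
      by (simp add: distrib_right sum_distrib_right mult.assoc)
    also have "\<dots> = of_real mu * (\<Sum>i\<in>UNIV. \<integral>x. Q i j x * cnj (U j x) \<partial>lebesgue) +
        of_real (lam + mu) * (\<integral>x. R j x * cnj (U j x) \<partial>lebesgue)"
      using i by (simp add: Bochner_Integration.integral_add Bochner_Integration.integral_sum
          Bochner_Integration.integrable_sum del: of_real_add)
    also have "\<dots> = - of_real mu * (\<Sum>i\<in>UNIV. of_real (sqnorm (P i j))) - of_real (lam + mu) * (\<integral>x. V x * cnj (P j j x) \<partial>lebesgue)"
      by (simp add: ibpQ ibpR sum_negf)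
    finally have 1: "(\<integral>x. (of_real mu * (\<Sum>i\<in>UNIV. Q i j x) + of_real (lam + mu) * R j x) * cnj (U j x) \<partial>lebesgue) = \<dots>" .
    have "(\<integral>x. (of_real mu * (\<Sum>i\<in>UNIV. Q i j x) + of_real (lam + mu) * R j x) * cnj (U j x) \<partial>lebesgue) =
        (\<integral>x. complex_of_real (b x * (norm (U j x))\<^sup>2) \<partial>lebesgue)"
      using integral_mult_cong_AE[OF comp[of j], where \<phi>="\<lambda>_. 1"] by simp
    then show ?thesis unfolding 1 by (simp only: integral_complex_of_real)
  qed
  have "(\<Sum>j\<in>UNIV. \<integral>x. V x * cnj (P j j x) \<partial>lebesgue) = (\<integral>x. V x * cnj (V x) \<partial>lebesgue)"
  proof -
    have "V x * cnj (V x) = (\<Sum>j\<in>UNIV. V x * cnj (P j j x))" for x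
      using V by (simp add: sum_distrib_left)
    moreover have "integrable lebesgue (\<lambda>x. V x * cnj (P j j x))" for j
      by (intro L2_mult_integrable VL L2_cnj S(2))
    ultimately show ?thesis by (simp add: Bochner_Integration.integral_sum)
  qed
  then have VV: "(\<Sum>j\<in>UNIV. \<integral>x. V x * cnj (P j j x) \<partial>lebesgue) = of_real (sqnorm V)"
    by (simp add: integral_mult_cnj)
  have "complex_of_real (\<Sum>j\<in>UNIV. \<integral>x. b x * (norm (U j x))\<^sup>2 \<partial>lebesgue) =
      (\<Sum>j\<in>UNIV. - of_real mu * (\<Sum>i\<in>UNIV. of_real (sqnorm (P i j))) - of_real (lam + mu) * (\<integral>x. V x * cnj (P j j x) \<partial>lebesgue))"
    by (simp only: id of_real_sum)
  also have "\<dots> = - of_real mu * (\<Sum>j\<in>UNIV. \<Sum>i\<in>UNIV. of_real (sqnorm (P i j))) - of_real (lam + mu) * of_real (sqnorm V)"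
    by (simp only: sum_subtractf sum_distrib_left[symmetric] VV)
  also have "\<dots> = of_real (- mu * (\<Sum>j\<in>UNIV. \<Sum>i\<in>UNIV. sqnorm (P i j)) - (lam + mu) * sqnorm V)"
    by simp
  finally have "(\<Sum>j\<in>UNIV. \<integral>x. b x * (norm (U j x))\<^sup>2 \<partial>lebesgue) = - mu * (\<Sum>j\<in>UNIV. \<Sum>i\<in>UNIV. sqnorm (P i j)) - (lam + mu) * sqnorm V"
    by (simp only: of_real_eq_iff)
  then show ?thesis by (simp add: U_def P_def V_def)
qed

text \<open>The d-th root of \<open>gagliardo_nirenberg\<close>, after every directional derivative
  has been estimated by the full gradient so that the product becomes a d-th power.\<close>

lemma weighted_L2_bound:
  fixes v :: "(real^'n::finite) \<Rightarrow> complex"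
  assumes v: "v \<in> L2" "\<And>i. w i \<in> L2" "\<And>i. has_weak_partial i v (w i)"
    and n: "n \<in> borel_measurable lebesgue" "\<And>x. n x \<ge> 0" "AE x in lebesgue. n x \<le> C" "n \<in> Lp (real CARD('n))"
  shows "(\<integral>x. n x * (norm (v x))\<^sup>2 \<partial>lebesgue) \<le>
    Lp_norm (real CARD('n)) n * (2 * sqrt (sqnorm v * (\<Sum>i\<in>UNIV. sqnorm (w i))))"
proof -
  obtain m where m: "m \<in> borel_measurable borel" and mn: "AE x in lebesgue. n x = m x"
    using completion_ex_borel_measurable_real[OF n(1)] AE_completion by fastforce
  define C' where "C' = max C 0"
  \<comment> \<open>A Borel representative agrees with n only almost everywhere and may violate its
    bounds on a null set. Clamping enforces them everywhere and changes nothing where they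
    hold.\<close>
  define a where "a x = min (max (m x) 0) C'" for x
  have a: "a \<in> borel_measurable borel" "\<And>x. a x \<ge> 0" "\<And>x. a x \<le> C'"
  proof -
    show "a \<in> borel_measurable borel" unfolding a_def [abs_def] using m by simp
  qed (auto simp: a_def C'_def)
  have na: "AE x in lebesgue. n x = a x"
    using mn n(3)
  proof eventually_elim
    case (elim x)
    with n(2)[of x] show ?case by (simp add: a_def C'_def)
  qed
  have am: "a \<in> borel_measurable lebesgue" by (rule borel_imp_lebesgue_measurable[OF a(1)])
  have pw: "norm (n x) powr real CARD('n) = n x ^ CARD('n)" for x
    using n(2)[of x] by (simp add: powr_realpow')
  have ni: "integrable lebesgue (\<lambda>x. n x ^ CARD('n))"
    using n(4) unfolding Lp_def mem_Collect_eq pw by simp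
  have ae: "AE x in lebesgue. n x ^ CARD('n) = a x ^ CARD('n)" using na by eventually_elim simp
  have ai: "integrable lebesgue (\<lambda>x. a x ^ CARD('n))"
    using ni integrable_cong_AE[OF _ _ ae] n(1) am by simp
  have Nint: "(\<integral>x. n x ^ CARD('n) \<partial>lebesgue) = (\<integral>x. a x ^ CARD('n) \<partial>lebesgue)"
    using n(1) am by (intro integral_cong_AE ae) simp_all
  define N where "N = Lp_norm (real CARD('n)) n"
  have N: "N \<ge> 0" "N ^ CARD('n) = (\<integral>x. a x ^ CARD('n) \<partial>lebesgue)"
  proof -
    have I: "(\<integral>x. n x ^ CARD('n) \<partial>lebesgue) \<ge> 0" using n(2) by simp
    show "N \<ge> 0" by (simp add: N_def Lp_norm_def)
    have "N ^ CARD('n) = N powr real CARD('n)" by (simp add: powr_realpow' \<open>N \<ge> 0\<close>)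
    also have "\<dots> = (\<integral>x. n x ^ CARD('n) \<partial>lebesgue)"
      using I unfolding N_def Lp_norm_def pw by (simp add: powr_powr)
    finally show "N ^ CARD('n) = (\<integral>x. a x ^ CARD('n) \<partial>lebesgue)" by (simp add: Nint)
  qed
  define Y where "Y = (\<Sum>i\<in>UNIV. sqnorm (w i))"
  have Y: "sqnorm (w i) \<le> Y" for i unfolding Y_def by (rule member_le_sum) (auto simp: sqnorm_nonneg)
  have "(\<integral>x. a x * (norm (v x))\<^sup>2 \<partial>lebesgue) ^ CARD('n) \<le>
      N ^ CARD('n) * (\<Prod>i\<in>UNIV. 2 * sqrt (sqnorm v * sqnorm (w i)))"
    unfolding N(2) by (rule gagliardo_nirenberg[OF v a ai])
  also have "\<dots> \<le> N ^ CARD('n) * (\<Prod>i\<in>(UNIV :: 'n set). 2 * sqrt (sqnorm v * Y))"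
    using N(1) Y by (intro mult_left_mono prod_mono) (auto intro!: mult_left_mono simp: sqnorm_nonneg)
  also have "\<dots> = (N * (2 * sqrt (sqnorm v * Y))) ^ CARD('n)"
    by (simp add: power_mult_distrib)
  finally have "(\<integral>x. a x * (norm (v x))\<^sup>2 \<partial>lebesgue) \<le> N * (2 * sqrt (sqnorm v * Y))"
  \<comment> \<open>The cancellation rule is stated for exponents of the form \<open>Suc n\<close>,
    hence the index d - 1.\<close>
  proof (rule power_le_imp_le_base[of _ "CARD('n) - 1", simplified])
    have "Y \<ge> 0" unfolding Y_def by (intro sum_nonneg sqnorm_nonneg)
    then show "0 \<le> N * (2 * sqrt (sqnorm v * Y))"
      using N(1) by (simp add: sqnorm_nonneg)
  qed
  moreover have "(\<integral>x. n x * (norm (v x))\<^sup>2 \<partial>lebesgue) = (\<integral>x. a x * (norm (v x))\<^sup>2 \<partial>lebesgue)"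
    using n(1) am L2_measurable[OF v(1)]
    by (intro integral_cong_AE) (simp_all, use na in eventually_elim, simp)
  ultimately show ?thesis by (simp add: N_def Y_def)
qed

text \<open>One statement serves both signs: by the pointwise inequality, |r| n dominates the
  negative part of r a, the only part of the damping term that can offset the positive terms of the
  energy identity.\<close>

lemma damped_wave_no_real_eigenvalue:
  fixes a n :: "real^'n::finite \<Rightarrow> real"
  assumes mu: "mu > 0" "lam + mu \<ge> 0" and "r \<noteq> 0" and a: "a \<in> Linfty"
    and n: "n \<in> borel_measurable lebesgue" "\<And>x. 0 \<le> n x" "\<And>x. n x \<le> \<bar>a x\<bar>"
      "\<And>x. - (\<bar>r\<bar> * n x) \<le> r * a x" "n \<in> Lp (real CARD('n))"
    and small: "Lp_norm (real CARD('n)) n < sqrt mu"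
  shows "\<not> damped_wave_eigenvalue lam mu (scalar_damping a) (complex_of_real r)"
proof
  assume "damped_wave_eigenvalue lam mu (scalar_damping a) (complex_of_real r)"
  then obtain u \<psi> where dom: "(u, \<psi>) \<in> damped_wave_domain"
    and nz: "\<not> (AE x in lebesgue. u x = 0 \<and> \<psi> x = 0)"
    and e1: "AE x in lebesgue. \<psi> x = complex_of_real r *s u x"
    and e2: "AE x in lebesgue. Lame_Delta lam mu u x - scalar_damping a x *v \<psi> x = complex_of_real r *s \<psi> x"
    by (auto simp: damped_wave_eigenvalue_def damped_wave_def)
  have u: "u \<in> vector_fields (Sobolev 2)" using dom by (simp add: damped_wave_domain_def)
  obtain C where am: "a \<in> borel_measurable lebesgue" and C: "AE x in lebesgue. \<bar>a x\<bar> \<le> C"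
    using a by (auto simp: Linfty_def)
  \<comment> \<open>Inserting \<psi> = r u into the second equation leaves the Lame equation for u
    alone, with this potential.\<close>
  define b where "b x = r * a x + r\<^sup>2" for x
  have b: "b \<in> borel_measurable lebesgue" "AE x in lebesgue. \<bar>b x\<bar> \<le> \<bar>r\<bar> * C + r\<^sup>2"
  proof -
    show "b \<in> borel_measurable lebesgue" unfolding b_def [abs_def] using am by simp
    show "AE x in lebesgue. \<bar>b x\<bar> \<le> \<bar>r\<bar> * C + r\<^sup>2"
      using C
    proof eventually_elim
      case (elim x)
      have "\<bar>b x\<bar> \<le> \<bar>r * a x\<bar> + \<bar>r\<^sup>2\<bar>" unfolding b_def by (rule abs_triangle_ineq)
      also have "\<dots> \<le> \<bar>r\<bar> * C + r\<^sup>2" using elim by (simp add: abs_mult mult_left_mono)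
      finally show ?case .
    qed
  qed
  have "AE x in lebesgue. Lame_Delta lam mu u x = of_real (b x) *s u x"
    using e1 e2
  proof eventually_elim
    case (elim x)
    have "scalar_damping a x *v \<psi> x = of_real (a x) *s \<psi> x"
      by (simp add: scalar_damping_def vec_eq_iff matrix_vector_mult_def mat_def if_distrib if_distribR cong: if_cong)
    with elim have "Lame_Delta lam mu u x = complex_of_real r *s \<psi> x + of_real (a x) *s \<psi> x"
      by (metis diff_add_cancel)
    with elim(1) show ?case
      by (simp add: vec_eq_iff b_def algebra_simps power2_eq_square)
  qed
  note energy = Lame_energy_identity[OF u b this]
  define U where "U j = (\<lambda>y. u y $ j)" for j
  define X where "X j = sqnorm (U j)" for j
  define Y where "Y j = (\<Sum>i\<in>UNIV. sqnorm (weak_partial i (U j)))" for j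
  define Z where "Z j = (\<integral>x. n x * (norm (U j x))\<^sup>2 \<partial>lebesgue)" for j
  define N where "N = Lp_norm (real CARD('n)) n"
  \<comment> \<open>The bound of the damping term relative to the form \<mu> |grad u|^2 + r^2 |u|^2;
    the smallness assumption says exactly that it is below 1.\<close>
  define \<theta> where "\<theta> = N / sqrt mu"
  have N0: "N \<ge> 0" by (simp add: N_def Lp_norm_def)
  have \<theta>: "\<theta> < 1" "\<theta> \<ge> 0" using small mu(1) N0 by (simp_all add: \<theta>_def N_def)
  have US: "U j \<in> Sobolev (Suc (Suc 0))" for j
    using u by (simp add: vector_fields_def U_def numeral_2_eq_2)
  note S = Sobolev_2D[OF US]
  have nC: "AE x in lebesgue. n x \<le> C" using C by eventually_elim (use n(3) order_trans in blast)
  have X0: "X j \<ge> 0" and Y0: "Y j \<ge> 0" for j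
    by (auto simp: X_def Y_def intro!: sum_nonneg sqnorm_nonneg)
  have Z: "\<bar>r\<bar> * Z j \<le> \<theta> * (mu * Y j + r\<^sup>2 * X j)" for j
  proof -
    have "Z j \<le> N * (2 * sqrt (X j * Y j))"
      unfolding Z_def N_def X_def Y_def
      by (rule weighted_L2_bound[OF S(1) S(2) S(3) n(1,2) nC n(5)])
    then have "\<bar>r\<bar> * Z j \<le> \<bar>r\<bar> * (N * (2 * sqrt (X j * Y j)))"
      by (rule mult_left_mono) simp
    also have "\<dots> = \<theta> * (2 * (\<bar>r\<bar> * sqrt (X j)) * (sqrt mu * sqrt (Y j)))"
      using mu(1) by (simp add: \<theta>_def real_sqrt_mult)
    \<comment> \<open>The factors are grouped so that their squares are the two terms of the form;
      this is why \<theta> does not depend on r.\<close>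
    also have "\<dots> \<le> \<theta> * ((\<bar>r\<bar> * sqrt (X j))\<^sup>2 + (sqrt mu * sqrt (Y j))\<^sup>2)"
      by (intro mult_left_mono sum_squares_bound \<theta>)
    also have "\<dots> = \<theta> * (mu * Y j + r\<^sup>2 * X j)"
      using mu(1) X0[of j] Y0[of j] by (simp add: power_mult_distrib)
    finally show ?thesis .
  qed
  have bZ: "(\<integral>x. b x * (norm (U j x))\<^sup>2 \<partial>lebesgue) \<ge> r\<^sup>2 * X j - \<bar>r\<bar> * Z j" for j
  proof -
    have bi: "integrable lebesgue (\<lambda>x. f x * (norm (U j x))\<^sup>2)"
      if "f \<in> borel_measurable lebesgue" "AE x in lebesgue. \<bar>f x\<bar> \<le> K" for f K
    proof (rule Bochner_Integration.integrable_bound)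
      show "integrable lebesgue (\<lambda>x. \<bar>K\<bar> * (norm (U j x))\<^sup>2)"
        by (intro integrable_mult_right L2_integrable S(1))
      show "(\<lambda>x. f x * (norm (U j x))\<^sup>2) \<in> borel_measurable lebesgue"
        using that(1) L2_measurable[OF S(1)] by simp
      show "AE x in lebesgue. norm (f x * (norm (U j x))\<^sup>2) \<le> norm (\<bar>K\<bar> * (norm (U j x))\<^sup>2)"
        using that(2) by eventually_elim (auto simp: abs_mult intro!: mult_right_mono)
    qed
    have ni: "integrable lebesgue (\<lambda>x. n x * (norm (U j x))\<^sup>2)"
      by (rule bi[OF n(1), of C]) (use nC n(2) in simp)
    have Ui: "integrable lebesgue (\<lambda>x. (norm (U j x))\<^sup>2)" by (rule L2_integrable[OF S(1)])
    have "r\<^sup>2 * X j - \<bar>r\<bar> * Z j = (\<integral>x. r\<^sup>2 * (norm (U j x))\<^sup>2 - \<bar>r\<bar> * (n x * (norm (U j x))\<^sup>2) \<partial>lebesgue)"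
      unfolding X_def Z_def sqnorm_def using ni Ui by simp
    also have "\<dots> \<le> (\<integral>x. b x * (norm (U j x))\<^sup>2 \<partial>lebesgue)"
    proof (rule integral_mono)
      show "integrable lebesgue (\<lambda>x. r\<^sup>2 * (norm (U j x))\<^sup>2 - \<bar>r\<bar> * (n x * (norm (U j x))\<^sup>2))"
        using ni Ui by simp
      show "integrable lebesgue (\<lambda>x. b x * (norm (U j x))\<^sup>2)" by (rule bi[OF b])
      fix x
      have "(r\<^sup>2 - \<bar>r\<bar> * n x) * (norm (U j x))\<^sup>2 \<le> b x * (norm (U j x))\<^sup>2"
        using n(4)[of x] by (intro mult_right_mono) (auto simp: b_def)
      then show "r\<^sup>2 * (norm (U j x))\<^sup>2 - \<bar>r\<bar> * (n x * (norm (U j x))\<^sup>2) \<le> b x * (norm (U j x))\<^sup>2"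
        by (simp add: left_diff_distrib mult.assoc)
    qed
    finally show ?thesis .
  qed
  define T where "T = (\<Sum>j\<in>UNIV. mu * Y j + r\<^sup>2 * X j)"
  \<comment> \<open>What the damping leaves of the form is bounded by the energy without its
    divergence term, and the energy identity makes that nonpositive. Since \<theta> is below 1, the
    form itself is nonpositive.\<close>
  have "(1 - \<theta>) * T = (\<Sum>j\<in>UNIV. mu * Y j + (r\<^sup>2 * X j - \<theta> * (mu * Y j + r\<^sup>2 * X j)))"
    by (simp add: T_def left_diff_distrib sum_subtractf sum_distrib_left sum.distrib algebra_simps)
  also have "\<dots> \<le> (\<Sum>j\<in>UNIV. mu * Y j + (\<integral>x. b x * (norm (U j x))\<^sup>2 \<partial>lebesgue))"
    by (intro sum_mono add_left_mono) (use Z bZ in \<open>smt (verit)\<close>)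
  also have "\<dots> = mu * (\<Sum>j\<in>UNIV. Y j) + (\<Sum>j\<in>UNIV. \<integral>x. b x * (norm (U j x))\<^sup>2 \<partial>lebesgue)"
    by (simp add: sum.distrib sum_distrib_left)
  also have "\<dots> = - ((lam + mu) * sqnorm (divergence u))"
    using energy by (simp add: U_def Y_def)
  also have "\<dots> \<le> 0"
    using mu(2) by (simp add: sqnorm_nonneg)
  finally have "T \<le> 0" using \<theta>(1) by (simp add: mult_le_0_iff)
  have nonneg: "mu * Y j + r\<^sup>2 * X j \<ge> 0" for j
    using mu(1) X0 Y0 by (simp add: add_nonneg_nonneg)
  have "X j = 0" for j
  proof -
    have "mu * Y j + r\<^sup>2 * X j \<le> T" unfolding T_def by (rule member_le_sum) (auto intro: nonneg)
    moreover have "mu * Y j \<ge> 0" using mu(1) Y0 by simp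
    ultimately have "r\<^sup>2 * X j \<le> 0" using \<open>T \<le> 0\<close> by linarith
    then show ?thesis using \<open>r \<noteq> 0\<close> X0[of j] by (simp add: mult_le_0_iff)
  qed
  then have "AE x in lebesgue. U j x = 0" for j
    by (intro sqnorm_eq_0_AE S(1)) (simp add: X_def)
  then have "AE x in lebesgue. \<forall>j. U j x = 0" by (subst AE_all_countable) auto
  \<comment> \<open>The second component vanishes with the first, being r times it.\<close>
  then have "AE x in lebesgue. u x = 0 \<and> \<psi> x = 0"
    using e1 by eventually_elim (simp add: U_def vec_eq_iff)
  with nz show False ..
qed

theorem corollary1p1:
  fixes lam mu :: real
  assumes "CARD('n::finite) \<ge> 2" and "mu > 0" and "lam + mu \<ge> 0"
  shows "\<exists>c>0. \<forall>a :: real^'n \<Rightarrow> real. a \<in> Linfty \<longrightarrow>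
     (neg_part a \<in> Lp (real CARD('n)) \<and>
        c * Lp_norm (real CARD('n)) (neg_part a) ^ CARD('n) < 1 \<longrightarrow>
        \<not> (\<exists>r::real. r > 0 \<and> damped_wave_eigenvalue lam mu (scalar_damping a) (complex_of_real r))) \<and>
     (pos_part a \<in> Lp (real CARD('n)) \<and>
        c * Lp_norm (real CARD('n)) (pos_part a) ^ CARD('n) < 1 \<longrightarrow>
        \<not> (\<exists>r::real. r < 0 \<and> damped_wave_eigenvalue lam mu (scalar_damping a) (complex_of_real r)))"
proof (intro exI[of _ "1 / sqrt mu ^ CARD('n)"] conjI allI impI)
  show "1 / sqrt mu ^ CARD('n) > 0" using assms(2) by simp
  \<comment> \<open>With this constant the assumption on the d-th power of the norm is the
    comparison of the norm itself with sqrt \<mu>.\<close>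
  have small: "N < sqrt mu" if "1 / sqrt mu ^ CARD('n) * N ^ CARD('n) < 1" for N
  proof -
    have "N ^ CARD('n) < sqrt mu ^ CARD('n)" using that assms(2) by (simp add: divide_simps)
    then show ?thesis by (rule power_less_imp_less_base) (use assms(2) in simp)
  qed
  fix a :: "real^'n \<Rightarrow> real"
  assume a: "a \<in> Linfty"
  show "\<not> (\<exists>r::real. r > 0 \<and> damped_wave_eigenvalue lam mu (scalar_damping a) (complex_of_real r))"
    if "neg_part a \<in> Lp (real CARD('n)) \<and>
      1 / sqrt mu ^ CARD('n) * Lp_norm (real CARD('n)) (neg_part a) ^ CARD('n) < 1"
  proof clarify
    fix r :: real
    assume r: "r > 0" and ev: "damped_wave_eigenvalue lam mu (scalar_damping a) (complex_of_real r)"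
    have "\<not> damped_wave_eigenvalue lam mu (scalar_damping a) (complex_of_real r)"
    proof (rule damped_wave_no_real_eigenvalue[OF assms(2,3) _ a, where n="neg_part a"])
      show "neg_part a \<in> borel_measurable lebesgue" using that by (simp add: Lp_def)
      show "- (\<bar>r\<bar> * neg_part a x) \<le> r * a x" for x
        using r by (auto simp: neg_part_def max_def mult_le_0_iff)
    qed (use r that small in \<open>auto simp: neg_part_def\<close>)
    with ev show False by simp
  qed
  show "\<not> (\<exists>r::real. r < 0 \<and> damped_wave_eigenvalue lam mu (scalar_damping a) (complex_of_real r))"
    if "pos_part a \<in> Lp (real CARD('n)) \<and>
      1 / sqrt mu ^ CARD('n) * Lp_norm (real CARD('n)) (pos_part a) ^ CARD('n) < 1"
  proof clarify
    fix r :: real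
    assume r: "r < 0" and ev: "damped_wave_eigenvalue lam mu (scalar_damping a) (complex_of_real r)"
    have "\<not> damped_wave_eigenvalue lam mu (scalar_damping a) (complex_of_real r)"
    proof (rule damped_wave_no_real_eigenvalue[OF assms(2,3) _ a, where n="pos_part a"])
      show "pos_part a \<in> borel_measurable lebesgue" using that by (simp add: Lp_def)
      show "- (\<bar>r\<bar> * pos_part a x) \<le> r * a x" for x
        using r by (auto simp: pos_part_def max_def mult_le_0_iff)
    qed (use r that small in \<open>auto simp: pos_part_def\<close>)
    with ev show False by simp
  qed
qed

end
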